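(* There exist absolute positive constants $c_0,c_1$ and $K'$ for which the following holds. Assume that for every $f\in\mathcal{F}$, $\ell_f(Z)\ge0$ almost surely, and that there are nondecreasing functions $\phi_n$ and $B_n$ of $r\ge 0$ such that for every $r\ge0$ and every $f\in F_r$, $$b_n(\ell_{F_r})\le\phi_n(r)\quad\text{and}\quad P\ell_f^2\le B_n(r)P\ell_f+B_n^2(r)/n.$$ Let $0<\epsilon<1/2$, for every $r\ge0$ let $\lambda_\epsilon^*(r)>0$ be such that $$\mathbb{E}\|P_n-P\|_{V(\ell_{F_r})_{\lambda_\epsilon^*(r)}}\le(\epsilon/4)\lambda_\epsilon^*(r),$$ and let $\rho_n:\mathbb{R}_+\times\mathbb{R}_+^*\to\mathbb{R}$ be nondecreasing in its first argument and such that for any $r\ge0$ and $x>0$, $$\rho_n(r,x)\ge\max\Big(\lambda_\epsilon^*(r),\ c_0\frac{(\phi_n(r)+B_n(r)/\epsilon)(x+1)}{n\epsilon}\Big).$$ Assume that one of the following two cases holds: (i) there exists $C_n>0$ such that $\mathrm{crit}(f)\le C_n$ for every $f\in\mathcal{F}$; in this case put $\alpha_n(\epsilon,x)=C_n$ for all $0<\epsilon<1/2$ and $x>0$; (ii) $\lambda_\epsilon^*(r)\to\infty$ as $r\to\infty$ and there exists $K_1>0$ such that $2\rho_n(r,x)\le\rho_n(K_1(r+1),x)$ for all $r\ge0$ and $x>0$; in this case let $f_0$ be any function in $\bigcup_{r\ge0}F_r$ and let $\alpha_n$ be such that for every $x>0$ and $0<\epsilon<1/2$, $$\alpha_n(\epsilon,x)\ge\max\Big[K_1(\mathrm{crit}(f_0)+2),\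 (\lambda_\epsilon^* )^{-1}\Big((1+2\epsilon)\Big(3R(f_0)+2K'\big(b_n(\ell_{f_0})+B_n(\mathrm{crit}(f_0))\big)\frac{x+1}{n}\Big)\Big)\Big].$$ Then for every $x>0$ and $$\hat f_n^{\mathrm{RERM}}\in\mathop{\mathrm{Arg\,min}}_{f\in\mathcal{F}}\Big(R_n(f)+\frac{2}{1+2\epsilon}\rho_n\big(\mathrm{crit}(f)+1,\,x+\log\alpha_n(\epsilon,x)\big)\Big),$$ with probability greater than $1-12\exp(-x)$, $$R(\hat f_n^{\mathrm{RERM}})+\rho_n\big(\mathrm{crit}(\hat f_n^{\mathrm{RERM}})+1,\,x+\log\alpha_n(\epsilon,x)\big)$$ $$\le\inf_{f\in\mathcal{F}}\Big[(1+3\epsilon)R(f)+2\rho_n\big(\mathrm{crit}(f)+1,\,x+\log\alpha_n(\epsilon,x)\big)+c_1\frac{(b_n(\ell_f)+B_n(\mathrm{crit}(f))/\epsilon)(x+1)}{n\epsilon}\Big].$$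
   Context: Let $\mathcal{Z}$ be a space endowed with a probability measure $P$, and let $Z,Z_1,\dots,Z_n$ be independent random variables with values in $\mathcal{Z}$ distributed according to $P$; $\mathcal{D}=(Z_1,\dots,Z_n)$ is the data. A loss function $\ell$ associates a real number $\ell(f,z)$ to any real-valued measurable function $f$ on $\mathcal{Z}$ and any $z\in\mathcal{Z}$; write $\ell_f=\ell(f,\cdot)$. The risk is $R(f)=\mathbb{E}\,\ell_f(Z)$ and the empirical risk is $R_n(f)=\frac1n\sum_{i=1}^n\ell_f(Z_i)$. For a data-dependent function $\hat f_n$, $R(\hat f_n)=\mathbb{E}[\ell_{\hat f_n}(Z)\mid\mathcal{D}]$. $\mathcal{F}$ is a class of real-valued measurable functions on $\mathcal{Z}$, $\mathrm{crit}:\mathcal{F}\to\mathbb{R}^+$ is a given function (the criterion), and for $r\ge0$, $F_r=\{f\in\mathcal{F}:\mathrm{crit}(f)\le r\}$ and $\ell_{F_r}=\{\ell_f:f\in F_r\}$. If the infimum of the regularized empirical risk defining $\hat f_n^{\mathrm{RERM}}$ is not attained, the Arg min is understood with the obvious extension: $\hat f_n^{\mathrm{RERM}}$ is an element of $\mathcal{F}$ whose regularized empirical risk is at most the infimum plus $1/n$. For a function $g$ on $\mathcal{Z}$, $Pg=\mathbb{E}g(Z)$ and $P_ng=\frac1n\sum_{i=1}^ng(Z_i)$. For a class $G$ of real-valued functions on $\mathcal{Z}$: - $\|P-P_n\|_G=\sup_{g\in G}|(P-P_n)(g)|$; - the $\psi_1$ norm of a random variable $U$ is $\|U\|_{\psi_1}=\inf\{c>0:\mathbb{E}\exp(|U|/c)\le2\}$;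 - $b_n(G)=\big\|\max_{1\le i\le n}\sup_{g\in G}|g(Z_i)|\big\|_{\psi_1}$, and for a single function $g$, $b_n(g)=\big\|\max_{1\le i\le n}|g(Z_i)|\big\|_{\psi_1}$; - $V(G)=\{\theta g:0\le\theta\le1,\ g\in G\}$, and for $\lambda\ge0$, $V(G)_\lambda=\{h\in V(G):Ph\le\lambda\}$. $(\lambda_\epsilon^* )^{-1}$ is the generalized inverse $(\lambda_\epsilon^* )^{-1}(y)=\sup\{r>0:\lambda_\epsilon^*(r)\le y\}$, $y>0$. $\mathbb{R}_+=[0,\infty)$, $\mathbb{R}_+^*=(0,\infty)$. Separability (standing assumption): each indexing class $G=V(\ell_{F_r})_\lambda$, $r\ge0,\lambda>0$, contains a countable subset $G_0$ such that every $g\in G$ is the pointwise limit on $\mathcal{Z}$ of a sequence of elements of $G_0$.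
   Formalization: In case (i) α_n is max(1,C_n), since the claim can fail for C_n<1; if the minimum is not attained, the bound for 1/n-minimisers carries an extra c_1/n, without which it can fail; B_n≥0 is assumed; constants are absolute for given underlying sets, hence overall by a disjoint union. *)

theory Defs
  imports "HOL-Probability.Probability"
begin

definition exp_ennreal :: "ennreal \<Rightarrow> ennreal" where
  "exp_ennreal u = (if u = \<top> then \<top> else ennreal (exp (enn2real u)))"

(* The argument plays the role of |U|; it may take the value infinity, as an uncountable
   supremum can. The norm is infinite if no admissible c exists (infimum of the empty set). *)
definition psi1_norm :: "'w measure \<Rightarrow> ('w \<Rightarrow> ennreal) \<Rightarrow> ereal" where
  "psi1_norm M U =
     (INF c\<in>{c::real. 0 < c \<and> (\<integral>\<^sup>+\<omega>. exp_ennreal (U \<omega> / ennreal c) \<partial>M) \<le> 2}. ereal c)"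

definition b_class ::
  "'w measure \<Rightarrow> (nat \<Rightarrow> 'w \<Rightarrow> 'z) \<Rightarrow> nat \<Rightarrow> ('z \<Rightarrow> real) set \<Rightarrow> ereal" where
  "b_class M Z n G =
     psi1_norm M (\<lambda>\<omega>. MAX i\<in>{1..n}. SUP g\<in>G. ennreal \<bar>g (Z i \<omega>)\<bar>)"

definition b_fun ::
  "'w measure \<Rightarrow> (nat \<Rightarrow> 'w \<Rightarrow> 'z) \<Rightarrow> nat \<Rightarrow> ('z \<Rightarrow> real) \<Rightarrow> ereal" where
  "b_fun M Z n g = psi1_norm M (\<lambda>\<omega>. MAX i\<in>{1..n}. ennreal \<bar>g (Z i \<omega>)\<bar>)"

definition sample :: "(nat \<Rightarrow> 'w \<Rightarrow> 'z) \<Rightarrow> nat \<Rightarrow> 'w \<Rightarrow> nat \<Rightarrow> 'z" where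
  "sample Z n \<omega> = (\<lambda>i\<in>{1..n}. Z i \<omega>)"

definition mean :: "'z measure \<Rightarrow> ('z \<Rightarrow> real) \<Rightarrow> real" where
  "mean P g = (\<integral>z. g z \<partial>P)"

definition emp_mean :: "nat \<Rightarrow> (nat \<Rightarrow> 'z) \<Rightarrow> ('z \<Rightarrow> real) \<Rightarrow> real" where
  "emp_mean n d g = (\<Sum>i=1..n. g (d i)) / real n"

definition sup_dev ::
  "'z measure \<Rightarrow> nat \<Rightarrow> (nat \<Rightarrow> 'z) \<Rightarrow> ('z \<Rightarrow> real) set \<Rightarrow> ennreal" where
  "sup_dev P n d G = (SUP g\<in>G. ennreal \<bar>mean P g - emp_mean n d g\<bar>)"

definition star_hull :: "('z \<Rightarrow> real) set \<Rightarrow> ('z \<Rightarrow> real) set" where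
  "star_hull G = {\<lambda>z. \<theta> * g z | \<theta> g. 0 \<le> \<theta> \<and> \<theta> \<le> 1 \<and> g \<in> G}"

definition star_level ::
  "'z measure \<Rightarrow> ('z \<Rightarrow> real) set \<Rightarrow> real \<Rightarrow> ('z \<Rightarrow> real) set" where
  "star_level P G l = {h \<in> star_hull G. mean P h \<le> l}"

definition crit_ball ::
  "('z \<Rightarrow> real) set \<Rightarrow> (('z \<Rightarrow> real) \<Rightarrow> real) \<Rightarrow> real \<Rightarrow> ('z \<Rightarrow> real) set" where
  "crit_ball F crit r = {f \<in> F. crit f \<le> r}"

definition pointwise_separable :: "'z measure \<Rightarrow> ('z \<Rightarrow> real) set \<Rightarrow> bool" where
  "pointwise_separable P G \<longleftrightarrow>
     (\<exists>G0 \<subseteq> G. countable G0 \<and>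
       (\<forall>g\<in>G. \<exists>s :: nat \<Rightarrow> 'z \<Rightarrow> real. range s \<subseteq> G0 \<and>
          (\<forall>z\<in>space P. (\<lambda>k. s k z) \<longlonglongrightarrow> g z)))"

(* Inserting 0 fixes the convention that the supremum of the empty set is 0. *)
definition gen_inverse :: "(real \<Rightarrow> real) \<Rightarrow> real \<Rightarrow> real" where
  "gen_inverse L y = Sup (insert 0 {r. 0 < r \<and> L r \<le> y})"

definition min_attained :: "'f set \<Rightarrow> ('f \<Rightarrow> real) \<Rightarrow> bool" where
  "min_attained F J \<longleftrightarrow> (\<exists>f\<in>F. \<forall>g\<in>F. J f \<le> J g)"

(* Exact minimisers when the minimum is attained, 1/n-approximate ones otherwise. *)
definition Arg_Min :: "nat \<Rightarrow> 'f set \<Rightarrow> ('f \<Rightarrow> real) \<Rightarrow> 'f set" where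
  "Arg_Min n F J =
     (if min_attained F J then {f \<in> F. \<forall>g\<in>F. J f \<le> J g}
      else {f \<in> F. J f \<le> (INF g\<in>F. J g) + 1 / real n})"

end

theory Submission
  imports Defs
begin

text \<open>
  The core is a tail bound for \<open>S = sup\<^bsub>g\<^esub> \<Sum>\<^sub>i g(Z\<^sub>i)\<close> over bounded centred classes, by the
  entropy method. Entropy tensorizes, and comparing \<open>S\<close> with the leave-one-out suprema
  \<open>S\<^sub>k\<close>, for which \<open>\<Sum>\<^sub>k (S - S\<^sub>k) \<le> S\<close>, yields a differential inequality for the
  moment generating function in which only the weak variance \<open>sup\<^bsub>g\<^esub> P g\<^sup>2\<close> enters.
  Unbounded classes are truncated at twice the level \<open>c\<close> of the \<open>\<psi>\<^sub>1\<close> envelope: since the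
  \<open>Z\<^sub>i\<close> are i.i.d., integrability of \<open>exp(max\<^sub>i Y\<^sub>i / c)\<close> forces
  \<open>n E(exp(Y / c) - 1) \<le> 2\<close> for the excess \<open>Y\<close> over the truncation level, so the excesses
  have a sum with exponential tails.

  Applied to the star-shaped hulls localized at level \<open>\<rho>\<close>, the bound makes \<open>P\<close> and \<open>P\<^sub>n\<close>
  comparable on each ball \<open>F\<^sub>r\<close>; peeling over integer \<open>r \<le> \<alpha>\<close> costs the term \<open>log \<alpha>\<close>.
  The minimality of \<open>f\<close>-hat, tested against a near-minimizer of the right-hand side, then gives
  the oracle inequality. In the unbounded case, testing against \<open>f\<^sub>0\<close> confines \<open>crit\<close> of
  \<open>f\<close>-hat to \<open>[0, \<alpha>]\<close>. An approximate minimizer may escape, but only with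
  \<open>\<rho> \<le> 6/n\<close>, and one additional ball covers that case at a cost of order \<open>1/n\<close>.
\<close>

section \<open>Tensorization of entropy\<close>

text \<open>Two obstacles shape the proof. Losses are unbounded, and bounding the sample maximum
  coordinate by coordinate would cost a factor log n; the psi_1 norm is therefore applied to the
  maximum itself, and independence converts it into a bound for the sum of the excesses. Moreover,
  suprema over the classes need not be measurable. Each tail estimate is thus made for a finite
  subclass, with constants free of its cardinality, and passes to a countable dense subclass along
  increasing events; results are stated as a measurable exceptional set outside which the inequality
  holds. The constants are not optimized. The tail bound asks for the factor 1000; localization
  doubles it to 2000, which leaves room for a strict inequality below the envelope level and for
  both parts of the variance. The 12 is 8 for peeling, 2 for the comparison function, 2 for
  localization. All deviations are taken at \<open>x + 1\<close>, so that the parameter is at least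
  1 and the final probability bound is strict.\<close>

text \<open>The Bregman divergence of \<open>t * ln t\<close>: the correction \<open>u - f\<close>
  makes the relative entropy integrand pointwise nonnegative even for functions that are not
  normalized.\<close>

definition ent_div :: "real \<Rightarrow> real \<Rightarrow> real" where
  "ent_div f u = f * ln (f / u) - f + u"

text \<open>With \<open>q = a / c\<close> the left side is linear in \<open>(f, u)\<close> and
  touches the divergence where \<open>f / u = q\<close>. The divergence is thus a supremum of linear
  functions, hence jointly convex. The inequality is \<open>ln s \<le> s - 1\<close> at
  \<open>s = u * a / (f * c)\<close>.\<close>

lemma ent_div_tangent:
  assumes "0 < f" "0 < u" "0 < a" "0 < c"
  shows "f * ln (a / c) + u * (1 - a / c) \<le> ent_div f u"
proof -
  have "f * ln (u * a / (f * c)) \<le> f * (u * a / (f * c) - 1)"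
    using assms by (intro mult_left_mono ln_le_minus_one) auto
  also have "\<dots> = u * a / c - f"
    using assms by (simp add: field_simps)
  finally show ?thesis
    using assms unfolding ent_div_def by (simp add: ln_mult ln_div algebra_simps)
qed

lemma ent_div_nonneg: "0 < f \<Longrightarrow> 0 < u \<Longrightarrow> 0 \<le> ent_div f u"
  using ent_div_tangent[of f u 1 1] by simp

lemma ent_div_le:
  assumes "0 < a" "f \<in> {a..b}" "u \<in> {a..b}"
  shows "ent_div f u \<le> b * (b / a) + b"
proof -
  have "f * ln (f / u) \<le> f * (f / u)"
    using assms ln_le_minus_one[of "f / u"] by (intro mult_left_mono) auto
  also have "\<dots> \<le> b * (b / a)"
    using assms by (intro mult_mono frac_le) auto
  finally show ?thesis
    using assms unfolding ent_div_def by auto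
qed

lemma xlnx_range:
  fixes t :: real
  assumes "0 < a" "t \<in> {a..b}"
  shows "\<bar>t * ln t\<bar> \<le> b * (\<bar>ln a\<bar> + \<bar>ln b\<bar>)"
proof -
  have "ln a \<le> ln t" "ln t \<le> ln b" using assms by auto
  then have "\<bar>ln t\<bar> \<le> \<bar>ln a\<bar> + \<bar>ln b\<bar>" by linarith
  then show ?thesis
    unfolding abs_mult using assms by (intro mult_mono) auto
qed

lemma measurable_ent_div [measurable]:
  assumes [measurable]: "f \<in> borel_measurable N" "u \<in> borel_measurable N"
  shows "(\<lambda>x. ent_div (f x) (u x)) \<in> borel_measurable N"
  unfolding ent_div_def by measurable

context prob_space
begin

lemma integrable_range:
  fixes f :: "'a \<Rightarrow> real"
  assumes "f \<in> borel_measurable M" "\<And>x. x \<in> space M \<Longrightarrow> f x \<in> {a..b}"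
  shows "integrable M f"
  using assms by (intro integrable_const_bound[where B = "max \<bar>a\<bar> \<bar>b\<bar>"]) (force intro!: AE_I2)+

lemma expectation_range:
  fixes f :: "'a \<Rightarrow> real"
  assumes "f \<in> borel_measurable M" "\<And>x. x \<in> space M \<Longrightarrow> f x \<in> {a..b}"
  shows "expectation f \<in> {a..b}"
  using assms integrable_range[OF assms]
  by (auto intro!: integral_ge_const integral_le_const AE_I2)

lemma integrable_ent_div:
  assumes [measurable]: "f \<in> borel_measurable M" "u \<in> borel_measurable M"
    and "0 < a" "\<And>x. x \<in> space M \<Longrightarrow> f x \<in> {a..b}" "\<And>x. x \<in> space M \<Longrightarrow> u x \<in> {a..b}"
  shows "integrable M (\<lambda>x. ent_div (f x) (u x))"
proof (rule integrable_range)
  fix x assume x: "x \<in> space M"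
  have "0 < f x" "0 < u x" using assms(3) assms(4)[OF x] assms(5)[OF x] by auto
  then show "ent_div (f x) (u x) \<in> {0..b * (b / a) + b}"
    using ent_div_nonneg ent_div_le[OF assms(3) assms(4)[OF x] assms(5)[OF x]] by auto
qed simp

text \<open>Integrate the linear minorant with ratio \<open>?q\<close>, which is exact at the pair
  of expectations.\<close>

lemma ent_div_Jensen:
  assumes [measurable]: "f \<in> borel_measurable M" "u \<in> borel_measurable M"
    and ab: "0 < a" "\<And>x. x \<in> space M \<Longrightarrow> f x \<in> {a..b}" "\<And>x. x \<in> space M \<Longrightarrow> u x \<in> {a..b}"
  shows "ent_div (expectation f) (expectation u) \<le> expectation (\<lambda>x. ent_div (f x) (u x))"
proof -
  have fi: "integrable M f" and ui: "integrable M u"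
    using integrable_range[OF assms(1) ab(2)] integrable_range[OF assms(2) ab(3)] by blast+
  have pos: "0 < expectation f" "0 < expectation u"
    using expectation_range[OF assms(1) ab(2)] expectation_range[OF assms(2) ab(3)] ab(1) by auto
  let ?q = "expectation f / expectation u"
  have "ent_div (expectation f) (expectation u)
      = expectation (\<lambda>x. f x * ln ?q + u x * (1 - ?q))"
  proof -
    have "expectation (\<lambda>x. f x * ln ?q + u x * (1 - ?q)) = expectation f * ln ?q + expectation u * (1 - ?q)"
      using fi ui by simp
    then show ?thesis using pos by (simp add: ent_div_def right_diff_distrib)
  qed
  also have "\<dots> \<le> expectation (\<lambda>x. ent_div (f x) (u x))"
  proof (intro integral_mono)
    fix x assume x: "x \<in> space M"
    have "0 < f x" "0 < u x" using ab(1) ab(2,3)[OF x] by auto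
    then show "f x * ln ?q + u x * (1 - ?q) \<le> ent_div (f x) (u x)"
      using pos by (intro ent_div_tangent)
  next
    show "integrable M (\<lambda>x. ent_div (f x) (u x))"
      by (rule integrable_ent_div[OF assms])
  qed (use fi ui in auto)
  finally show ?thesis .
qed

lemma integrable_xlnx:
  fixes f :: "'a \<Rightarrow> real"
  assumes [measurable]: "f \<in> borel_measurable M"
    and ab: "0 < a" "\<And>x. x \<in> space M \<Longrightarrow> f x \<in> {a..b}"
  shows "integrable M (\<lambda>x. f x * ln (f x))"
proof (rule integrable_range)
  fix x assume "x \<in> space M"
  then have "\<bar>f x * ln (f x)\<bar> \<le> b * (\<bar>ln a\<bar> + \<bar>ln b\<bar>)"
    by (intro xlnx_range ab)
  then show "f x * ln (f x) \<in> {- (b * (\<bar>ln a\<bar> + \<bar>ln b\<bar>))..b * (\<bar>ln a\<bar> + \<bar>ln b\<bar>)}" by auto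
qed measurable

text \<open>The two sides differ by \<open>ent_div (expectation f) c\<close>: entropy is the least
  mean divergence from a constant.\<close>

lemma entropy_le_ent_div:
  fixes f :: "'a \<Rightarrow> real"
  assumes [measurable]: "f \<in> borel_measurable M"
    and ab: "0 < a" "\<And>x. x \<in> space M \<Longrightarrow> f x \<in> {a..b}" "c \<in> {a..b}"
  shows "expectation (\<lambda>x. f x * ln (f x)) - expectation f * ln (expectation f)
    \<le> expectation (\<lambda>x. ent_div (f x) c)"
proof -
  have fi: "integrable M f" by (rule integrable_range[OF assms(1) ab(2)])
  note xi = integrable_xlnx[OF assms(1-3)]
  have pos: "0 < expectation f"
    using expectation_range[OF assms(1) ab(2)] ab(1) by auto
  have "expectation (\<lambda>x. ent_div (f x) c) = expectation (\<lambda>x. f x * ln (f x) - f x * ln c - f x + c)"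
  proof (intro Bochner_Integration.integral_cong refl)
    fix x assume "x \<in> space M"
    then have "0 < f x" "0 < c" using ab(1,3) ab(2)[of x] by auto
    then show "ent_div (f x) c = f x * ln (f x) - f x * ln c - f x + c"
      by (simp add: ent_div_def ln_div right_diff_distrib)
  qed
  also have "\<dots> = expectation (\<lambda>x. f x * ln (f x)) - expectation f * ln c - expectation f + c"
    using fi xi by (simp add: prob_space)
  finally show ?thesis
    using ent_div_nonneg[OF pos, of c] pos ab by (simp add: ent_div_def ln_div right_diff_distrib)
qed

section \<open>Integrating out one coordinate of a finite product\<close>

lemma measurable_PiM_upd:
  assumes "x \<in> space (PiM I (\<lambda>_. M))" "f \<in> measurable (PiM (insert j I) (\<lambda>_. M)) N"
  shows "(\<lambda>y. f (x(j := y))) \<in> measurable M N"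
proof -
  have "(\<lambda>y. x(j := y)) \<in> measurable M (PiM (insert j I) (\<lambda>_. M))"
    using assms(1) by (intro measurable_fun_upd[where J = I]) auto
  from measurable_comp[OF this assms(2)] show ?thesis by (simp add: comp_def)
qed

lemma measurable_PiM_upd_pair:
  assumes "f \<in> measurable (PiM (insert j I) (\<lambda>_. M)) N"
  shows "(\<lambda>(x, y). f (x(j := y))) \<in> measurable (PiM I (\<lambda>_. M) \<Otimes>\<^sub>M M) N"
proof -
  have "(\<lambda>p. (fst p)(j := snd p)) \<in> measurable (PiM I (\<lambda>_. M) \<Otimes>\<^sub>M M) (PiM (insert j I) (\<lambda>_. M))"
    by (intro measurable_fun_upd[where J = I]) auto
  from measurable_comp[OF this assms(1)] show ?thesis by (simp add: comp_def case_prod_beta')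
qed

lemma measurable_PiM_integral:
  fixes f :: "('i \<Rightarrow> 'a) \<Rightarrow> real"
  assumes "f \<in> borel_measurable (PiM (insert j I) (\<lambda>_. M))"
  shows "(\<lambda>x. \<integral>y. f (x(j := y)) \<partial>M) \<in> borel_measurable (PiM I (\<lambda>_. M))"
  using measurable_PiM_upd_pair[OF assms]
  by (intro borel_measurable_lebesgue_integral) simp

lemma integrable_PiM_integral:
  fixes f :: "('i \<Rightarrow> 'a) \<Rightarrow> real"
  assumes "f \<in> borel_measurable (PiM (insert j I) (\<lambda>_. M))" "\<And>x. f x \<in> {a..b}"
  shows "integrable (PiM I (\<lambda>_. M)) (\<lambda>x. \<integral>y. f (x(j := y)) \<partial>M)"
proof -
  interpret QI: prob_space "PiM I (\<lambda>_. M)" by (rule prob_space_PiM) (rule prob_space_axioms)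
  show ?thesis
    using measurable_PiM_upd[OF _ assms(1)] assms(2)
    by (intro QI.integrable_range[OF measurable_PiM_integral[OF assms(1)]] expectation_range)
qed

text \<open>Chain rule: the entropy of \<open>f\<close> is the entropy of its average
  \<open>F\<close> over coordinate \<open>j\<close> plus the mean entropy in coordinate
  \<open>j\<close>. The induction hypothesis bounds the former by divergences of \<open>F\<close>
  from the averages \<open>U k\<close>, and joint convexity carries these back to \<open>f\<close>
  and \<open>u k\<close>. In coordinate \<open>j\<close> the function \<open>u j\<close> is a
  constant, so the variational bound applies. The freedom in \<open>u k\<close> is what later admits
  the leave-one-out suprema.\<close>

lemma entropy_tensorization:
  fixes f :: "('i \<Rightarrow> 'a) \<Rightarrow> real"
  assumes "finite I" and ab: "0 < a"
    and "f \<in> borel_measurable (PiM I (\<lambda>_. M))" "\<And>x. f x \<in> {a..b}"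
    and "\<And>k. k \<in> I \<Longrightarrow> u k \<in> borel_measurable (PiM I (\<lambda>_. M))"
    and "\<And>k x. k \<in> I \<Longrightarrow> u k x \<in> {a..b}" "\<And>k x y. k \<in> I \<Longrightarrow> u k (x(k := y)) = u k x"
  shows "(\<integral>x. f x * ln (f x) \<partial>PiM I (\<lambda>_. M))
      - (\<integral>x. f x \<partial>PiM I (\<lambda>_. M)) * ln (\<integral>x. f x \<partial>PiM I (\<lambda>_. M))
    \<le> (\<Sum>k\<in>I. \<integral>x. ent_div (f x) (u k x) \<partial>PiM I (\<lambda>_. M))"
  using assms(1,3-)
proof (induction I arbitrary: f u rule: finite_induct)
  case empty
  then show ?case by (simp add: PiM_empty lebesgue_integral_count_space_finite)
next
  case (insert j I)
  interpret Q: product_prob_space "\<lambda>_. M" UNIV by standard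
  interpret QI: prob_space "PiM I (\<lambda>_. M)" by (rule prob_space_PiM) (rule prob_space_axioms)
  interpret QJ: prob_space "PiM (insert j I) (\<lambda>_. M)" by (rule prob_space_PiM) (rule prob_space_axioms)
  note fm = insert.prems(1) and fr = insert.prems(2) and um = insert.prems(3)
    and ur = insert.prems(4) and ui = insert.prems(5)
  let ?QI = "PiM I (\<lambda>_. M)" and ?QJ = "PiM (insert j I) (\<lambda>_. M)"
  define F where "F x = (\<integral>y. f (x(j := y)) \<partial>M)" for x
  define U where "U k x = (\<integral>y. u k (x(j := y)) \<partial>M)" for k x
  have F_m [measurable]: "F \<in> borel_measurable ?QI"
    unfolding F_def using fm by (rule measurable_PiM_integral)
  have U_m: "U k \<in> borel_measurable ?QI" if "k \<in> insert j I" for k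
    unfolding U_def using um[OF that] by (rule measurable_PiM_integral)
  have ab': "a \<le> b" using fr[of undefined] by auto
  have F_r: "F x \<in> {a..b}" if x: "x \<in> space ?QI" for x
    unfolding F_def using fr measurable_PiM_upd[OF x fm] by (intro expectation_range)
  have U_r: "U k x \<in> {a..b}" if "k \<in> insert j I" "x \<in> space ?QI" for k x
    unfolding U_def using ur[OF that(1)] measurable_PiM_upd[OF that(2) um[OF that(1)]]
    by (intro expectation_range)
  have f_pos: "0 < f x" for x using fr[of x] ab by auto
  have u_pos: "0 < u k x" if "k \<in> insert j I" for k x using ur[OF that, of x] ab by auto
  note fubini = Q.product_integral_insert[OF insert.hyps(1,2)]
  note upd_m = measurable_PiM_upd
  have xlnx: "integrable ?QJ (\<lambda>x. f x * ln (f x))"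
    using fm fr ab by (intro QJ.integrable_xlnx)
  have ed_int: "integrable ?QJ (\<lambda>x. ent_div (f x) (u k x))" if "k \<in> insert j I" for k
    using fm fr um[OF that] ur[OF that] ab by (intro QJ.integrable_ent_div)
  have ed_r: "ent_div (f x) (u k x) \<in> {0..b * (b / a) + b}" if "k \<in> insert j I" for k x
    using ent_div_nonneg[OF f_pos u_pos[OF that]] ent_div_le[OF ab fr ur[OF that]]
    unfolding atLeastAtMost_iff by blast
  have I1: "(\<integral>x. f x \<partial>?QJ) = (\<integral>x. F x \<partial>?QI)"
    unfolding F_def using QJ.integrable_range[OF fm fr] by (rule fubini)
  have I2: "(\<integral>x. f x * ln (f x) \<partial>?QJ) = (\<integral>x. (\<integral>y. f (x(j := y)) * ln (f (x(j := y))) \<partial>M) \<partial>?QI)"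
    using xlnx by (rule fubini)
  have I3: "(\<integral>x. ent_div (f x) (u k x) \<partial>?QJ)
      = (\<integral>x. (\<integral>y. ent_div (f (x(j := y))) (u k (x(j := y))) \<partial>M) \<partial>?QI)"
    if "k \<in> insert j I" for k
    using ed_int[OF that] by (rule fubini)
  \<comment> \<open>The induction hypothesis wants the range at every point, but off
    \<open>space ?QI\<close> a section may fail to be integrable and its integral is then the
    default 0. Clamping leaves the values on the space unchanged.\<close>
  define F' where "F' x = max a (min b (F x))" for x
  define U' where "U' k x = max a (min b (U k x))" for k x
  have F'_eq: "F' x = F x" if "x \<in> space ?QI" for x
    using F_r[OF that] by (auto simp: F'_def)
  have U'_eq: "U' k x = U k x" if "k \<in> insert j I" "x \<in> space ?QI" for k x
    using U_r[OF that] by (auto simp: U'_def)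
  have IH: "(\<integral>x. F' x * ln (F' x) \<partial>?QI) - (\<integral>x. F' x \<partial>?QI) * ln (\<integral>x. F' x \<partial>?QI)
      \<le> (\<Sum>k\<in>I. \<integral>x. ent_div (F' x) (U' k x) \<partial>?QI)"
  proof (rule insert.IH)
    show "F' \<in> borel_measurable ?QI" unfolding F'_def by measurable
    show "F' x \<in> {a..b}" for x using ab' by (auto simp: F'_def)
    show "U' k \<in> borel_measurable ?QI" if "k \<in> I" for k
    proof -
      have [measurable]: "U k \<in> borel_measurable ?QI" using U_m that by auto
      show ?thesis unfolding U'_def by measurable
    qed
    show "U' k x \<in> {a..b}" if "k \<in> I" for k x using ab' by (auto simp: U'_def)
    show "U' k (x(k := y)) = U' k x" if k: "k \<in> I" for k x y
    proof -
      have k': "k \<in> insert j I" using k by simp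
      have "k \<noteq> j" using k insert.hyps by auto
      then have "u k ((x(k := y))(j := z)) = u k (x(j := z))" for z
        using ui[OF k', of "x(j := z)" y] fun_upd_twist[OF \<open>k \<noteq> j\<close>, of x y z] by metis
      then show ?thesis by (simp add: U'_def U_def)
    qed
  qed
  also have "(\<integral>x. F' x * ln (F' x) \<partial>?QI) = (\<integral>x. F x * ln (F x) \<partial>?QI)"
    by (intro Bochner_Integration.integral_cong) (auto simp: F'_eq)
  also have "(\<integral>x. F' x \<partial>?QI) = (\<integral>x. F x \<partial>?QI)"
    by (intro Bochner_Integration.integral_cong) (auto simp: F'_eq)
  also have "(\<Sum>k\<in>I. \<integral>x. ent_div (F' x) (U' k x) \<partial>?QI) = (\<Sum>k\<in>I. \<integral>x. ent_div (F x) (U k x) \<partial>?QI)"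
    by (intro sum.cong Bochner_Integration.integral_cong) (auto simp: F'_eq U'_eq)
  also have "\<dots> \<le> (\<Sum>k\<in>I. \<integral>x. ent_div (f x) (u k x) \<partial>?QJ)"
  proof (intro sum_mono)
    fix k assume "k \<in> I"
    then have k: "k \<in> insert j I" by auto
    have [measurable]: "U k \<in> borel_measurable ?QI" using U_m k by auto
    have "(\<integral>x. ent_div (F x) (U k x) \<partial>?QI)
        \<le> (\<integral>x. (\<integral>y. ent_div (f (x(j := y))) (u k (x(j := y))) \<partial>M) \<partial>?QI)"
    proof (rule integral_mono)
      show "integrable ?QI (\<lambda>x. ent_div (F x) (U k x))"
        using F_r U_r[OF k] ab by (intro QI.integrable_ent_div) auto
      show "integrable ?QI (\<lambda>x. \<integral>y. ent_div (f (x(j := y))) (u k (x(j := y))) \<partial>M)"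
        using ed_int[OF k] by (intro integrable_PiM_integral[OF _ ed_r[OF k]]) auto
      fix x assume x: "x \<in> space ?QI"
      show "ent_div (F x) (U k x) \<le> (\<integral>y. ent_div (f (x(j := y))) (u k (x(j := y))) \<partial>M)"
        unfolding F_def U_def using upd_m[OF x fm] upd_m[OF x um[OF k]] ab fr ur[OF k]
        by (intro ent_div_Jensen)
    qed
    then show "(\<integral>x. ent_div (F x) (U k x) \<partial>?QI) \<le> (\<integral>x. ent_div (f x) (u k x) \<partial>?QJ)"
      using I3[OF k] by simp
  qed
  finally have A: "(\<integral>x. F x * ln (F x) \<partial>?QI) - (\<integral>x. F x \<partial>?QI) * ln (\<integral>x. F x \<partial>?QI)
    \<le> (\<Sum>k\<in>I. \<integral>x. ent_div (f x) (u k x) \<partial>?QJ)" .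
  have j: "j \<in> insert j I" by simp
  have iXI: "integrable ?QI (\<lambda>x. \<integral>y. f (x(j := y)) * ln (f (x(j := y))) \<partial>M)"
  proof (rule integrable_PiM_integral)
    show "f x * ln (f x) \<in> {- (b * (\<bar>ln a\<bar> + \<bar>ln b\<bar>))..b * (\<bar>ln a\<bar> + \<bar>ln b\<bar>)}" for x
      using xlnx_range[OF ab fr[of x]] by auto
  qed (use xlnx in auto)
  have iFI: "integrable ?QI (\<lambda>x. F x * ln (F x))"
    using F_r ab by (intro QI.integrable_xlnx) auto
  have iEI: "integrable ?QI (\<lambda>x. \<integral>y. ent_div (f (x(j := y))) (u j (x(j := y))) \<partial>M)"
    using ed_int[OF j] by (intro integrable_PiM_integral[OF _ ed_r[OF j]]) auto
  have B: "(\<integral>x. (\<integral>y. f (x(j := y)) * ln (f (x(j := y))) \<partial>M) \<partial>?QI) - (\<integral>x. F x * ln (F x) \<partial>?QI)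
      \<le> (\<integral>x. ent_div (f x) (u j x) \<partial>?QJ)"
  proof -
    have "(\<integral>x. (\<integral>y. f (x(j := y)) * ln (f (x(j := y))) \<partial>M) \<partial>?QI) - (\<integral>x. F x * ln (F x) \<partial>?QI)
      = (\<integral>x. (\<integral>y. f (x(j := y)) * ln (f (x(j := y))) \<partial>M) - F x * ln (F x) \<partial>?QI)"
      using iXI iFI by simp
    also have "\<dots> \<le> (\<integral>x. (\<integral>y. ent_div (f (x(j := y))) (u j (x(j := y))) \<partial>M) \<partial>?QI)"
    proof (rule integral_mono)
      fix x assume x: "x \<in> space ?QI"
      show "(\<integral>y. f (x(j := y)) * ln (f (x(j := y))) \<partial>M) - F x * ln (F x)
        \<le> (\<integral>y. ent_div (f (x(j := y))) (u j (x(j := y))) \<partial>M)"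
        unfolding F_def ui[OF j] using upd_m[OF x fm] ab fr ur[OF j]
        by (intro entropy_le_ent_div)
    qed (use iXI iFI iEI in auto)
    finally show ?thesis using I3[OF j] by simp
  qed
  show ?case
    using A B insert.hyps by (simp add: I1 I2)
qed

section \<open>Suprema of bounded classes\<close>

text \<open>The increment \<open>D\<close> is not centred, but \<open>D\<^sup>2 \<le> Y\<^sup>2 + 2 (D - Y)\<close> trades its second moment
  for that of the centred minorant \<open>Y\<close>.\<close>

lemma ent_div_exp_le:
  assumes [measurable]: "D \<in> borel_measurable M" "Y \<in> borel_measurable M"
    and r: "\<And>y. D y \<in> {-1..1}" "\<And>y. Y y \<in> {-1..1}" "\<And>y. Y y \<le> D y"
    and Y: "expectation Y = 0" "expectation (\<lambda>y. (Y y)\<^sup>2) \<le> v" and l: "0 < l" "l \<le> 1" and "0 \<le> v"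
  shows "expectation (\<lambda>y. ent_div (exp (l * (c + D y))) (exp (l * c)))
    \<le> l\<^sup>2 * expectation (\<lambda>y. (v + 2 * D y) * exp (l * (c + D y)))"
proof -
  define E where "E y = exp (l * (c + D y))" for y
  have [measurable]: "E \<in> borel_measurable M" unfolding E_def by measurable
  have iD: "integrable M D" by (rule integrable_range[OF assms(1) r(1)])
  have iY: "integrable M Y" by (rule integrable_range[OF assms(2) r(2)])
  have Dr: "l * (c + D y) \<in> {l * (c - 1)..l * (c + 1)}" for y
    using r(1)[of y] l by auto
  have Er: "E y \<in> {exp (l * (c - 1))..exp (l * (c + 1))}" for y
    using Dr[of y] by (auto simp: E_def)
  have iE: "integrable M E" by (rule integrable_range[OF _ Er]) simp
  have iED: "integrable M (\<lambda>y. D y * E y)"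
  proof (rule Bochner_Integration.integrable_bound[OF iE])
    show "AE y in M. norm (D y * E y) \<le> norm (E y)"
    proof (rule AE_I2)
      fix y
      have "\<bar>D y\<bar> \<le> 1" using r(1)[of y] by auto
      then show "norm (D y * E y) \<le> norm (E y)"
        using mult_right_mono[of "\<bar>D y\<bar>" 1 "\<bar>E y\<bar>"] by (simp add: abs_mult)
    qed
  qed simp
  have iY2: "integrable M (\<lambda>y. (Y y)\<^sup>2)"
  proof (rule integrable_range)
    fix y
    have "\<bar>Y y\<bar> \<le> 1" using r(2)[of y] by auto
    then show "(Y y)\<^sup>2 \<in> {0..1}" by (simp add: abs_square_le_1)
  qed simp
  have ED: "0 \<le> expectation D"
    using integral_mono[OF iY iD r(3)] Y by simp
  have le1: "ent_div (E y) (exp (l * c)) \<le> exp (l * c) * (l\<^sup>2 * ((Y y)\<^sup>2 + 2 * (D y - Y y)))" for y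
  proof -
    define u where "u = l * D y"
    have "0 \<le> l * (1 - D y)" using r(1)[of y] l by (intro mult_nonneg_nonneg) auto
    then have "u \<le> 1" using l(2) unfolding u_def right_diff_distrib by linarith
    \<comment> \<open>Multiplying \<open>u + 1 \<le> exp u\<close> by \<open>u - 1 \<le> 0\<close>
      reverses it; this is where \<open>l \<le> 1\<close> and \<open>D y \<le> 1\<close>
      enter.\<close>
    then have "(u - 1) * exp u \<le> (u - 1) * (u + 1)"
      using exp_ge_add_one_self[of u] by (intro mult_left_mono_neg) (auto simp: add.commute)
    then have psi: "exp u * u - exp u + 1 \<le> u\<^sup>2"
      by (simp add: algebra_simps power2_eq_square)
    have "(D y)\<^sup>2 = (Y y)\<^sup>2 + (D y - Y y) * (D y + Y y)"
      by (simp add: algebra_simps power2_eq_square)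
    also have "\<dots> \<le> (Y y)\<^sup>2 + (D y - Y y) * 2"
      using r(1,2)[of y] r(3)[of y] by (intro add_left_mono mult_left_mono) auto
    finally have D2: "(D y)\<^sup>2 \<le> (Y y)\<^sup>2 + 2 * (D y - Y y)" by simp
    have "ent_div (E y) (exp (l * c)) = exp (l * c) * (exp u * u - exp u + 1)"
      by (simp add: ent_div_def E_def u_def exp_diff[symmetric] exp_add algebra_simps)
    also have "\<dots> \<le> exp (l * c) * (l\<^sup>2 * (D y)\<^sup>2)"
      using psi by (intro mult_left_mono) (auto simp: u_def power_mult_distrib)
    also have "\<dots> \<le> exp (l * c) * (l\<^sup>2 * ((Y y)\<^sup>2 + 2 * (D y - Y y)))"
      using D2 by (intro mult_left_mono) auto
    finally show ?thesis .
  qed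
  have "expectation (\<lambda>y. ent_div (E y) (exp (l * c)))
      \<le> expectation (\<lambda>y. exp (l * c) * (l\<^sup>2 * ((Y y)\<^sup>2 + 2 * (D y - Y y))))"
  proof (intro integral_mono le1)
    show "integrable M (\<lambda>y. ent_div (E y) (exp (l * c)))"
    proof (rule integrable_ent_div[OF _ _ _ Er])
      show "exp (l * c) \<in> {exp (l * (c - 1))..exp (l * (c + 1))}" using l by simp
    qed auto
  qed (use iY2 iD iY in auto)
  also have "\<dots> = exp (l * c) * (l\<^sup>2 * (expectation (\<lambda>y. (Y y)\<^sup>2) + 2 * expectation D))"
    using iY2 iD iY Y by simp
  also have "\<dots> \<le> exp (l * c) * (l\<^sup>2 * (v + 2 * expectation D))"
    using Y by (intro mult_left_mono) auto
  also have "\<dots> = l\<^sup>2 * (v * exp (l * c) + 2 * (exp (l * c) * expectation D))"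
    by (simp add: algebra_simps)
  \<comment> \<open>Both terms must carry the weight \<open>E\<close>, because the differential
    inequality speaks of moments under \<open>exp (l * S)\<close> only. The first may be enlarged
    since \<open>0 \<le> expectation D\<close>, the second since
    \<open>D y \<le> D y * exp (l * D y)\<close> for either sign of \<open>D y\<close>.\<close>
  also have "\<dots> \<le> l\<^sup>2 * (v * expectation E + 2 * expectation (\<lambda>y. D y * E y))"
  proof (intro mult_left_mono add_mono)
    have "exp (l * c) \<le> exp (l * c) * (1 + l * expectation D)"
      using ED l by simp
    also have "\<dots> = expectation (\<lambda>y. exp (l * c) * (1 + l * D y))"
      using iD by (simp add: prob_space)
    also have "\<dots> \<le> expectation E"
    proof (intro integral_mono)
      show "exp (l * c) * (1 + l * D y) \<le> E y" for y
        unfolding E_def distrib_left[of l] exp_add by (intro mult_left_mono exp_ge_add_one_self) simp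
    qed (use iD iE in auto)
    finally show "exp (l * c) \<le> expectation E" .
    have "exp (l * c) * expectation D = expectation (\<lambda>y. exp (l * c) * D y)"
      by simp
    also have "\<dots> \<le> expectation (\<lambda>y. D y * E y)"
    proof (intro integral_mono)
      fix y
      have "D y * 1 \<le> D y * exp (l * D y)"
      proof (cases "0 \<le> D y")
        case True
        then show ?thesis using l by (intro mult_left_mono) auto
      next
        case False
        then show ?thesis using l by (intro mult_left_mono_neg) (auto simp: mult_nonneg_nonpos)
      qed
      from mult_left_mono[OF this, of "exp (l * c)"]
      show "exp (l * c) * D y \<le> D y * E y"
        by (simp add: E_def distrib_left exp_add mult.assoc mult.left_commute)
    qed (use iD iED in auto)
    finally show "exp (l * c) * expectation D \<le> expectation (\<lambda>y. D y * E y)" .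
  qed (use \<open>0 \<le> v\<close> in auto)
  also have "\<dots> = l\<^sup>2 * expectation (\<lambda>y. (v + 2 * D y) * E y)"
    using iE iED by (simp add: distrib_right mult.assoc)
  finally show ?thesis by (simp add: E_def)
qed

text \<open>For bounded \<open>S\<close> and small \<open>h\<close> the remainder
  \<open>exp u - 1 - u\<close> at \<open>u = h * S x\<close> is at most
  \<open>2 * u\<^sup>2\<close>, uniformly in \<open>x\<close>; the difference quotient therefore
  misses the claimed derivative by at most a multiple of \<open>\<bar>h\<bar>\<close>.\<close>

lemma mgf_has_derivative:
  assumes [measurable]: "S \<in> borel_measurable M" and S: "\<And>x. x \<in> space M \<Longrightarrow> \<bar>S x\<bar> \<le> b" and b: "0 < b"
  shows "((\<lambda>l. expectation (\<lambda>x. exp (l * S x))) has_real_derivative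
    expectation (\<lambda>x. S x * exp (l * S x))) (at l)"
proof -
  have iE: "integrable M (\<lambda>x. exp (l * S x))" for l
  proof (rule integrable_range[where a = 0 and b = "exp (\<bar>l\<bar> * b)"])
    fix x assume "x \<in> space M"
    then have "\<bar>l * S x\<bar> \<le> \<bar>l\<bar> * b"
      unfolding abs_mult by (intro mult_left_mono S) auto
    then have "l * S x \<le> \<bar>l\<bar> * b" by linarith
    then show "exp (l * S x) \<in> {0..exp (\<bar>l\<bar> * b)}" by simp
  qed simp
  have iSE: "integrable M (\<lambda>x. S x * exp (l * S x))"
  proof (rule Bochner_Integration.integrable_bound[of _ "\<lambda>x. b * exp (l * S x)"])
    show "AE x in M. norm (S x * exp (l * S x)) \<le> norm (b * exp (l * S x))"
      using S b by (intro AE_I2) (auto simp: abs_mult)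
  qed (use iE in auto)
  define K where "K = 2 * b\<^sup>2 * expectation (\<lambda>x. exp (l * S x))"
  have bound: "norm ((expectation (\<lambda>x. exp ((l + h) * S x)) - expectation (\<lambda>x. exp (l * S x))) / h
      - expectation (\<lambda>x. S x * exp (l * S x))) \<le> \<bar>h\<bar> * K"
    if h: "h \<noteq> 0" "\<bar>h\<bar> < 1 / (2 * b)" for h
  proof -
    have pt: "\<bar>exp ((l + h) * S x) - exp (l * S x) - h * (S x * exp (l * S x))\<bar>
        \<le> h\<^sup>2 * (2 * b\<^sup>2) * exp (l * S x)" if x: "x \<in> space M" for x
    proof -
      define u where "u = h * S x"
      have "\<bar>u\<bar> \<le> 1 / (2 * b) * b"
        unfolding u_def abs_mult using h S[OF x] b by (intro mult_mono) auto
      then have u: "\<bar>u\<bar> \<le> 1/2" using b by simp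
      have "1 - u \<le> exp (- u)" using exp_ge_add_one_self[of "- u"] by simp
      then have "exp u * (1 - u) \<le> exp u * exp (- u)" by (intro mult_left_mono) auto
      then have "exp u * (1 - u) \<le> 1" by (simp add: exp_minus_inverse)
      then have "exp u \<le> 1 / (1 - u)" using u by (simp add: field_simps)
      also have "\<dots> \<le> 1 + u + 2 * u\<^sup>2"
      proof -
        have "0 \<le> u\<^sup>2 * (1 - 2 * u)" using u by auto
        then have "1 \<le> (1 + u + 2 * u\<^sup>2) * (1 - u)"
          by (simp add: algebra_simps power2_eq_square)
        then show ?thesis using u by (simp add: field_simps)
      qed
      finally have up: "exp u - 1 - u \<le> 2 * u\<^sup>2" by simp
      have "u\<^sup>2 = h\<^sup>2 * (S x)\<^sup>2" by (simp add: u_def power_mult_distrib)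
      also have "\<dots> \<le> h\<^sup>2 * b\<^sup>2"
        using power_mono[OF S[OF x], of 2] by (intro mult_left_mono) auto
      finally have "\<bar>exp u - 1 - u\<bar> \<le> h\<^sup>2 * (2 * b\<^sup>2)"
        using up exp_ge_add_one_self[of u] by linarith
      then have "\<bar>exp u - 1 - u\<bar> * exp (l * S x) \<le> h\<^sup>2 * (2 * b\<^sup>2) * exp (l * S x)"
        by (intro mult_right_mono) auto
      moreover have "exp ((l + h) * S x) - exp (l * S x) - h * (S x * exp (l * S x))
          = (exp u - 1 - u) * exp (l * S x)"
        by (simp add: u_def distrib_right exp_add algebra_simps)
      ultimately show ?thesis by (simp add: abs_mult)
    qed
    have eq: "(expectation (\<lambda>x. exp ((l + h) * S x)) - expectation (\<lambda>x. exp (l * S x))) / h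
        - expectation (\<lambda>x. S x * exp (l * S x))
      = expectation (\<lambda>x. exp ((l + h) * S x) - exp (l * S x) - h * (S x * exp (l * S x))) / h"
    proof -
      have "expectation (\<lambda>x. exp ((l + h) * S x) - exp (l * S x) - h * (S x * exp (l * S x)))
        = expectation (\<lambda>x. exp ((l + h) * S x)) - expectation (\<lambda>x. exp (l * S x))
          - h * expectation (\<lambda>x. S x * exp (l * S x))"
        using iE[of "l + h"] iE[of l] iSE by simp
      then show ?thesis using h by (simp add: diff_divide_distrib)
    qed
    have "\<bar>expectation (\<lambda>x. exp ((l + h) * S x) - exp (l * S x) - h * (S x * exp (l * S x)))\<bar>
       \<le> expectation (\<lambda>x. \<bar>exp ((l + h) * S x) - exp (l * S x) - h * (S x * exp (l * S x))\<bar>)"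
      by (rule integral_abs_bound)
    also have "\<dots> \<le> expectation (\<lambda>x. h\<^sup>2 * (2 * b\<^sup>2) * exp (l * S x))"
      using iE iSE by (intro integral_mono pt) auto
    also have "\<dots> = h\<^sup>2 * K" by (simp add: K_def)
    finally show ?thesis
      unfolding eq using h by (simp add: power2_eq_square divide_le_eq ac_simps)
  qed
  show ?thesis
    unfolding DERIV_def
  proof (rule Lim_transform2[where g = "\<lambda>h. (expectation (\<lambda>x. exp ((l + h) * S x)) - expectation (\<lambda>x. exp (l * S x))) / h"], rule LIM_zero_cancel)
    show "((\<lambda>h. (expectation (\<lambda>x. exp ((l + h) * S x)) - expectation (\<lambda>x. exp (l * S x))) / h
      - expectation (\<lambda>x. S x * exp (l * S x))) \<longlongrightarrow> 0) (at 0)"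
    proof (rule Lim_null_comparison)
      show "\<forall>\<^sub>F h in at 0. norm ((expectation (\<lambda>x. exp ((l + h) * S x)) - expectation (\<lambda>x. exp (l * S x))) / h
        - expectation (\<lambda>x. S x * exp (l * S x))) \<le> \<bar>h\<bar> * K"
        unfolding eventually_at by (rule exI[of _ "1 / (2 * b)"]) (use b bound in \<open>auto simp: dist_real_def\<close>)
      show "((\<lambda>h. \<bar>h\<bar> * K) \<longlongrightarrow> 0) (at 0)"
        by (intro tendsto_eq_intros) auto
    qed
  qed auto
qed

end

section \<open>Finite maxima of sums and their leave-one-out versions\<close>

text \<open>The index set is a parameter so that the leave-one-out supremum is
  \<open>max_sum G (I - {k})\<close> at the same point \<open>x\<close>, of which it ignores
  coordinate \<open>k\<close>.\<close>

definition max_sum :: "('a \<Rightarrow> real) set \<Rightarrow> 'i set \<Rightarrow> ('i \<Rightarrow> 'a) \<Rightarrow> real" where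
  "max_sum G I x = Max ((\<lambda>g. \<Sum>i\<in>I. g (x i)) ` G)"

lemma max_sum_ge: "finite G \<Longrightarrow> g \<in> G \<Longrightarrow> (\<Sum>i\<in>I. g (x i)) \<le> max_sum G I x"
  by (simp add: max_sum_def)

lemma max_sum_attained:
  assumes "finite G" "G \<noteq> {}"
  obtains g where "g \<in> G" "max_sum G I x = (\<Sum>i\<in>I. g (x i))"
proof -
  have "max_sum G I x \<in> (\<lambda>g. \<Sum>i\<in>I. g (x i)) ` G"
    unfolding max_sum_def using assms by (intro Max_in) auto
  then show ?thesis using that by auto
qed

lemma max_sum_measurable:
  assumes "finite G" "G \<noteq> {}" "\<And>g. g \<in> G \<Longrightarrow> g \<in> borel_measurable M" "J \<subseteq> I"
  shows "max_sum G J \<in> borel_measurable (PiM I (\<lambda>_. M))"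
proof -
  have "(\<lambda>x. \<Sum>i\<in>J. g (x i)) \<in> borel_measurable (PiM I (\<lambda>_. M))" if "g \<in> G" for g
  proof (rule borel_measurable_sum)
    fix i assume "i \<in> J"
    then show "(\<lambda>x. g (x i)) \<in> borel_measurable (PiM I (\<lambda>_. M))"
      using assms(3)[OF that] assms(4) by (intro measurable_compose[OF measurable_component_singleton]) auto
  qed
  then have "(\<lambda>x. Max ((\<lambda>g. \<Sum>i\<in>J. g (x i)) ` G)) \<in> borel_measurable (PiM I (\<lambda>_. M))"
    by (intro borel_measurable_Max assms)
  then show ?thesis by (simp add: max_sum_def[abs_def])
qed

lemma max_sum_bound:
  assumes "finite G" "G \<noteq> {}" "\<And>g. g \<in> G \<Longrightarrow> range g \<subseteq> {-1..1}" "finite J"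
  shows "\<bar>max_sum G J x\<bar> \<le> real (card J)"
proof -
  obtain g where g: "g \<in> G" "max_sum G J x = (\<Sum>i\<in>J. g (x i))"
    using max_sum_attained assms by blast
  have "\<bar>\<Sum>i\<in>J. g (x i)\<bar> \<le> (\<Sum>i\<in>J. \<bar>g (x i)\<bar>)" by (rule sum_abs)
  also have "\<dots> \<le> (\<Sum>i\<in>J. 1)"
  proof (rule sum_mono)
    fix i show "\<bar>g (x i)\<bar> \<le> 1" using range_subsetD[OF assms(3)[OF g(1)], of "x i"] by auto
  qed
  finally show ?thesis using g by simp
qed

text \<open>A maximizer for the old coordinates works for all \<open>y\<close> at once. As it does
  not depend on \<open>y\<close>, it is a centred minorant of the increment when the new coordinate
  is averaged.\<close>

lemma max_sum_insert_diff:
  assumes "finite G" "G \<noteq> {}" "finite J" "k \<notin> J"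
  obtains g where "g \<in> G" "\<And>y. g y \<le> max_sum G (insert k J) (x(k := y)) - max_sum G J x"
proof -
  obtain g where g: "g \<in> G" "max_sum G J x = (\<Sum>i\<in>J. g (x i))"
    using max_sum_attained assms by blast
  have "g y \<le> max_sum G (insert k J) (x(k := y)) - max_sum G J x" for y
  proof -
    have "(\<Sum>i\<in>J. g ((x(k := y)) i)) = (\<Sum>i\<in>J. g (x i))"
      using assms by (intro sum.cong) auto
    then have "(\<Sum>i\<in>insert k J. g ((x(k := y)) i)) = g y + max_sum G J x"
      using assms g by simp
    then show ?thesis
      using max_sum_ge[OF assms(1) g(1), of "x(k := y)" "insert k J"] by linarith
  qed
  then show ?thesis using that g by blast
qed

text \<open>A maximizer \<open>g\<close> of the full sum gives the upper bound
  \<open>g (x k)\<close> for the \<open>k\<close>-th difference, and these add up to the maximum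
  itself; a maximizer of the reduced sum gives the lower bound.\<close>

lemma max_sum_remove_diff:
  assumes "finite G" "G \<noteq> {}" "finite I"
  shows "(\<Sum>k\<in>I. max_sum G I x - max_sum G (I - {k}) x) \<le> max_sum G I x"
    and "(\<And>g. g \<in> G \<Longrightarrow> range g \<subseteq> {-1..1}) \<Longrightarrow> k \<in> I \<Longrightarrow> max_sum G I x - max_sum G (I - {k}) x \<in> {-1..1}"
proof -
  obtain g where g: "g \<in> G" "max_sum G I x = (\<Sum>i\<in>I. g (x i))"
    using max_sum_attained assms by blast
  have le: "max_sum G I x - max_sum G (I - {k}) x \<le> g (x k)" if "k \<in> I" for k
    using max_sum_ge[OF assms(1) g(1), of x "I - {k}"] g sum.remove[OF assms(3) that, of "\<lambda>i. g (x i)"]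
    by linarith
  show "(\<Sum>k\<in>I. max_sum G I x - max_sum G (I - {k}) x) \<le> max_sum G I x"
    unfolding g(2) using le g(2) by (intro sum_mono) auto
  assume r: "\<And>g. g \<in> G \<Longrightarrow> range g \<subseteq> {-1..1}" and k: "k \<in> I"
  obtain h where h: "h \<in> G" "max_sum G (I - {k}) x = (\<Sum>i\<in>I - {k}. h (x i))"
    using max_sum_attained assms by blast
  have "h (x k) \<le> max_sum G I x - max_sum G (I - {k}) x"
    using max_sum_ge[OF assms(1) h(1), of x I] h sum.remove[OF assms(3) k, of "\<lambda>i. h (x i)"]
    by linarith
  then show "max_sum G I x - max_sum G (I - {k}) x \<in> {-1..1}"
    using le[OF k] range_subsetD[OF r[OF g(1)], of "x k"] range_subsetD[OF r[OF h(1)], of "x k"] by auto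
qed

section \<open>The differential inequality for the moment generating function and its
  integration\<close>

context prob_space
begin

text \<open>With the other coordinates frozen, the leave-one-out supremum is the constant
  \<open>c\<close> of \<open>ent_div_exp_le\<close>, the increment is its \<open>D\<close>, and a
  leave-one-out maximizer is its \<open>Y\<close>.\<close>

lemma ent_div_max_sum_le:
  fixes G :: "('a \<Rightarrow> real) set" and I :: "'i set"
  assumes "finite I" "k \<in> I" and fin: "finite G" "G \<noteq> {}"
    and gm: "\<And>g. g \<in> G \<Longrightarrow> g \<in> borel_measurable M"
    and gr: "\<And>g. g \<in> G \<Longrightarrow> range g \<subseteq> {-1..1}"
    and g0: "\<And>g. g \<in> G \<Longrightarrow> expectation g = 0"
    and gv: "\<And>g. g \<in> G \<Longrightarrow> expectation (\<lambda>z. (g z)\<^sup>2) \<le> v"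
    and l: "0 < l" "l \<le> 1"
  shows "(\<integral>x. ent_div (exp (l * max_sum G I x)) (exp (l * max_sum G (I - {k}) x)) \<partial>PiM I (\<lambda>_. M))
    \<le> l\<^sup>2 * (\<integral>x. (v + 2 * (max_sum G I x - max_sum G (I - {k}) x)) * exp (l * max_sum G I x) \<partial>PiM I (\<lambda>_. M))"
proof -
  interpret Q: product_prob_space "\<lambda>_. M" UNIV by standard
  define J where "J = I - {k}"
  have I: "I = insert k J" and J: "finite J" "k \<notin> J" using assms by (auto simp: J_def)
  interpret QI: prob_space "PiM (insert k J) (\<lambda>_. M)" by (rule prob_space_PiM) (rule prob_space_axioms)
  have v0: "0 \<le> v"
  proof -
    obtain g where "g \<in> G" using fin by auto
    then show ?thesis using order_trans[OF _ gv[of g], of 0] by simp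
  qed
  let ?Q = "PiM (insert k J) (\<lambda>_. M)" and ?QJ = "PiM J (\<lambda>_. M)"
  let ?S = "max_sum G (insert k J)" and ?R = "max_sum G J"
  define N where "N = real (card I)"
  have Sm [measurable]: "?S \<in> borel_measurable ?Q" and Rm [measurable]: "?R \<in> borel_measurable ?Q"
    by (intro max_sum_measurable fin gm; auto)+
  have Sr: "\<bar>?S x\<bar> \<le> N" for x
    using max_sum_bound[OF fin gr, of "insert k J" x] J by (simp add: N_def I)
  have Rr: "\<bar>?R x\<bar> \<le> N" for x
    using max_sum_bound[OF fin gr, of J x] J by (simp add: N_def I)
  have Dr: "?S x - ?R x \<in> {-1..1}" for x
    using max_sum_remove_diff(2)[OF fin \<open>finite I\<close> gr, of k x] \<open>k \<in> I\<close> by (simp add: I J)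
  have er: "exp (l * t) \<in> {exp (- N)..exp N}" if "\<bar>t\<bar> \<le> N" for t
  proof -
    have "\<bar>l * t\<bar> \<le> 1 * N" unfolding abs_mult using l that by (intro mult_mono) auto
    then show ?thesis by auto
  qed
  let ?f = "\<lambda>x. ent_div (exp (l * ?S x)) (exp (l * ?R x))"
  let ?h = "\<lambda>x. (v + 2 * (?S x - ?R x)) * exp (l * ?S x)"
  have fm: "?f \<in> borel_measurable ?Q" and hm: "?h \<in> borel_measurable ?Q" by measurable
  have fr: "?f x \<in> {0..exp N * (exp N / exp (- N)) + exp N}" for x
    using ent_div_nonneg[of "exp (l * ?S x)" "exp (l * ?R x)"]
      ent_div_le[OF _ er[OF Sr] er[OF Rr], of x x] by simp
  have hr: "?h x \<in> {- ((v + 2) * exp N)..(v + 2) * exp N}" for x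
  proof -
    have "\<bar>?h x\<bar> \<le> (v + 2) * exp N"
      unfolding abs_mult using Dr[of x] er[OF Sr[of x]] v0 by (intro mult_mono) auto
    then show ?thesis by auto
  qed
  have eq: "?R (x(k := y)) = ?R x" for x y
  proof -
    have "(\<Sum>i\<in>J. g ((x(k := y)) i)) = (\<Sum>i\<in>J. g (x i))" for g :: "'a \<Rightarrow> real"
      using J by (intro sum.cong) auto
    then show ?thesis by (simp add: max_sum_def)
  qed
  have "(\<integral>x. ?f x \<partial>?Q) = (\<integral>x. (\<integral>y. ?f (x(k := y)) \<partial>M) \<partial>?QJ)"
    by (intro Q.product_integral_insert J QI.integrable_range[OF fm fr])
  also have "\<dots> \<le> (\<integral>x. l\<^sup>2 * (\<integral>y. ?h (x(k := y)) \<partial>M) \<partial>?QJ)"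
  proof (rule integral_mono)
    show "integrable ?QJ (\<lambda>x. \<integral>y. ?f (x(k := y)) \<partial>M)"
      by (rule integrable_PiM_integral[OF fm fr])
    show "integrable ?QJ (\<lambda>x. l\<^sup>2 * (\<integral>y. ?h (x(k := y)) \<partial>M))"
      using integrable_PiM_integral[OF hm hr] by (rule integrable_mult_right)
    fix x assume x: "x \<in> space ?QJ"
    obtain g where g: "g \<in> G" "\<And>y. g y \<le> ?S (x(k := y)) - ?R x"
      using max_sum_insert_diff[OF fin J] by blast
    have [measurable]: "(\<lambda>y. ?S (x(k := y))) \<in> borel_measurable M"
      using measurable_PiM_upd[OF x Sm] .
    define D where "D y = ?S (x(k := y)) - ?R x" for y
    have "expectation (\<lambda>y. ent_div (exp (l * (?R x + D y))) (exp (l * ?R x)))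
      \<le> l\<^sup>2 * expectation (\<lambda>y. (v + 2 * D y) * exp (l * (?R x + D y)))"
    proof (rule ent_div_exp_le[where Y = g])
      show "D \<in> borel_measurable M" unfolding D_def by measurable
      show "D y \<in> {-1..1}" for y using Dr[of "x(k := y)"] by (simp only: D_def eq)
      show "g y \<le> D y" for y using g by (simp add: D_def)
    qed (use g l gm g0 gv v0 range_subsetD[OF gr] in auto)
    then show "(\<integral>y. ?f (x(k := y)) \<partial>M) \<le> l\<^sup>2 * (\<integral>y. ?h (x(k := y)) \<partial>M)"
      by (simp only: D_def eq add.commute[of "?R x"] diff_add_cancel)
  qed
  also have "\<dots> = l\<^sup>2 * (\<integral>x. (\<integral>y. ?h (x(k := y)) \<partial>M) \<partial>?QJ)" by simp
  also have "(\<integral>x. (\<integral>y. ?h (x(k := y)) \<partial>M) \<partial>?QJ) = (\<integral>x. ?h x \<partial>?Q)"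
    by (intro Q.product_integral_insert[symmetric] J QI.integrable_range[OF hm hr])
  finally show ?thesis using J by (simp add: I)
qed

text \<open>Tensorization with the leave-one-out exponentials as comparison functions. Summed over
  \<open>k\<close>, the variances give \<open>card I * v\<close>, and the increments give at most
  \<open>S\<close> under the positive weight \<open>exp (l * S)\<close>.\<close>

lemma mgf_max_sum_entropy:
  fixes G :: "('a \<Rightarrow> real) set" and I :: "'i set"
  assumes "finite I" and fin: "finite G" "G \<noteq> {}"
    and gm: "\<And>g. g \<in> G \<Longrightarrow> g \<in> borel_measurable M"
    and gr: "\<And>g. g \<in> G \<Longrightarrow> range g \<subseteq> {-1..1}"
    and g0: "\<And>g. g \<in> G \<Longrightarrow> expectation g = 0"
    and gv: "\<And>g. g \<in> G \<Longrightarrow> expectation (\<lambda>z. (g z)\<^sup>2) \<le> v"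
    and l: "0 < l" "l \<le> 1"
  defines "S \<equiv> max_sum G I" and "Q \<equiv> PiM I (\<lambda>_. M)"
  shows "l * (\<integral>x. S x * exp (l * S x) \<partial>Q) - (\<integral>x. exp (l * S x) \<partial>Q) * ln (\<integral>x. exp (l * S x) \<partial>Q)
    \<le> l\<^sup>2 * (real (card I) * v * (\<integral>x. exp (l * S x) \<partial>Q) + 2 * (\<integral>x. S x * exp (l * S x) \<partial>Q))"
proof -
  interpret Q: prob_space Q unfolding Q_def by (rule prob_space_PiM) (rule prob_space_axioms)
  let ?R = "\<lambda>k. max_sum G (I - {k})"
  define N where "N = real (card I)"
  have Sm [measurable]: "S \<in> borel_measurable Q" and Rm [measurable]: "?R k \<in> borel_measurable Q" for k
    unfolding S_def Q_def by (intro max_sum_measurable fin gm; auto)+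
  have Sr: "\<bar>S x\<bar> \<le> N" for x
    unfolding S_def N_def by (rule max_sum_bound) (use fin gr \<open>finite I\<close> in auto)
  have Rr: "\<bar>?R k x\<bar> \<le> N" for k x
    using max_sum_bound[OF fin gr, of "I - {k}" x] \<open>finite I\<close> card_mono[of I "I - {k}"]
    by (fastforce simp: N_def)
  have er: "exp (l * t) \<in> {exp (- N)..exp N}" if "\<bar>t\<bar> \<le> N" for t
  proof -
    have "\<bar>l * t\<bar> \<le> 1 * N" unfolding abs_mult using l that by (intro mult_mono) auto
    then show ?thesis by auto
  qed
  have Req: "?R k (x(k := y)) = ?R k x" for k x y
  proof -
    have "(\<Sum>i\<in>I - {k}. g ((x(k := y)) i)) = (\<Sum>i\<in>I - {k}. g (x i))" for g :: "'a \<Rightarrow> real"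
      by (intro sum.cong) auto
    then show ?thesis by (simp add: max_sum_def)
  qed
  have iE: "integrable Q (\<lambda>x. exp (l * S x))"
    by (rule Q.integrable_range[OF _ er[OF Sr]]) simp
  have i_mult: "integrable Q (\<lambda>x. h x * exp (l * S x))"
    if [measurable]: "h \<in> borel_measurable Q" and "\<And>x. \<bar>h x\<bar> \<le> c" for h c
  proof (rule Bochner_Integration.integrable_bound[OF integrable_mult_right[OF iE, of c]])
    show "AE x in Q. norm (h x * exp (l * S x)) \<le> norm (c * exp (l * S x))"
      using that(2) by (intro AE_I2) (auto simp: abs_mult intro!: mult_right_mono order_trans[OF _ abs_ge_self])
  qed simp
  have iSE: "integrable Q (\<lambda>x. S x * exp (l * S x))" by (rule i_mult[OF Sm Sr])
  have iDE: "integrable Q (\<lambda>x. (S x - ?R k x) * exp (l * S x))" for k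
  proof (rule i_mult)
    show "\<bar>S x - ?R k x\<bar> \<le> 2 * N" for x using Sr[of x] Rr[of k x] by linarith
  qed simp
  have "l * (\<integral>x. S x * exp (l * S x) \<partial>Q) = (\<integral>x. exp (l * S x) * ln (exp (l * S x)) \<partial>Q)"
    by (simp add: mult_ac flip: integral_mult_right_zero)
  then have "l * (\<integral>x. S x * exp (l * S x) \<partial>Q) - (\<integral>x. exp (l * S x) \<partial>Q) * ln (\<integral>x. exp (l * S x) \<partial>Q)
    = (\<integral>x. exp (l * S x) * ln (exp (l * S x)) \<partial>Q) - (\<integral>x. exp (l * S x) \<partial>Q) * ln (\<integral>x. exp (l * S x) \<partial>Q)"
    by simp
  also have "\<dots> \<le> (\<Sum>k\<in>I. \<integral>x. ent_div (exp (l * S x)) (exp (l * ?R k x)) \<partial>Q)"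
    unfolding Q_def
  proof (rule entropy_tensorization[OF \<open>finite I\<close>])
    show "0 < exp (- N)" by simp
    show "exp (l * S x) \<in> {exp (- N)..exp N}" for x by (rule er[OF Sr])
    show "exp (l * ?R k x) \<in> {exp (- N)..exp N}" for k x by (rule er[OF Rr])
    show "exp (l * ?R k (x(k := y))) = exp (l * ?R k x)" for k x y by (simp only: Req)
  qed (unfold Q_def[symmetric], measurable)
  also have "\<dots> \<le> (\<Sum>k\<in>I. l\<^sup>2 * (\<integral>x. (v + 2 * (S x - ?R k x)) * exp (l * S x) \<partial>Q))"
    unfolding S_def Q_def
    by (intro sum_mono ent_div_max_sum_le[OF \<open>finite I\<close> _ fin gm gr g0 gv l])
  also have "\<dots> = l\<^sup>2 * (\<Sum>k\<in>I. v * (\<integral>x. exp (l * S x) \<partial>Q) + 2 * (\<integral>x. (S x - ?R k x) * exp (l * S x) \<partial>Q))"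
  proof -
    have "(\<integral>x. (v + 2 * (S x - ?R k x)) * exp (l * S x) \<partial>Q)
      = v * (\<integral>x. exp (l * S x) \<partial>Q) + 2 * (\<integral>x. (S x - ?R k x) * exp (l * S x) \<partial>Q)" for k
    proof -
      have "(\<integral>x. (v + 2 * (S x - ?R k x)) * exp (l * S x) \<partial>Q)
        = (\<integral>x. v * exp (l * S x) + 2 * ((S x - ?R k x) * exp (l * S x)) \<partial>Q)"
        by (intro Bochner_Integration.integral_cong) (auto simp: algebra_simps)
      then show ?thesis
        using integrable_mult_right[OF iE, of v] integrable_mult_right[OF iDE[of k], of 2] by simp
    qed
    then show ?thesis by (simp add: sum_distrib_left)
  qed
  also have "\<dots> = l\<^sup>2 * (real (card I) * v * (\<integral>x. exp (l * S x) \<partial>Q)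
      + 2 * (\<Sum>k\<in>I. \<integral>x. (S x - ?R k x) * exp (l * S x) \<partial>Q))"
    by (simp add: sum.distrib sum_distrib_left)
  also have "(\<Sum>k\<in>I. \<integral>x. (S x - ?R k x) * exp (l * S x) \<partial>Q)
      = (\<integral>x. (\<Sum>k\<in>I. (S x - ?R k x)) * exp (l * S x) \<partial>Q)"
    using iDE by (simp add: sum_distrib_right)
  also have "l\<^sup>2 * (real (card I) * v * (\<integral>x. exp (l * S x) \<partial>Q) + 2 * (\<integral>x. (\<Sum>k\<in>I. (S x - ?R k x)) * exp (l * S x) \<partial>Q))
    \<le> l\<^sup>2 * (real (card I) * v * (\<integral>x. exp (l * S x) \<partial>Q) + 2 * (\<integral>x. S x * exp (l * S x) \<partial>Q))"
  proof (intro mult_left_mono add_left_mono integral_mono mult_right_mono)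
    show "integrable Q (\<lambda>x. (\<Sum>k\<in>I. (S x - ?R k x)) * exp (l * S x))"
      unfolding sum_distrib_right using iDE by simp
    show "(\<Sum>k\<in>I. (S x - ?R k x)) \<le> S x" for x
      unfolding S_def by (rule max_sum_remove_diff(1)[OF fin \<open>finite I\<close>])
  qed (use iSE in auto)
  finally show ?thesis .
qed

text \<open>Herbst's argument: the entropy inequality bounds the derivative of
  \<open>ln (\<Psi> l) / l\<close>, and this quotient tends to the mean of \<open>S\<close> at 0,
  being a difference quotient of \<open>ln \<Psi>\<close>. The term \<open>2 * \<Psi>' l\<close> on
  the right is absorbed and produces the denominator \<open>1 - 2 * l\<close>.\<close>

lemma mgf_max_sum_le:
  fixes G :: "('a \<Rightarrow> real) set" and I :: "'i set"
  assumes "finite I" and fin: "finite G" "G \<noteq> {}"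
    and gm: "\<And>g. g \<in> G \<Longrightarrow> g \<in> borel_measurable M"
    and gr: "\<And>g. g \<in> G \<Longrightarrow> range g \<subseteq> {-1..1}"
    and g0: "\<And>g. g \<in> G \<Longrightarrow> expectation g = 0"
    and gv: "\<And>g. g \<in> G \<Longrightarrow> expectation (\<lambda>z. (g z)\<^sup>2) \<le> v"
    and l: "0 < l" "l < 1 / 2"
  defines "S \<equiv> max_sum G I" and "Q \<equiv> PiM I (\<lambda>_. M)"
  shows "(\<integral>x. exp (l * S x) \<partial>Q)
    \<le> exp (l * ((\<integral>x. S x \<partial>Q) + real (card I) * v * l) / (1 - 2 * l))"
proof -
  interpret Q: prob_space Q unfolding Q_def by (rule prob_space_PiM) (rule prob_space_axioms)
  define N where "N = real (card I)"
  define \<Psi> where "\<Psi> l = (\<integral>x. exp (l * S x) \<partial>Q)" for l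
  define \<Psi>' where "\<Psi>' l = (\<integral>x. S x * exp (l * S x) \<partial>Q)" for l
  have Sm [measurable]: "S \<in> borel_measurable Q"
    unfolding S_def Q_def by (intro max_sum_measurable fin gm; auto)+
  \<comment> \<open>The extra 1 keeps the bound positive when \<open>I\<close> is empty, as
    differentiation under the integral requires.\<close>
  have Sr: "\<bar>S x\<bar> \<le> N + 1" for x
    unfolding S_def N_def using max_sum_bound[OF fin gr, of I x] \<open>finite I\<close> by linarith
  have deriv: "(\<Psi> has_real_derivative \<Psi>' l) (at l)" for l
    unfolding \<Psi>_def[abs_def] \<Psi>'_def using Sr by (intro Q.mgf_has_derivative[where b = "N + 1"]) (auto simp: N_def)
  have pos: "0 < \<Psi> l" for l
  proof -
    have b: "exp (l * S x) \<in> {exp (- (\<bar>l\<bar> * (N + 1)))..exp (\<bar>l\<bar> * (N + 1))}" for x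
    proof -
      have "\<bar>l * S x\<bar> \<le> \<bar>l\<bar> * (N + 1)" unfolding abs_mult by (intro mult_left_mono Sr) auto
      then show ?thesis by auto
    qed
    have "\<Psi> l \<in> {exp (- (\<bar>l\<bar> * (N + 1)))..exp (\<bar>l\<bar> * (N + 1))}"
      unfolding \<Psi>_def by (rule Q.expectation_range[OF _ b]) simp
    then show ?thesis by (auto intro: less_le_trans[OF exp_gt_zero])
  qed
  have ineq: "l * \<Psi>' l - \<Psi> l * ln (\<Psi> l) \<le> l\<^sup>2 * (N * v * \<Psi> l + 2 * \<Psi>' l)" if "0 < l" "l \<le> 1" for l
    unfolding \<Psi>_def \<Psi>'_def N_def S_def Q_def
    by (rule mgf_max_sum_entropy[OF \<open>finite I\<close> fin gm gr g0 gv that])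
  \<comment> \<open>Divided by \<open>l\<^sup>2 * \<Psi> l\<close>, the entropy inequality compares
    the derivative of \<open>ln (\<Psi> l) / l\<close> with that of
    \<open>N * v * l + 2 * ln (\<Psi> l)\<close>; \<open>h\<close> is the difference of these
    antiderivatives and so is nonincreasing.\<close>
  define h where "h l = ln (\<Psi> l) * (1 / l - 2) - N * v * l" for l
  have h_deriv: "(h has_real_derivative
      (\<Psi>' t / \<Psi> t * (1 / t - 2) - ln (\<Psi> t) / t\<^sup>2 - N * v)) (at t)" if "0 < t" for t
    unfolding h_def[abs_def] using pos[of t] that
    by (auto intro!: derivative_eq_intros deriv simp: power2_eq_square field_simps)
  have h_mono: "h l \<le> h d" if "0 < d" "d \<le> l" for d
  proof (rule DERIV_nonpos_imp_nonincreasing[OF that(2)])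
    fix t assume t: "d \<le> t" "t \<le> l"
    then have t': "0 < t" "t \<le> 1" using that l by auto
    have "\<Psi>' t / \<Psi> t * (1 / t - 2) - ln (\<Psi> t) / t\<^sup>2 - N * v
        = (t * \<Psi>' t - \<Psi> t * ln (\<Psi> t) - t\<^sup>2 * (N * v * \<Psi> t + 2 * \<Psi>' t)) / (t\<^sup>2 * \<Psi> t)"
      using t' pos[of t] by (simp add: field_simps power2_eq_square)
    also have "\<dots> \<le> 0"
      using ineq[OF t'] pos[of t] by (intro divide_nonpos_nonneg) auto
    finally show "\<exists>y. (h has_real_derivative y) (at t) \<and> y \<le> 0"
      using h_deriv[OF t'(1)] by blast
  qed
  have \<Psi>0: "\<Psi> 0 = 1" "\<Psi>' 0 = (\<integral>x. S x \<partial>Q)"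
    by (simp_all add: \<Psi>_def \<Psi>'_def Q.prob_space)
  have "((\<lambda>t. ln (\<Psi> t)) has_real_derivative (\<Psi>' 0 / \<Psi> 0)) (at 0)"
    using pos[of 0] by (auto intro!: derivative_eq_intros deriv)
  then have "((\<lambda>t. ln (\<Psi> t) / t) \<longlongrightarrow> (\<integral>x. S x \<partial>Q)) (at 0)"
    by (simp add: DERIV_def \<Psi>0)
  then have lim1: "((\<lambda>t. ln (\<Psi> t) / t) \<longlongrightarrow> (\<integral>x. S x \<partial>Q)) (at_right 0)"
    by (rule filterlim_mono) (auto simp: at_le)
  have "isCont \<Psi> 0" using deriv by (rule DERIV_isCont)
  then have "(\<Psi> \<longlongrightarrow> 1) (at_right 0)"
    using \<Psi>0 by (auto simp: isCont_def intro: filterlim_mono[OF _ order_refl at_le])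
  then have lim2: "((\<lambda>t. ln (\<Psi> t)) \<longlongrightarrow> ln 1) (at_right 0)"
    by (intro tendsto_ln) auto
  have "((\<lambda>t. ln (\<Psi> t) / t - 2 * ln (\<Psi> t) - N * v * t) \<longlongrightarrow> (\<integral>x. S x \<partial>Q) - 2 * ln 1 - N * v * 0) (at_right 0)"
    by (intro tendsto_diff tendsto_mult tendsto_const tendsto_ident_at lim1 lim2)
  then have "((\<lambda>t. ln (\<Psi> t) / t - 2 * ln (\<Psi> t) - N * v * t) \<longlongrightarrow> (\<integral>x. S x \<partial>Q)) (at_right 0)"
    by simp
  then have "h l \<le> (\<integral>x. S x \<partial>Q)"
  proof (rule tendsto_lowerbound)
    have "h t = ln (\<Psi> t) / t - 2 * ln (\<Psi> t) - N * v * t" for t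
      by (simp add: h_def right_diff_distrib)
    then show "\<forall>\<^sub>F t in at_right 0. h l \<le> ln (\<Psi> t) / t - 2 * ln (\<Psi> t) - N * v * t"
      unfolding eventually_at_right_field using h_mono l by (intro exI[of _ l]) auto
  qed simp
  then have "ln (\<Psi> l) * ((1 - 2 * l) / l) \<le> (\<integral>x. S x \<partial>Q) + N * v * l"
    using l by (simp add: h_def field_simps)
  then have "ln (\<Psi> l) \<le> ((\<integral>x. S x \<partial>Q) + N * v * l) / ((1 - 2 * l) / l)"
    using l by (subst pos_le_divide_eq) auto
  then have "\<Psi> l \<le> exp (((\<integral>x. S x \<partial>Q) + N * v * l) / ((1 - 2 * l) / l))"
    using pos[of l] by (metis exp_le_cancel_iff exp_ln)
  then show ?thesis
    by (simp add: \<Psi>_def N_def mult.commute)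
qed

section \<open>Classes with a subexponential envelope\<close>

lemma integral_PiM_component:
  fixes f :: "'a \<Rightarrow> real"
  assumes "i \<in> I" "f \<in> borel_measurable M"
  shows "(\<integral>x. f (x i) \<partial>PiM I (\<lambda>_. M)) = expectation f"
proof -
  have "expectation f = (\<integral>y. f y \<partial>distr (PiM I (\<lambda>_. M)) M (\<lambda>x. x i))"
    using assms(1) by (subst distr_PiM_component) (auto intro: prob_space_axioms)
  also have "\<dots> = (\<integral>x. f (x i) \<partial>PiM I (\<lambda>_. M))"
    using assms by (intro integral_distr) auto
  finally show ?thesis by simp
qed

lemma integrable_PiM_component:
  fixes f :: "'a \<Rightarrow> real"
  assumes "i \<in> I" "f \<in> borel_measurable M"
  shows "integrable (PiM I (\<lambda>_. M)) (\<lambda>x. f (x i)) \<longleftrightarrow> integrable M f"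
proof -
  have "integrable M f \<longleftrightarrow> integrable (distr (PiM I (\<lambda>_. M)) M (\<lambda>x. x i)) f"
    using assms(1) by (subst distr_PiM_component) (auto intro: prob_space_axioms)
  also have "\<dots> \<longleftrightarrow> integrable (PiM I (\<lambda>_. M)) (\<lambda>x. f (x i))"
    using assms by (intro integrable_distr_eq) auto
  finally show ?thesis by simp
qed

lemma exp_component_integrable:
  fixes E :: "'a \<Rightarrow> real"
  assumes I: "finite I" "I \<noteq> {}" and [measurable]: "E \<in> borel_measurable M" and c: "0 < c"
    and W: "integrable (PiM I (\<lambda>_. M)) (\<lambda>x. exp (Max ((\<lambda>i. E (x i)) ` I) / c))"
  shows "integrable M (\<lambda>z. exp (E z / c))"
proof -
  obtain i where i: "i \<in> I" using I by auto
  have m: "(\<lambda>x. exp (E (x i) / c)) \<in> borel_measurable (PiM I (\<lambda>_. M))"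
    using i by measurable
  have "integrable (PiM I (\<lambda>_. M)) (\<lambda>x. exp (E (x i) / c))"
    using I i c by (intro Bochner_Integration.integrable_bound[OF W m] AE_I2)
      (auto intro!: divide_right_mono Max_ge)
  then show ?thesis
    using i integrable_PiM_component[of i I "\<lambda>z. exp (E z / c)"] by simp
qed

lemma integrable_if_exp_moment:
  fixes h :: "'a \<Rightarrow> real"
  assumes [measurable]: "h \<in> borel_measurable M" and c: "0 < c"
    and W: "integrable M (\<lambda>z. exp (\<bar>h z\<bar> / c))"
  shows "integrable M h" "integrable M (\<lambda>z. (h z)\<^sup>2)"
proof -
  have taylor: "1 + \<bar>h z\<bar> / c + (\<bar>h z\<bar> / c)\<^sup>2 / 2 \<le> exp (\<bar>h z\<bar> / c)" for z
    using c by (intro exp_lower_Taylor_quadratic) auto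
  show "integrable M h"
  proof (rule Bochner_Integration.integrable_bound[OF integrable_mult_right[OF W, of c]])
    show "AE z in M. norm (h z) \<le> norm (c * exp (\<bar>h z\<bar> / c))"
    proof (rule AE_I2)
      fix z
      have "\<bar>h z\<bar> / c \<le> exp (\<bar>h z\<bar> / c)"
        using exp_ge_add_one_self[of "\<bar>h z\<bar> / c"] by linarith
      then show "norm (h z) \<le> norm (c * exp (\<bar>h z\<bar> / c))"
        using c by (simp add: pos_divide_le_eq abs_mult mult.commute)
    qed
  qed measurable
  show "integrable M (\<lambda>z. (h z)\<^sup>2)"
  proof (rule Bochner_Integration.integrable_bound[OF integrable_mult_right[OF W, of "2 * c\<^sup>2"]])
    show "AE z in M. norm ((h z)\<^sup>2) \<le> norm (2 * c\<^sup>2 * exp (\<bar>h z\<bar> / c))"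
    proof (rule AE_I2)
      fix z
      have "0 \<le> \<bar>h z\<bar> / c" using c by simp
      then have "(\<bar>h z\<bar> / c)\<^sup>2 \<le> 2 * exp (\<bar>h z\<bar> / c)" using taylor[of z] by linarith
      then show "norm ((h z)\<^sup>2) \<le> norm (2 * c\<^sup>2 * exp (\<bar>h z\<bar> / c))"
        using c by (simp add: power_divide pos_divide_le_eq mult_ac)
    qed
  qed measurable
qed

text \<open>Let \<open>p\<close> be the probability of no excess in one coordinate. The exponential
  moment forces \<open>p ^ card I \<ge> 1 / 2\<close>. Restricted to the disjoint events that
  exactly one coordinate is in excess, the same moment minus 1 dominates
  \<open>card I * expectation e * p ^ (card I - 1)\<close>. It is at most 1, so dividing by the
  power of \<open>p\<close> costs a factor 2.\<close>

lemma exp_truncated_envelope: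
  fixes E :: "'a \<Rightarrow> real" and I :: "'i set"
  assumes I: "finite I" "I \<noteq> {}" and [measurable]: "E \<in> borel_measurable M" and c: "0 < c"
    and E0: "\<And>z. 0 \<le> E z"
    and W: "integrable (PiM I (\<lambda>_. M)) (\<lambda>x. exp (Max ((\<lambda>i. E (x i)) ` I) / c))"
    and W2: "(\<integral>x. exp (Max ((\<lambda>i. E (x i)) ` I) / c) \<partial>PiM I (\<lambda>_. M)) \<le> 2"
  defines "Y \<equiv> \<lambda>z. if E z \<le> 2 * c then 0 else E z"
  shows "integrable M (\<lambda>z. exp (Y z / c) - 1)"
    and "real (card I) * expectation (\<lambda>z. exp (Y z / c) - 1) \<le> 2"
proof -
  interpret QQ: prob_space "PiM I (\<lambda>_. M)" by (rule prob_space_PiM) (rule prob_space_axioms)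
  interpret Q: product_prob_space "\<lambda>_. M" I by standard
  let ?Q = "PiM I (\<lambda>_. M)"
  let ?W = "\<lambda>x. exp (Max ((\<lambda>i. E (x i)) ` I) / c)"
  have [measurable]: "Y \<in> borel_measurable M" unfolding Y_def by measurable
  define e where "e z = exp (Y z / c) - 1" for z
  define d where "d z = (if E z \<le> 2 * c then 1 else 0 :: real)" for z
  have [measurable]: "e \<in> borel_measurable M" "d \<in> borel_measurable M"
    unfolding e_def[abs_def] d_def[abs_def] by measurable
  have e0: "0 \<le> e z" for z unfolding e_def Y_def using E0[of z] c by simp
  have ie: "integrable M e"
  proof (rule Bochner_Integration.integrable_bound[OF exp_component_integrable[OF I _ c W]])
    show "AE z in M. norm (e z) \<le> norm (exp (E z / c))"
      using e0 E0 c by (intro AE_I2) (auto simp: e_def Y_def)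
  qed measurable
  then show "integrable M (\<lambda>z. exp (Y z / c) - 1)" by (simp add: e_def[abs_def])
  have id: "integrable M d"
    by (rule integrable_range[where a = 0 and b = 1]) (auto simp: d_def)
  define p where "p = expectation d"
  have p: "0 \<le> p" "p \<le> 1"
    using expectation_range[of d 0 1] by (auto simp: p_def d_def)
  \<comment> \<open>The product of \<open>f i j (x j)\<close> over \<open>j\<close> vanishes unless
    coordinate \<open>i\<close>, and no other, is in excess; hence at most one of these products is
    nonzero at any \<open>x\<close>.\<close>
  define f where "f i j = (if j = i then e else d)" for i j :: 'i
  have fi: "integrable M (f i j)" for i j using ie id by (simp add: f_def)
  have f0: "0 \<le> f i j z" for i j z using e0 by (simp add: f_def d_def)
  have prod_d: "(\<integral>x. (\<Prod>j\<in>I. d (x j)) \<partial>?Q) = p ^ card I"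
    using Q.product_integral_prod[OF I(1), of "\<lambda>_. d"] id by (simp add: p_def)
  have prod_f: "(\<integral>x. (\<Prod>j\<in>I. f i j (x j)) \<partial>?Q) = expectation e * p ^ (card I - 1)" if "i \<in> I" for i
  proof -
    have "(\<integral>x. (\<Prod>j\<in>I. f i j (x j)) \<partial>?Q) = (\<Prod>j\<in>I. expectation (f i j))"
      using Q.product_integral_prod[OF I(1), of "f i"] fi by simp
    also have "\<dots> = expectation e * (\<Prod>j\<in>I - {i}. p)"
      unfolding prod.remove[OF I(1) that] by (auto simp: f_def p_def intro!: prod.cong)
    finally show ?thesis using that I by (simp add: card_Diff_singleton)
  qed
  have half: "1 / 2 \<le> p ^ card I"
  proof -
    \<comment> \<open>One excess already makes \<open>?W x\<close> at least
      \<open>exp 2 \<ge> 4\<close>, twice the bound on its mean. This is the reason for the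
      truncation level \<open>2 * c\<close>.\<close>
    have "4 * (1 - p ^ card I) \<le> (\<integral>x. ?W x \<partial>?Q)"
    proof -
      have i1: "integrable ?Q (\<lambda>x. \<Prod>j\<in>I. d (x j))"
        using Q.product_integrable_prod[OF I(1), of "\<lambda>_. d"] id by simp
      have "4 * (1 - p ^ card I) = (\<integral>x. 4 * (1 - (\<Prod>j\<in>I. d (x j))) \<partial>?Q)"
        using i1 by (simp add: prod_d QQ.prob_space)
      also have "\<dots> \<le> (\<integral>x. ?W x \<partial>?Q)"
      proof (intro integral_mono W)
        fix x
        show "4 * (1 - (\<Prod>j\<in>I. d (x j))) \<le> ?W x"
        proof (cases "\<forall>j\<in>I. E (x j) \<le> 2 * c")
          case True
          then have "(\<Prod>j\<in>I. d (x j)) = 1" by (intro prod.neutral) (simp add: d_def)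
          then show ?thesis by simp
        next
          case False
          then obtain j where j: "j \<in> I" "2 * c < E (x j)" by auto
          then have "(\<Prod>j\<in>I. d (x j)) = 0" using I j by (intro prod_zero) (auto simp: d_def intro!: bexI[of _ j])
          moreover have "2 * c < Max ((\<lambda>i. E (x i)) ` I)"
            using j I by (intro less_le_trans[OF j(2)] Max_ge) auto
          then have "2 \<le> Max ((\<lambda>i. E (x i)) ` I) / c" using c by (simp add: field_simps)
          then have "exp 2 \<le> ?W x" by simp
          then have "4 \<le> ?W x"
            using exp_lower_Taylor_quadratic[of 2] by (simp del: exp_le_cancel_iff)
          ultimately show ?thesis by simp
        qed
      qed (use i1 in auto)
      finally show ?thesis .
    qed
    then show ?thesis using W2 by simp
  qed
  have "p ^ card I \<le> p ^ (card I - 1)" using p by (intro power_decreasing) auto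
  with half have half': "1 / 2 \<le> p ^ (card I - 1)" by simp
  have pt: "(\<Sum>i\<in>I. \<Prod>j\<in>I. f i j (x j)) + 1 \<le> ?W x" for x
  proof -
    have W1: "1 \<le> ?W x"
    proof -
      obtain i where "i \<in> I" using I by auto
      then have "0 \<le> Max ((\<lambda>i. E (x i)) ` I)"
        using I by (intro order_trans[OF E0 Max_ge]) auto
      then show ?thesis using c by simp
    qed
    have z: "(\<Prod>j\<in>I. f i j (x j)) = 0" if "i \<in> I" "E (x i) \<le> 2 * c" for i
      using that I by (intro prod_zero) (auto simp: f_def e_def Y_def intro!: bexI[of _ i])
    show ?thesis
    proof (cases "\<exists>k\<in>I. 2 * c < E (x k)")
      case False
      then have "(\<Sum>i\<in>I. \<Prod>j\<in>I. f i j (x j)) = 0"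
        using z by (intro sum.neutral) (auto simp: not_less)
      then show ?thesis using W1 by simp
    next
      case True
      then obtain k where k: "k \<in> I" "2 * c < E (x k)" by auto
      have "(\<Prod>j\<in>I. f i j (x j)) = 0" if "i \<in> I - {k}" for i
        using that k I by (intro prod_zero) (auto simp: f_def d_def intro!: bexI[of _ k])
      then have "(\<Sum>i\<in>I. \<Prod>j\<in>I. f i j (x j)) = (\<Prod>j\<in>I. f k j (x j))"
        unfolding sum.remove[OF I(1) k(1)] by simp
      also have "\<dots> = e (x k) * (\<Prod>j\<in>I - {k}. f k j (x j))"
        unfolding prod.remove[OF I(1) k(1)] by (simp add: f_def)
      also have "\<dots> \<le> e (x k) * 1"
        using f0 e0 by (intro mult_left_mono prod_le_1) (auto simp: f_def d_def)
      also have "\<dots> = exp (E (x k) / c) - 1" using k by (simp add: e_def Y_def)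
      also have "\<dots> \<le> ?W x - 1"
        using k I c by (auto intro!: divide_right_mono Max_ge)
      finally show ?thesis by simp
    qed
  qed
  have if': "integrable ?Q (\<lambda>x. \<Prod>j\<in>I. f i j (x j))" for i
    using Q.product_integrable_prod[OF I(1), of "f i"] fi by simp
  have "real (card I) * (expectation e * p ^ (card I - 1)) + 1
      = (\<integral>x. (\<Sum>i\<in>I. \<Prod>j\<in>I. f i j (x j)) + 1 \<partial>?Q)"
    using if' by (simp add: prod_f QQ.prob_space)
  also have "\<dots> \<le> (\<integral>x. ?W x \<partial>?Q)"
    using if' by (intro integral_mono W pt) auto
  finally have "real (card I) * (expectation e * p ^ (card I - 1)) \<le> 1" using W2 by simp
  moreover have "real (card I) * expectation e * (1 / 2) \<le> real (card I) * expectation e * p ^ (card I - 1)"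
    using half' e0 by (intro mult_left_mono mult_nonneg_nonneg) auto
  ultimately show "real (card I) * expectation (\<lambda>z. exp (Y z / c) - 1) \<le> 2"
    by (simp add: e_def[abs_def] mult.assoc)
qed

text \<open>Chernoff at rate \<open>1 / c\<close>: by \<open>1 + a \<le> exp a\<close> the product
  of the \<open>card I\<close> equal moments is at most \<open>exp K\<close>, so \<open>K\<close>
  only shifts the threshold.\<close>

lemma sum_exp_tail:
  fixes Y :: "'a \<Rightarrow> real"
  assumes I: "finite I" and [measurable]: "Y \<in> borel_measurable M" and c: "0 < c"
    and i: "integrable M (\<lambda>z. exp (Y z / c) - 1)"
    and e: "real (card I) * expectation (\<lambda>z. exp (Y z / c) - 1) \<le> K"
  shows "measure (PiM I (\<lambda>_. M)) {x \<in> space (PiM I (\<lambda>_. M)). c * (K + y) \<le> (\<Sum>i\<in>I. Y (x i))} \<le> exp (- y)"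
proof -
  interpret Q: product_prob_space "\<lambda>_. M" I by standard
  let ?Q = "PiM I (\<lambda>_. M)"
  have iE: "integrable M (\<lambda>z. exp (Y z / c))"
    using Bochner_Integration.integrable_add[OF i integrable_const[of 1]] by simp
  define a where "a = expectation (\<lambda>z. exp (Y z / c) - 1)"
  have a: "expectation (\<lambda>z. exp (Y z / c)) = 1 + a"
    using iE by (simp add: a_def prob_space)
  have "0 \<le> 1 + a" unfolding a[symmetric] by simp
  have eq: "exp ((\<Sum>i\<in>I. Y (x i)) / c) = (\<Prod>i\<in>I. exp (Y (x i) / c))" for x
    using I by (simp add: exp_sum sum_divide_distrib)
  have int: "integrable ?Q (\<lambda>x. exp ((\<Sum>i\<in>I. Y (x i)) / c))"
    unfolding eq using Q.product_integrable_prod[OF I, of "\<lambda>_ z. exp (Y z / c)"] iE by simp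
  have "(\<integral>x. exp ((\<Sum>i\<in>I. Y (x i)) / c) \<partial>?Q) = (1 + a) ^ card I"
    unfolding eq using Q.product_integral_prod[OF I, of "\<lambda>_ z. exp (Y z / c)"] iE by (simp add: a)
  also have "\<dots> \<le> exp a ^ card I"
    using exp_ge_add_one_self[of a] \<open>0 \<le> 1 + a\<close> by (intro power_mono) auto
  also have "\<dots> = exp (real (card I) * a)" by (simp add: exp_of_nat_mult)
  also have "\<dots> \<le> exp K" using e by (simp add: a_def)
  finally have le: "(\<integral>x. exp ((\<Sum>i\<in>I. Y (x i)) / c) \<partial>?Q) \<le> exp K" .
  have "{x \<in> space ?Q. c * (K + y) \<le> (\<Sum>i\<in>I. Y (x i))}
      = {x \<in> space ?Q. exp (K + y) \<le> exp ((\<Sum>i\<in>I. Y (x i)) / c)}"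
    using c by (auto simp: pos_le_divide_eq mult.commute)
  also have "measure ?Q \<dots> \<le> (\<integral>x. exp ((\<Sum>i\<in>I. Y (x i)) / c) \<partial>?Q) / exp (K + y)"
    by (rule integral_Markov_inequality_measure[OF int, of "{}"]) auto
  also have "\<dots> \<le> exp K / exp (K + y)" using le by (intro divide_right_mono) auto
  also have "\<dots> = exp (- y)" by (simp add: exp_add exp_minus field_simps)
  finally show ?thesis .
qed

section \<open>Tail bound for a finite unbounded class\<close>

text \<open>Cut each \<open>h\<close> to \<open>t h\<close> where the envelope is at most
  \<open>2 * c\<close>. The parts cut off are dominated by \<open>Y\<close>, whose sum has
  exponential tails; the centred cut functions form a bounded class to which the entropy bound
  applies.\<close>

lemma finite_class_deviation:
  fixes H :: "('a \<Rightarrow> real) set" and I :: "'i set"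
  assumes I: "finite I" "I \<noteq> {}" and fin: "finite H" "H \<noteq> {}"
    and hm [measurable]: "\<And>h. h \<in> H \<Longrightarrow> h \<in> borel_measurable M"
    and c: "0 < c"
  defines "E \<equiv> \<lambda>z. Max ((\<lambda>h. \<bar>h z\<bar>) ` H)"
    and "Q \<equiv> PiM I (\<lambda>_. M)"
    and "dev \<equiv> \<lambda>x. Max ((\<lambda>h. \<bar>(\<Sum>i\<in>I. h (x i)) - real (card I) * expectation h\<bar>) ` H)"
  assumes W: "integrable Q (\<lambda>x. exp (Max ((\<lambda>i. E (x i)) ` I) / c))"
    and W2: "(\<integral>x. exp (Max ((\<lambda>i. E (x i)) ` I) / c) \<partial>Q) \<le> 2"
    and v: "\<And>h. h \<in> H \<Longrightarrow> expectation (\<lambda>z. (h z)\<^sup>2) \<le> v"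
    and D: "(\<integral>x. dev x \<partial>Q) \<le> T / 4"
    and y: "1 \<le> y" and T1: "1000 * c * y \<le> T" and T2: "1000 * real (card I) * v * y \<le> T\<^sup>2"
  shows "measure Q {x \<in> space Q. T < dev x} \<le> 2 * exp (- y)"
proof -
  interpret Q: product_prob_space "\<lambda>_. M" I by standard
  interpret QQ: prob_space Q unfolding Q_def by (rule prob_space_PiM) (rule prob_space_axioms)
  define n where "n = real (card I)"
  have n: "0 \<le> n" by (simp add: n_def)
  have v0: "0 \<le> v"
  proof -
    obtain h where "h \<in> H" using fin by auto
    then show ?thesis using order_trans[OF _ v[of h], of 0] by simp
  qed
  have Em [measurable]: "E \<in> borel_measurable M"
    unfolding E_def using hm by (intro borel_measurable_Max fin) auto
  have E_ge: "\<bar>h z\<bar> \<le> E z" if "h \<in> H" for h z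
    unfolding E_def using fin that by (intro Max_ge) auto
  have E0: "0 \<le> E z" for z
    using fin E_ge[of _ z] by (metis abs_ge_zero ex_in_conv order_trans)
  define Y where "Y z = (if E z \<le> 2 * c then 0 else E z)" for z
  have Ym [measurable]: "Y \<in> borel_measurable M" unfolding Y_def[abs_def] by measurable
  have Y0: "0 \<le> Y z" for z using E0 by (simp add: Y_def)
  note tr = exp_truncated_envelope[OF I Em c E0 W[unfolded Q_def] W2[unfolded Q_def], folded Y_def]
  have iexpE: "integrable M (\<lambda>z. exp (\<bar>E z\<bar> / c))"
    using exp_component_integrable[OF I Em c W[unfolded Q_def]] E0 by simp
  have iE: "integrable M E"
    by (rule integrable_if_exp_moment(1)[OF Em c iexpE])
  have v2: "integrable M (\<lambda>z. (h z)\<^sup>2)" if h: "h \<in> H" for h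
  proof (rule Bochner_Integration.integrable_bound[OF integrable_if_exp_moment(2)[OF Em c iexpE]])
    show "AE z in M. norm ((h z)\<^sup>2) \<le> norm ((E z)\<^sup>2)"
    proof (rule AE_I2)
      fix z show "norm ((h z)\<^sup>2) \<le> norm ((E z)\<^sup>2)"
        using power_mono[OF E_ge[OF h, of z], of 2] by simp
    qed
  qed (use h in measurable)
  have iY: "integrable M Y"
    by (rule Bochner_Integration.integrable_bound[OF iE Ym]) (auto simp: Y_def E0)
  have EY: "n * expectation Y \<le> 2 * c"
  proof -
    have "expectation Y \<le> expectation (\<lambda>z. c * (exp (Y z / c) - 1))"
    proof (rule integral_mono[OF iY])
      fix z
      have "Y z / c \<le> exp (Y z / c) - 1" using exp_ge_add_one_self[of "Y z / c"] by linarith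
      then show "Y z \<le> c * (exp (Y z / c) - 1)" using c by (simp add: field_simps)
    qed (use tr in auto)
    also have "\<dots> = c * expectation (\<lambda>z. exp (Y z / c) - 1)" by (rule integral_mult_right_zero)
    finally have "n * expectation Y \<le> n * (c * expectation (\<lambda>z. exp (Y z / c) - 1))"
      using n by (rule mult_left_mono)
    also have "\<dots> = c * (real (card I) * expectation (\<lambda>z. exp (Y z / c) - 1))" by (simp add: n_def)
    also have "\<dots> \<le> c * 2" using tr(2) c by (intro mult_left_mono) auto
    finally show ?thesis by simp
  qed
  define t where "t h z = (if E z \<le> 2 * c then h z else 0)" for h :: "'a \<Rightarrow> real" and z
  define m where "m h = expectation (t h)" for h
  have tm [measurable]: "t h \<in> borel_measurable M" if "h \<in> H" for h
    unfolding t_def[abs_def] using hm[OF that] by measurable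
  have tr: "t h z \<in> {- (2 * c)..2 * c}" if "h \<in> H" for h z
    using E_ge[OF that, of z] c by (auto simp: t_def)
  have it: "integrable M (t h)" if "h \<in> H" for h
    by (rule integrable_range[OF tm[OF that] tr[OF that]])
  have ih: "integrable M h" if "h \<in> H" for h
    by (rule Bochner_Integration.integrable_bound[OF iE hm[OF that]]) (auto simp: E0 E_ge that)
  have mr: "m h \<in> {- (2 * c)..2 * c}" if "h \<in> H" for h
    unfolding m_def by (rule expectation_range[OF tm[OF that] tr[OF that]])
  have ht: "\<bar>h z - t h z\<bar> \<le> Y z" if "h \<in> H" for h z
    using E_ge[OF that, of z] by (simp add: t_def Y_def)
  have hm_m: "n * \<bar>expectation h - m h\<bar> \<le> 2 * c" if "h \<in> H" for h
  proof -
    have "\<bar>expectation h - m h\<bar> = \<bar>expectation (\<lambda>z. h z - t h z)\<bar>"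
      using ih[OF that] it[OF that] by (simp add: m_def)
    also have "\<dots> \<le> expectation (\<lambda>z. \<bar>h z - t h z\<bar>)" by (rule integral_abs_bound)
    also have "\<dots> \<le> expectation Y"
      using ih[OF that] it[OF that] iY by (intro integral_mono ht that) auto
    finally show ?thesis using EY mult_left_mono[OF _ n] by fastforce
  qed
  \<comment> \<open>Both \<open>t h\<close> and its mean lie in \<open>{- (2 * c)..2 * c}\<close>,
    hence the divisor \<open>4 * c\<close>. Both signs \<open>s\<close> enter \<open>G\<close>, so
    that the one-sided supremum controls the absolute deviation.\<close>
  define u where "u s h z = s * (t h z - m h) / (4 * c)" for s :: real and h z
  define G where "G = (\<lambda>(s, h). u s h) ` ({1, -1} \<times> H)"
  have G: "finite G" "G \<noteq> {}" using fin by (auto simp: G_def)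
  have GE: thesis if "g \<in> G" "\<And>s h. g = u s h \<Longrightarrow> h \<in> H \<Longrightarrow> \<bar>s\<bar> = 1 \<Longrightarrow> thesis" for g thesis
    using that by (auto simp: G_def)
  have uG: "u 1 h \<in> G" "u (-1) h \<in> G" if "h \<in> H" for h
    using that by (force simp: G_def)+
  have gm: "g \<in> borel_measurable M" if "g \<in> G" for g
    using that by (rule GE) (auto simp: u_def[abs_def])
  have gr: "range g \<subseteq> {-1..1}" if "g \<in> G" for g
    using that
  proof (rule GE)
    fix s h assume g: "g = u s h" and h: "h \<in> H" and s: "\<bar>s\<bar> = 1"
    have "\<bar>u s h z\<bar> \<le> 1" for z
      using tr[OF h, of z] mr[OF h] s c by (simp add: u_def abs_mult divide_le_eq abs_le_iff)
    then show ?thesis unfolding g by (force simp: abs_le_iff minus_le_iff)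
  qed
  have g0: "expectation g = 0" if "g \<in> G" for g
    using that
  proof (rule GE)
    fix s h assume g: "g = u s h" and h: "h \<in> H"
    show ?thesis using it[OF h] unfolding g u_def[abs_def] by (simp add: m_def prob_space)
  qed
  have gv: "expectation (\<lambda>z. (g z)\<^sup>2) \<le> v / (16 * c\<^sup>2)" if "g \<in> G" for g
    using that
  proof (rule GE)
    fix s h assume g: "g = u s h" and h: "h \<in> H" and s: "\<bar>s\<bar> = 1"
    have it2: "integrable M (\<lambda>z. (t h z)\<^sup>2)"
    proof (rule Bochner_Integration.integrable_bound[OF v2[OF h]])
      show "AE z in M. norm ((t h z)\<^sup>2) \<le> norm ((h z)\<^sup>2)" by (auto simp: t_def)
    qed (use h in measurable)
    have s2: "s = 1 \<or> s = -1" using s by linarith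
    have "expectation (\<lambda>z. (g z)\<^sup>2) = expectation (\<lambda>z. ((t h z)\<^sup>2 - 2 * m h * t h z + (m h)\<^sup>2) / (16 * c\<^sup>2))"
      unfolding g u_def using s2
      by (intro Bochner_Integration.integral_cong) (auto simp: power_divide power2_diff power2_eq_square algebra_simps)
    also have "\<dots> = (expectation (\<lambda>z. (t h z)\<^sup>2) - 2 * m h * m h + (m h)\<^sup>2) / (16 * c\<^sup>2)"
      using it[OF h] it2 by (simp add: prob_space m_def)
    also have "\<dots> \<le> expectation (\<lambda>z. (t h z)\<^sup>2) / (16 * c\<^sup>2)"
      by (intro divide_right_mono) (auto simp: power2_eq_square)
    also have "\<dots> \<le> v / (16 * c\<^sup>2)"
    proof (intro divide_right_mono)
      have "expectation (\<lambda>z. (t h z)\<^sup>2) \<le> expectation (\<lambda>z. (h z)\<^sup>2)"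
        using it2 v2[OF h] by (intro integral_mono) (auto simp: t_def)
      then show "expectation (\<lambda>z. (t h z)\<^sup>2) \<le> v" using v[OF h] by linarith
    qed auto
    finally show ?thesis .
  qed
  let ?S = "max_sum G I"
  have Sm: "?S \<in> borel_measurable Q"
    unfolding Q_def by (intro max_sum_measurable G gm) auto
  have sum_u: "4 * c * (\<Sum>i\<in>I. u s h (x i)) = s * ((\<Sum>i\<in>I. t h (x i)) - n * m h)" for s h x
    using c by (simp add: u_def sum_divide_distrib[symmetric] sum_distrib_left[symmetric] sum_subtractf n_def)
  have diff: "\<bar>((\<Sum>i\<in>I. h (x i)) - n * expectation h) - ((\<Sum>i\<in>I. t h (x i)) - n * m h)\<bar>
      \<le> (\<Sum>i\<in>I. Y (x i)) + 2 * c" if h: "h \<in> H" for h x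
  proof -
    have "\<bar>(\<Sum>i\<in>I. h (x i)) - (\<Sum>i\<in>I. t h (x i))\<bar> \<le> (\<Sum>i\<in>I. Y (x i))"
      unfolding sum_subtractf[symmetric] by (rule order_trans[OF sum_abs sum_mono[OF ht[OF h]]])
    moreover have "\<bar>n * expectation h - n * m h\<bar> \<le> 2 * c"
      using hm_m[OF h] n by (simp add: abs_mult right_diff_distrib[symmetric])
    ultimately show ?thesis by linarith
  qed
  have up: "dev x \<le> 4 * c * ?S x + (\<Sum>i\<in>I. Y (x i)) + 2 * c" for x
    unfolding dev_def
  proof (subst Max_le_iff)
    show "\<forall>a\<in>(\<lambda>h. \<bar>(\<Sum>i\<in>I. h (x i)) - real (card I) * expectation h\<bar>) ` H.
      a \<le> 4 * c * ?S x + (\<Sum>i\<in>I. Y (x i)) + 2 * c"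
    proof safe
      fix h assume h: "h \<in> H"
      have "4 * c * (\<Sum>i\<in>I. u s h (x i)) \<le> 4 * c * ?S x" if "s \<in> {1, -1}" for s
        using max_sum_ge[OF G(1), of "u s h" x I] uG[OF h] that c by (intro mult_left_mono) auto
      from this[of 1] this[of "-1"] have "\<bar>(\<Sum>i\<in>I. t h (x i)) - n * m h\<bar> \<le> 4 * c * ?S x"
        unfolding sum_u by simp
      with diff[OF h, of x] show "\<bar>(\<Sum>i\<in>I. h (x i)) - real (card I) * expectation h\<bar>
        \<le> 4 * c * ?S x + (\<Sum>i\<in>I. Y (x i)) + 2 * c" unfolding n_def by linarith
    qed
  qed (use fin in auto)
  \<comment> \<open>The converse comparison is for the means: hypothesis \<open>D\<close> controls
    the mean of the untruncated \<open>dev\<close>, while the entropy bound is centred at the mean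
    of \<open>?S\<close>. Passing from one to the other costs \<open>4 * c\<close>.\<close>
  have low: "4 * c * ?S x \<le> dev x + (\<Sum>i\<in>I. Y (x i)) + 2 * c" for x
  proof -
    obtain g where g: "g \<in> G" "?S x = (\<Sum>i\<in>I. g (x i))"
      using max_sum_attained[OF G] by blast
    from g(1) show ?thesis
    proof (rule GE)
      fix s h assume gu: "g = u s h" and h: "h \<in> H" and s: "\<bar>s\<bar> = 1"
      have "4 * c * ?S x \<le> \<bar>s * ((\<Sum>i\<in>I. t h (x i)) - n * m h)\<bar>"
        unfolding g gu sum_u by simp
      also have "\<dots> = \<bar>(\<Sum>i\<in>I. t h (x i)) - n * m h\<bar>" using s by (simp add: abs_mult)
      also have "\<dots> \<le> \<bar>(\<Sum>i\<in>I. h (x i)) - n * expectation h\<bar> + (\<Sum>i\<in>I. Y (x i)) + 2 * c"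
        using diff[OF h, of x] by linarith
      also have "\<bar>(\<Sum>i\<in>I. h (x i)) - n * expectation h\<bar> \<le> dev x"
        unfolding dev_def n_def using fin h by (intro Max_ge) auto
      finally show ?thesis by simp
    qed
  qed
  have iYQ: "integrable Q (\<lambda>x. \<Sum>i\<in>I. Y (x i))"
    unfolding Q_def using iY by (intro Bochner_Integration.integrable_sum) (simp add: integrable_PiM_component)
  have EYQ: "(\<integral>x. (\<Sum>i\<in>I. Y (x i)) \<partial>Q) \<le> 2 * c"
  proof -
    have "(\<integral>x. (\<Sum>i\<in>I. Y (x i)) \<partial>Q) = (\<Sum>i\<in>I. expectation Y)"
      unfolding Q_def using iY
      by (subst Bochner_Integration.integral_sum) (auto simp: integrable_PiM_component integral_PiM_component)
    then show ?thesis using EY by (simp add: n_def)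
  qed
  have iS: "integrable Q ?S"
  proof (rule QQ.integrable_range[OF Sm])
    show "?S x \<in> {- real (card I)..real (card I)}" for x
    proof -
      have "\<bar>?S x\<bar> \<le> real (card I)" by (intro max_sum_bound G gr I)
      then show ?thesis by auto
    qed
  qed
  have dm: "dev \<in> borel_measurable Q"
    unfolding dev_def Q_def by (intro borel_measurable_Max fin) measurable
  have dev0: "0 \<le> dev x" for x
    using low[of x] fin unfolding dev_def by (auto simp: Max_ge_iff)
  have iD: "integrable Q dev"
  proof (rule Bochner_Integration.integrable_bound[OF _ dm])
    show "integrable Q (\<lambda>x. 4 * c * ?S x + (\<Sum>i\<in>I. Y (x i)) + 2 * c)" using iS iYQ by auto
    show "AE x in Q. norm (dev x) \<le> norm (4 * c * ?S x + (\<Sum>i\<in>I. Y (x i)) + 2 * c)"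
    proof (rule AE_I2)
      fix x show "norm (dev x) \<le> norm (4 * c * ?S x + (\<Sum>i\<in>I. Y (x i)) + 2 * c)"
        using up[of x] dev0[of x] by simp
    qed
  qed
  have ES: "4 * c * (\<integral>x. ?S x \<partial>Q) \<le> T / 4 + 4 * c"
  proof -
    have "4 * c * (\<integral>x. ?S x \<partial>Q) = (\<integral>x. 4 * c * ?S x \<partial>Q)" by simp
    also have "\<dots> \<le> (\<integral>x. dev x + (\<Sum>i\<in>I. Y (x i)) + 2 * c \<partial>Q)"
      using iS iD iYQ by (intro integral_mono low) auto
    also have "\<dots> = (\<integral>x. dev x \<partial>Q) + (\<integral>x. (\<Sum>i\<in>I. Y (x i)) \<partial>Q) + 2 * c"
      using iD iYQ by (simp add: QQ.prob_space)
    finally show ?thesis using D EYQ by linarith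
  qed
  have cy: "0 < c * y" using c y by simp
  then have Tpos: "0 < T" using T1 by linarith
  \<comment> \<open>The Chernoff rate for \<open>dev\<close>. The mean, at most
    \<open>T / 4\<close>, is doubled by the denominator \<open>1 - 2 * l\<close> and uses up half of
    \<open>q * T = 10 * y\<close>. From the remaining \<open>5 * y\<close> the other terms take less
    than \<open>y\<close>, so the required exponent \<open>- y\<close> is reached.\<close>
  define q where "q = 10 * y / T"
  have q0: "0 < q" using y Tpos by (simp add: q_def)
  have qT: "q * T = 10 * y" using Tpos by (simp add: q_def)
  have qcy: "q * (c * y) \<le> y / 100"
  proof -
    have "q * (1000 * c * y) \<le> q * T" using T1 q0 by (intro mult_left_mono) auto
    then show ?thesis unfolding qT by (simp add: mult_ac)
  qed
  have qc: "q * c \<le> q * (c * y)" using q0 c y by simp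
  have qc1: "q * c \<le> 1 / 100"
  proof -
    have "(q * c) * y \<le> (1 / 100) * y" using qcy by (simp add: mult_ac)
    then show ?thesis using y by (subst (asm) mult_le_cancel_right_pos) auto
  qed
  have nvq: "n * v * q\<^sup>2 \<le> y / 10"
  proof -
    have "n * v * q\<^sup>2 * T\<^sup>2 = (1000 * n * v * y) * (y / 10)"
      using qT by (simp add: power_mult_distrib[symmetric] mult.assoc) (simp add: power2_eq_square)
    also have "\<dots> \<le> T\<^sup>2 * (y / 10)" using T2 y by (intro mult_right_mono) (auto simp: n_def)
    finally show ?thesis using Tpos by (simp add: mult.commute[of "T\<^sup>2"])
  qed
  \<comment> \<open>The same rate on the scale of \<open>?S\<close>; it is small enough for
    \<open>1 / (1 - 2 * l) \<le> 2\<close>.\<close>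
  define l where "l = 4 * c * q"
  have l: "0 < l" "l \<le> 1 / 25" using c q0 qc1 by (auto simp: l_def mult.commute)
  \<comment> \<open>Of the threshold \<open>T\<close>, the truncated sum keeps what is left after
    \<open>2 * c\<close> for the shift of the means and \<open>c * (2 + y)\<close> for the sum of
    the excesses.\<close>
  define s0 where "s0 = (T - c * (4 + y)) / (4 * c)"
  have tail_S: "measure Q {x \<in> space Q. s0 \<le> ?S x} \<le> exp (- y)"
  proof -
    have iexp: "integrable Q (\<lambda>x. exp (l * ?S x))"
    proof (rule QQ.integrable_range[where a = 0 and b = "exp (l * real (card I))"])
      show "(\<lambda>x. exp (l * ?S x)) \<in> borel_measurable Q" using Sm by measurable
      have "\<bar>?S x\<bar> \<le> real (card I)" for x by (intro max_sum_bound G gr I)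
      then show "exp (l * ?S x) \<in> {0..exp (l * real (card I))}" for x
        using l by (auto simp: abs_le_iff)
    qed
    have mgf: "(\<integral>x. exp (l * ?S x) \<partial>Q)
      \<le> exp (l * ((\<integral>x. ?S x \<partial>Q) + real (card I) * (v / (16 * c\<^sup>2)) * l) / (1 - 2 * l))"
      unfolding Q_def using l by (intro mgf_max_sum_le I G gm gr g0 gv) auto
    define K where "K = (T / 4 + 4 * c) / (4 * c) + n * (v / (16 * c\<^sup>2)) * l"
    have K0: "0 \<le> K" unfolding K_def using Tpos c n v0 l by simp
    have "(\<integral>x. ?S x \<partial>Q) \<le> (T / 4 + 4 * c) / (4 * c)"
      using ES c by (simp add: pos_le_divide_eq mult.commute)
    then have "l * ((\<integral>x. ?S x \<partial>Q) + real (card I) * (v / (16 * c\<^sup>2)) * l) \<le> l * K"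
      unfolding K_def n_def using l by (intro mult_left_mono add_right_mono) auto
    then have "l * ((\<integral>x. ?S x \<partial>Q) + real (card I) * (v / (16 * c\<^sup>2)) * l) / (1 - 2 * l) \<le> l * K / (1 - 2 * l)"
      using l by (intro divide_right_mono) auto
    also have "\<dots> \<le> l * K / (1 / 2)"
      using l K0 by (intro divide_left_mono mult_nonneg_nonneg mult_pos_pos) auto
    also have "\<dots> = 2 * q * (T / 4 + 4 * c) + 2 * (n * v * q\<^sup>2)"
      unfolding K_def l_def using c by (simp add: field_simps power2_eq_square)
    finally have expo: "l * ((\<integral>x. ?S x \<partial>Q) + real (card I) * (v / (16 * c\<^sup>2)) * l) / (1 - 2 * l)
        \<le> 2 * q * (T / 4 + 4 * c) + 2 * (n * v * q\<^sup>2)" .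
    have ls0: "l * s0 = q * T - q * (c * (4 + y))"
      unfolding l_def s0_def using c by (simp add: field_simps)
    have "{x \<in> space Q. s0 \<le> ?S x} = {x \<in> space Q. exp (l * s0) \<le> exp (l * ?S x)}"
      using l by auto
    also have "measure Q \<dots> \<le> (\<integral>x. exp (l * ?S x) \<partial>Q) / exp (l * s0)"
      by (rule integral_Markov_inequality_measure[OF iexp, of "{}"]) auto
    also have "\<dots> \<le> exp (2 * q * (T / 4 + 4 * c) + 2 * (n * v * q\<^sup>2)) / exp (l * s0)"
      using mgf expo by (intro divide_right_mono) (auto intro: order_trans)
    also have "\<dots> = exp (2 * q * (T / 4 + 4 * c) + 2 * (n * v * q\<^sup>2) - l * s0)"
      by (rule exp_diff[symmetric])
    also have "\<dots> \<le> exp (- y)"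
    proof -
      have "2 * q * (T / 4 + 4 * c) + 2 * (n * v * q\<^sup>2) - l * s0
        = - (1 / 2) * (q * T) + 12 * (q * c) + q * (c * y) + 2 * (n * v * q\<^sup>2)"
        unfolding ls0 by (simp add: algebra_simps)
      also have "\<dots> \<le> - y" using qT qc qcy nvq y by linarith
      finally show ?thesis by simp
    qed
    finally show ?thesis .
  qed
  have tail_Y: "measure Q {x \<in> space Q. c * (2 + y) \<le> (\<Sum>i\<in>I. Y (x i))} \<le> exp (- y)"
    unfolding Q_def
    using exp_truncated_envelope[OF I Em c E0 W[unfolded Q_def] W2[unfolded Q_def], folded Y_def]
    by (intro sum_exp_tail I Ym c)
  have ms1: "{x \<in> space Q. c * (2 + y) \<le> (\<Sum>i\<in>I. Y (x i))} \<in> sets Q"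
    using iYQ by measurable
  have ms2: "{x \<in> space Q. s0 \<le> ?S x} \<in> sets Q"
    using Sm by measurable
  have "{x \<in> space Q. T < dev x}
    \<subseteq> {x \<in> space Q. c * (2 + y) \<le> (\<Sum>i\<in>I. Y (x i))} \<union> {x \<in> space Q. s0 \<le> ?S x}"
  proof safe
    fix x assume x: "x \<in> space Q" "T < dev x" "\<not> s0 \<le> ?S x"
    then have "4 * c * ?S x < T - c * (4 + y)"
      using c by (simp add: s0_def not_le pos_less_divide_eq mult.commute)
    then show "c * (2 + y) \<le> (\<Sum>i\<in>I. Y (x i))"
      using up[of x] x by (simp add: distrib_left)
  qed
  then have "measure Q {x \<in> space Q. T < dev x}
    \<le> measure Q ({x \<in> space Q. c * (2 + y) \<le> (\<Sum>i\<in>I. Y (x i))} \<union> {x \<in> space Q. s0 \<le> ?S x})"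
    using ms1 ms2 by (intro QQ.finite_measure_mono) auto
  also have "\<dots> \<le> measure Q {x \<in> space Q. c * (2 + y) \<le> (\<Sum>i\<in>I. Y (x i))} + measure Q {x \<in> space Q. s0 \<le> ?S x}"
    by (rule measure_Un_le[OF ms1 ms2])
  finally show ?thesis using tail_S tail_Y by linarith
qed

end

section \<open>Deviations for i.i.d. samples\<close>

lemma exp_ennreal_mono: "u \<le> w \<Longrightarrow> exp_ennreal u \<le> exp_ennreal w"
  by (auto simp: exp_ennreal_def top_unique less_top intro!: ennreal_leI enn2real_mono)

lemma exp_ennreal_ennreal: "0 \<le> r \<Longrightarrow> exp_ennreal (ennreal r) = ennreal (exp r)"
  by (simp add: exp_ennreal_def)

lemma le_exp_ennreal: "u \<le> exp_ennreal u"
proof (cases u)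
  case (real r)
  then show ?thesis
    using order_trans[OF _ exp_ge_add_one_self[of r], of r] by (auto simp: exp_ennreal_ennreal intro!: ennreal_leI)
qed (simp add: exp_ennreal_def)

text \<open>The infimum need not be attained (for \<open>U = 0\<close> it is 0, which is not
  admissible), so an exponential moment is available only at levels strictly above the norm.\<close>

lemma psi1_norm_lessD:
  assumes "psi1_norm M U < ereal c"
  shows "(\<integral>\<^sup>+\<omega>. exp_ennreal (U \<omega> / ennreal c) \<partial>M) \<le> 2"
proof -
  obtain c' where c': "0 < c'" "(\<integral>\<^sup>+\<omega>. exp_ennreal (U \<omega> / ennreal c') \<partial>M) \<le> 2" "c' < c"
    using assms unfolding psi1_norm_def by (auto simp: INF_less_iff)
  have "U \<omega> / ennreal c \<le> U \<omega> / ennreal c'" for \<omega>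
  proof -
    have "inverse (ennreal c) \<le> inverse (ennreal c')"
      using c' by (simp add: inverse_ennreal le_imp_inverse_le ennreal_leI)
    then show ?thesis unfolding divide_ennreal_def by (rule mult_left_mono) simp
  qed
  then have "(\<integral>\<^sup>+\<omega>. exp_ennreal (U \<omega> / ennreal c) \<partial>M) \<le> (\<integral>\<^sup>+\<omega>. exp_ennreal (U \<omega> / ennreal c') \<partial>M)"
    by (intro nn_integral_mono exp_ennreal_mono)
  with c'(2) show ?thesis by (rule order_trans[rotated])
qed

lemma psi1_norm_nonneg: "0 \<le> psi1_norm M U"
  unfolding psi1_norm_def by (intro INF_greatest) auto

lemma psi1_norm_mono:
  assumes "\<And>\<omega>. U \<omega> \<le> V \<omega>"
  shows "psi1_norm M U \<le> psi1_norm M V"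
  unfolding psi1_norm_def
proof (rule INF_superset_mono)
  have "(\<integral>\<^sup>+\<omega>. exp_ennreal (U \<omega> / ennreal c) \<partial>M) \<le> (\<integral>\<^sup>+\<omega>. exp_ennreal (V \<omega> / ennreal c) \<partial>M)" for c
    by (intro nn_integral_mono exp_ennreal_mono divide_right_mono_ennreal assms)
  then show "{c. 0 < c \<and> (\<integral>\<^sup>+\<omega>. exp_ennreal (V \<omega> / ennreal c) \<partial>M) \<le> 2}
    \<subseteq> {c. 0 < c \<and> (\<integral>\<^sup>+\<omega>. exp_ennreal (U \<omega> / ennreal c) \<partial>M) \<le> 2}"
    by (auto intro: order_trans)
qed auto

lemma Max_mono_fun:
  fixes f g :: "'i \<Rightarrow> 'b::linorder"
  assumes "finite I" "I \<noteq> {}" "\<And>i. i \<in> I \<Longrightarrow> f i \<le> g i"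
  shows "Max (f ` I) \<le> Max (g ` I)"
  using assms by (subst Max_le_iff) (auto intro: order_trans[OF assms(3) Max_ge])

section \<open>From the product space to the sample and to separable classes\<close>

locale iid_sample = M: prob_space M + P: prob_space P
  for M :: "'w measure" and P :: "'z measure" +
  fixes Z :: "nat \<Rightarrow> 'w \<Rightarrow> 'z" and n :: nat
  assumes n: "1 \<le> n"
    and indep: "M.indep_vars (\<lambda>_. P) Z {1..n}"
    and distr_Z: "\<And>i. i \<in> {1..n} \<Longrightarrow> distr M P (Z i) = P"
begin

abbreviation "Q \<equiv> PiM {1..n} (\<lambda>_. P)"

lemma I_props: "finite {1..n}" "{1..n} \<noteq> {}" "card {1..n} = n"
  using n by auto

lemma measurable_Z [measurable]: "i \<in> {1..n} \<Longrightarrow> Z i \<in> measurable M P"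
  using indep by (auto simp: M.indep_vars_def)

lemma Z_space: "i \<in> {1..n} \<Longrightarrow> \<omega> \<in> space M \<Longrightarrow> Z i \<omega> \<in> space P"
  by (rule measurable_space[OF measurable_Z])

lemma sample_apply [simp]: "i \<in> {1..n} \<Longrightarrow> sample Z n \<omega> i = Z i \<omega>"
  by (simp add: sample_def)

lemma measurable_sample: "sample Z n \<in> measurable M Q"
  unfolding sample_def[abs_def] by (intro measurable_restrict measurable_Z)

lemma distr_sample: "distr M Q (sample Z n) = Q"
proof -
  have "distr M Q (sample Z n) = (PiM {1..n} (\<lambda>i. distr M P (Z i)))"
    using M.indep_vars_iff_distr_eq_PiM'[where I = "{1..n}" and M' = "\<lambda>_. P" and X = Z] I_props indep measurable_Z
    unfolding sample_def[abs_def] by simp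
  also have "\<dots> = Q" using distr_Z by (intro PiM_cong) auto
  finally show ?thesis .
qed

lemma nn_integral_Z:
  assumes "i \<in> {1..n}" "f \<in> borel_measurable P"
  shows "(\<integral>\<^sup>+\<omega>. f (Z i \<omega>) \<partial>M) = (\<integral>\<^sup>+z. f z \<partial>P)"
  using nn_integral_distr[OF measurable_Z[OF assms(1)], of f] assms by (simp add: distr_Z)

lemma AE_Z:
  assumes "i \<in> {1..n}" "AE z in P. p z"
  shows "AE \<omega> in M. p (Z i \<omega>)"
proof -
  have "AE z in distr M P (Z i). p z" unfolding distr_Z[OF assms(1)] by (rule assms(2))
  then show ?thesis using AE_distrD[OF measurable_Z[OF assms(1)]] by blast
qed

lemma nn_integral_sample:
  assumes "f \<in> borel_measurable Q"
  shows "(\<integral>\<^sup>+x. f x \<partial>Q) = (\<integral>\<^sup>+\<omega>. f (sample Z n \<omega>) \<partial>M)"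
  by (subst distr_sample[symmetric]) (rule nn_integral_distr[OF measurable_sample], use assms in simp)

lemma emp_mean_measurable [measurable]:
  assumes "g \<in> borel_measurable P"
  shows "(\<lambda>\<omega>. emp_mean n (sample Z n \<omega>) g) \<in> borel_measurable M"
proof -
  have "(\<lambda>\<omega>. (\<Sum>i=1..n. g (Z i \<omega>)) / real n) \<in> borel_measurable M"
    using assms measurable_Z by (intro borel_measurable_divide borel_measurable_sum measurable_compose[OF _ assms]) auto
  then show ?thesis by (simp add: emp_mean_def)
qed

lemma envelope_exp_moment:
  assumes "0 < c" "b_class M Z n G < ereal c"
  shows "(\<integral>\<^sup>+\<omega>. exp_ennreal ((MAX i\<in>{1..n}. SUP g\<in>G. ennreal \<bar>g (Z i \<omega>)\<bar>) / ennreal c) \<partial>M) \<le> 2"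
  using assms psi1_norm_lessD unfolding b_class_def by blast

text \<open>One coordinate lies below the maximum, and \<open>u \<le> exp u\<close>. The result
  provides the dominating function when means are passed to a pointwise limit.\<close>

lemma envelope_integrable:
  assumes c: "0 < c" "b_class M Z n G < ereal c"
    and G: "countable G" "G \<subseteq> borel_measurable P"
  shows "(\<integral>\<^sup>+z. (SUP g\<in>G. ennreal \<bar>g z\<bar>) \<partial>P) < \<infinity>"
proof -
  let ?E = "\<lambda>z. SUP g\<in>G. ennreal \<bar>g z\<bar>"
  let ?U = "\<lambda>\<omega>. MAX i\<in>{1..n}. ?E (Z i \<omega>)"
  have m: "?E \<in> borel_measurable P"
    using G by (intro borel_measurable_SUP) auto
  have eq: "(\<integral>\<^sup>+z. ?E z \<partial>P) = (\<integral>\<^sup>+\<omega>. ?E (Z 1 \<omega>) \<partial>M)"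
    using n by (intro nn_integral_Z[symmetric] m) auto
  have m1: "(\<lambda>\<omega>. ?E (Z 1 \<omega>)) \<in> borel_measurable M"
    using n by (intro measurable_compose[OF measurable_Z m]) auto
  have "(\<integral>\<^sup>+\<omega>. ?E (Z 1 \<omega>) \<partial>M) / ennreal c = (\<integral>\<^sup>+\<omega>. ?E (Z 1 \<omega>) / ennreal c \<partial>M)"
    by (rule nn_integral_divide[OF m1, symmetric])
  also have "\<dots> \<le> (\<integral>\<^sup>+\<omega>. exp_ennreal (?U \<omega> / ennreal c) \<partial>M)"
  proof (rule nn_integral_mono)
    fix \<omega>
    have "?E (Z 1 \<omega>) \<le> ?U \<omega>" using n by (intro Max_ge) auto
    then have "?E (Z 1 \<omega>) / ennreal c \<le> ?U \<omega> / ennreal c" by (rule divide_right_mono_ennreal)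
    also have "\<dots> \<le> exp_ennreal (?U \<omega> / ennreal c)" by (rule le_exp_ennreal)
    finally show "?E (Z 1 \<omega>) / ennreal c \<le> exp_ennreal (?U \<omega> / ennreal c)" .
  qed
  also have "\<dots> \<le> 2" by (rule envelope_exp_moment[OF c])
  finally show ?thesis
    unfolding eq using c by (cases "(\<integral>\<^sup>+\<omega>. ?E (Z 1 \<omega>) \<partial>M) = \<top>") (auto simp: less_top ennreal_top_divide top_unique)
qed

text \<open>The envelope of a finite subclass is real and measurable and lies below the possibly
  nonmeasurable supremum over \<open>G\<close>. Monotonicity of the lower integral thus turns the
  psi_1 bound for \<open>G\<close> into a genuine exponential moment.\<close>

lemma envelope_finite_class:
  assumes c: "0 < c" "b_class M Z n G < ereal c"
    and H: "finite H" "H \<noteq> {}" "H \<subseteq> G" "H \<subseteq> borel_measurable P"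
  defines "W \<equiv> \<lambda>x. exp (Max ((\<lambda>i. Max ((\<lambda>h. \<bar>h (x i)\<bar>) ` H)) ` {1..n}) / c)"
  shows "integrable Q W" "(\<integral>x. W x \<partial>Q) \<le> 2"
proof -
  let ?E = "\<lambda>z. Max ((\<lambda>h. \<bar>h z\<bar>) ` H)"
  have Em: "?E \<in> borel_measurable P"
    using H by (intro borel_measurable_Max borel_measurable_abs) auto
  have Wm: "W \<in> borel_measurable Q"
    unfolding W_def
    by (intro measurable_compose[OF _ borel_measurable_exp] borel_measurable_divide borel_measurable_Max
        borel_measurable_const measurable_PiM_component_rev Em) auto
  have "(\<integral>\<^sup>+x. ennreal (W x) \<partial>Q) = (\<integral>\<^sup>+\<omega>. ennreal (W (sample Z n \<omega>)) \<partial>M)"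
    using Wm by (intro nn_integral_sample) auto
  also have "\<dots> \<le> (\<integral>\<^sup>+\<omega>. exp_ennreal ((MAX i\<in>{1..n}. SUP g\<in>G. ennreal \<bar>g (Z i \<omega>)\<bar>) / ennreal c) \<partial>M)"
  proof (rule nn_integral_mono)
    fix \<omega>
    define m where "m = Max ((\<lambda>i. ?E (Z i \<omega>)) ` {1..n})"
    have "m \<in> (\<lambda>i. ?E (Z i \<omega>)) ` {1..n}"
      unfolding m_def using I_props by (intro Max_in) auto
    then obtain i where i: "i \<in> {1..n}" "m = ?E (Z i \<omega>)" by auto
    have "?E (Z i \<omega>) \<in> (\<lambda>h. \<bar>h (Z i \<omega>)\<bar>) ` H" using H by (intro Max_in) auto
    then obtain h where h: "h \<in> H" "m = \<bar>h (Z i \<omega>)\<bar>" using i by auto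
    have "ennreal m \<le> (SUP g\<in>G. ennreal \<bar>g (Z i \<omega>)\<bar>)"
      unfolding h(2) using h H by (intro SUP_upper) auto
    also have "\<dots> \<le> (MAX i\<in>{1..n}. SUP g\<in>G. ennreal \<bar>g (Z i \<omega>)\<bar>)"
      using i by (intro Max_ge) auto
    finally have le: "ennreal m / ennreal c \<le> (MAX i\<in>{1..n}. SUP g\<in>G. ennreal \<bar>g (Z i \<omega>)\<bar>) / ennreal c"
      by (rule divide_right_mono_ennreal)
    have "W (sample Z n \<omega>) = exp (m / c)"
      unfolding W_def m_def by simp
    then have "ennreal (W (sample Z n \<omega>)) = exp_ennreal (ennreal m / ennreal c)"
      using c h by (simp add: divide_ennreal exp_ennreal_ennreal)
    also have "\<dots> \<le> exp_ennreal ((MAX i\<in>{1..n}. SUP g\<in>G. ennreal \<bar>g (Z i \<omega>)\<bar>) / ennreal c)"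
      by (rule exp_ennreal_mono[OF le])
    finally show "ennreal (W (sample Z n \<omega>))
      \<le> exp_ennreal ((MAX i\<in>{1..n}. SUP g\<in>G. ennreal \<bar>g (Z i \<omega>)\<bar>) / ennreal c)" .
  qed
  also have "\<dots> \<le> 2" by (rule envelope_exp_moment[OF c])
  finally have le2: "(\<integral>\<^sup>+x. ennreal (W x) \<partial>Q) \<le> ennreal 2" by simp
  have "(\<integral>\<^sup>+x. ennreal (norm (W x)) \<partial>Q) < \<infinity>"
    using le2 by (simp add: W_def le_less_trans)
  then show "integrable Q W" using Wm by (intro integrableI_bounded)
  show "(\<integral>x. W x \<partial>Q) \<le> 2" using le2 by (intro integral_real_bounded) auto
qed

lemma integrable_member:
  assumes c: "0 < c" "b_class M Z n G < ereal c" and h: "h \<in> G" "h \<in> borel_measurable P"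
  shows "integrable P h" "integrable P (\<lambda>z. (h z)\<^sup>2)"
proof -
  have "integrable P (\<lambda>z. exp (\<bar>h z\<bar> / c))"
    using envelope_finite_class(1)[OF c, of "{h}"] h I_props c
    by (intro P.exp_component_integrable[of "{1..n}"]) auto
  then show "integrable P h" "integrable P (\<lambda>z. (h z)\<^sup>2)"
    using P.integrable_if_exp_moment[OF h(2) c(1)] by auto
qed

text \<open>The hypotheses concern all of \<open>G\<close> and the bound is blind to the size of
  \<open>H\<close>; it therefore survives an increasing union of finite subclasses.\<close>

lemma finite_class_bad_event:
  assumes c: "0 < c" "b_class M Z n G < ereal c"
    and H: "finite H" "H \<noteq> {}" "H \<subseteq> G" "H \<subseteq> borel_measurable P"
    and v: "\<And>g. g \<in> G \<Longrightarrow> mean P (\<lambda>z. (g z)\<^sup>2) \<le> v"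
    and D: "(\<integral>\<^sup>+\<omega>. sup_dev P n (sample Z n \<omega>) G \<partial>M) \<le> ennreal (T / (4 * real n))"
    and y: "1 \<le> y" and T1: "1000 * c * y \<le> T" and T2: "1000 * real n * v * y \<le> T\<^sup>2"
  shows "measure M {\<omega> \<in> space M. \<exists>g\<in>H. T / real n < \<bar>mean P g - emp_mean n (sample Z n \<omega>) g\<bar>} \<le> 2 * exp (- y)"
proof -
  define dev where "dev x = Max ((\<lambda>h. \<bar>(\<Sum>i\<in>{1..n}. h (x i)) - real (card {1..n}) * P.expectation h\<bar>) ` H)" for x
  have n0: "0 < real n" using n by simp
  have hm: "(\<lambda>x. h (x i)) \<in> borel_measurable Q" if "h \<in> H" "i \<in> {1..n}" for h i
    using that H by (intro measurable_PiM_component_rev) auto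
  have dm: "dev \<in> borel_measurable Q"
    unfolding dev_def[abs_def]
  proof (intro borel_measurable_Max H)
    fix h assume "h \<in> H"
    then have "(\<lambda>x. \<Sum>i\<in>{1..n}. h (x i)) \<in> borel_measurable Q" by (intro borel_measurable_sum hm)
    then show "(\<lambda>x. \<bar>(\<Sum>i\<in>{1..n}. h (x i)) - real (card {1..n}) * P.expectation h\<bar>) \<in> borel_measurable Q"
      by measurable
  qed
  have dev_eq: "\<bar>(\<Sum>i\<in>{1..n}. h (x i)) - real (card {1..n}) * P.expectation h\<bar> = real n * \<bar>mean P h - emp_mean n x h\<bar>" for h x
  proof -
    have "real n * \<bar>mean P h - emp_mean n x h\<bar> = \<bar>real n * (mean P h - emp_mean n x h)\<bar>" by (simp add: abs_mult)
    also have "real n * (mean P h - emp_mean n x h) = real n * P.expectation h - (\<Sum>i\<in>{1..n}. h (x i))"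
      using n0 by (simp add: mean_def emp_mean_def right_diff_distrib)
    finally show ?thesis using I_props by (simp add: abs_minus_commute)
  qed
  have dev0: "0 \<le> dev x" for x
  proof -
    have "dev x \<in> (\<lambda>h. \<bar>(\<Sum>i\<in>{1..n}. h (x i)) - real (card {1..n}) * P.expectation h\<bar>) ` H"
      unfolding dev_def using H by (intro Max_in) auto
    then show ?thesis by auto
  qed
  have "0 \<le> T" using T1 c y by (meson mult_nonneg_nonneg less_imp_le order_trans zero_le_numeral zero_le_one)
  have "(\<integral>\<^sup>+x. ennreal (dev x) \<partial>Q) = (\<integral>\<^sup>+\<omega>. ennreal (dev (sample Z n \<omega>)) \<partial>M)"
    using dm by (intro nn_integral_sample) auto
  also have "\<dots> = (\<integral>\<^sup>+\<omega>. ennreal (real n) * ennreal (dev (sample Z n \<omega>) / real n) \<partial>M)"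
    using n0 dev0 by (simp add: ennreal_mult[symmetric])
  also have "\<dots> = ennreal (real n) * (\<integral>\<^sup>+\<omega>. ennreal (dev (sample Z n \<omega>) / real n) \<partial>M)"
    using measurable_compose[OF measurable_sample dm] by (intro nn_integral_cmult) auto
  also have "\<dots> \<le> ennreal (real n) * (\<integral>\<^sup>+\<omega>. sup_dev P n (sample Z n \<omega>) G \<partial>M)"
  proof (intro mult_left_mono nn_integral_mono)
    fix \<omega>
    have "dev (sample Z n \<omega>) \<in> (\<lambda>h. \<bar>(\<Sum>i\<in>{1..n}. h (sample Z n \<omega> i)) - real (card {1..n}) * P.expectation h\<bar>) ` H"
      unfolding dev_def using H by (intro Max_in) auto
    then obtain h where h: "h \<in> H" "dev (sample Z n \<omega>) = real n * \<bar>mean P h - emp_mean n (sample Z n \<omega>) h\<bar>"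
      unfolding dev_eq by auto
    show "ennreal (dev (sample Z n \<omega>) / real n) \<le> sup_dev P n (sample Z n \<omega>) G"
      unfolding h sup_dev_def using h H n0 by (intro SUP_upper2[of h]) auto
  qed simp
  also have "\<dots> \<le> ennreal (real n) * ennreal (T / (4 * real n))" by (intro mult_left_mono D) simp
  also have "\<dots> = ennreal (T / 4)" using n0 \<open>0 \<le> T\<close> by (simp add: ennreal_mult[symmetric])
  finally have "(\<integral>x. dev x \<partial>Q) \<le> T / 4"
    using \<open>0 \<le> T\<close> by (intro integral_real_bounded) auto
  then have "measure Q {x \<in> space Q. T < dev x} \<le> 2 * exp (- y)"
    unfolding dev_def
    using envelope_finite_class[OF c H] v T2 H I_props y T1
    by (intro P.finite_class_deviation[where c = c and v = v] c)
      (auto simp: mean_def subset_eq)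
  moreover have "measure M {\<omega> \<in> space M. \<exists>g\<in>H. T / real n < \<bar>mean P g - emp_mean n (sample Z n \<omega>) g\<bar>}
      = measure Q {x \<in> space Q. T < dev x}"
  proof -
    have "measure Q {x \<in> space Q. T < dev x} = measure (distr M Q (sample Z n)) {x \<in> space Q. T < dev x}"
      by (simp only: distr_sample)
    also have "\<dots> = measure M (sample Z n -` {x \<in> space Q. T < dev x} \<inter> space M)"
      using dm by (intro measure_distr measurable_sample) measurable
    also have "sample Z n -` {x \<in> space Q. T < dev x} \<inter> space M
      = {\<omega> \<in> space M. \<exists>g\<in>H. T / real n < \<bar>mean P g - emp_mean n (sample Z n \<omega>) g\<bar>}"
    proof -
      have "T < dev x \<longleftrightarrow> (\<exists>g\<in>H. T / real n < \<bar>mean P g - emp_mean n x g\<bar>)" for x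
        unfolding dev_def dev_eq using H n0
        by (subst Max_gr_iff) (auto simp: pos_divide_less_eq mult.commute)
      then show ?thesis using measurable_space[OF measurable_sample] by auto
    qed
    finally show ?thesis by simp
  qed
  ultimately show ?thesis by simp
qed

text \<open>Finite initial segments of the countable dense subclass have increasing bad events of
  uniformly bounded probability, so their union obeys the same bound. Off that union the inequality
  extends to pointwise limits: empirical means converge coordinatewise, means by dominated
  convergence.\<close>

lemma separable_class_deviation:
  assumes c: "0 < c" "b_class M Z n G < ereal c"
    and G: "G \<subseteq> borel_measurable P" "pointwise_separable P G"
    and v: "\<And>g. g \<in> G \<Longrightarrow> mean P (\<lambda>z. (g z)\<^sup>2) \<le> v"
    and D: "(\<integral>\<^sup>+\<omega>. sup_dev P n (sample Z n \<omega>) G \<partial>M) \<le> ennreal (T / (4 * real n))"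
    and y: "1 \<le> y" and T1: "1000 * c * y \<le> T" and T2: "1000 * real n * v * y \<le> T\<^sup>2"
  shows "\<exists>N\<in>sets M. measure M N \<le> 2 * exp (- y) \<and>
    (\<forall>\<omega>\<in>space M - N. \<forall>g\<in>G. \<bar>mean P g - emp_mean n (sample Z n \<omega>) g\<bar> \<le> T / real n)"
proof -
  obtain G0 where G0: "G0 \<subseteq> G" "countable G0"
    and lim: "\<And>g. g \<in> G \<Longrightarrow> \<exists>s :: nat \<Rightarrow> 'z \<Rightarrow> real. range s \<subseteq> G0 \<and> (\<forall>z\<in>space P. (\<lambda>k. s k z) \<longlonglongrightarrow> g z)"
    using G(2) unfolding pointwise_separable_def by auto
  show ?thesis
  \<comment> \<open>An enumeration by \<open>from_nat_into\<close> needs a nonempty set. If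
    \<open>G0\<close> is empty it contains no sequence, so \<open>G\<close> is empty too.\<close>
  proof (cases "G0 = {}")
    case True
    then have "G = {}" using lim by fastforce
    then show ?thesis by (intro bexI[of _ "{}"]) auto
  next
    case False
    define e where "e = from_nat_into G0"
    have e: "range e = G0" unfolding e_def using False G0 by (intro range_from_nat_into)
    define bad where "bad k = {\<omega> \<in> space M. \<exists>g\<in>e ` {..k}. T / real n < \<bar>mean P g - emp_mean n (sample Z n \<omega>) g\<bar>}" for k :: nat
    have em: "e k \<in> borel_measurable P" for k using e G0 G by auto
    have bm: "bad k \<in> sets M" for k
    proof -
      have "bad k = (\<Union>j\<in>{..k}. {\<omega> \<in> space M. T / real n < \<bar>mean P (e j) - emp_mean n (sample Z n \<omega>) (e j)\<bar>})"
        by (auto simp: bad_def)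
      also have "\<dots> \<in> sets M" using emp_mean_measurable[OF em] by (intro sets.finite_UN) (auto, measurable)
      finally show ?thesis .
    qed
    have "e ` {..k} \<subseteq> G" "e ` {..k} \<subseteq> borel_measurable P" for k using e G0 G by auto
    then have bp: "measure M (bad k) \<le> 2 * exp (- y)" for k
      unfolding bad_def by (intro finite_class_bad_event[OF c _ _ _ _ v D y T1 T2]) auto
    have inc: "incseq bad" unfolding bad_def incseq_def by (force intro: order_trans)
    have "(\<lambda>k. measure M (bad k)) \<longlonglongrightarrow> measure M (\<Union>k. bad k)"
      using bm inc by (intro M.finite_Lim_measure_incseq) auto
    then have Np: "measure M (\<Union>k. bad k) \<le> 2 * exp (- y)"
      using bp by (intro LIMSEQ_le_const2) auto
    have "\<bar>mean P g - emp_mean n (sample Z n \<omega>) g\<bar> \<le> T / real n"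
      if \<omega>: "\<omega> \<in> space M - (\<Union>k. bad k)" and g: "g \<in> G" for \<omega> g
    proof -
      obtain s where s: "range s \<subseteq> G0" "\<And>z. z \<in> space P \<Longrightarrow> (\<lambda>k. s k z) \<longlonglongrightarrow> g z"
        using lim[OF g] by auto
      have le: "\<bar>mean P (s k) - emp_mean n (sample Z n \<omega>) (s k)\<bar> \<le> T / real n" for k
      proof -
        obtain j where "s k = e j" using s(1) e by (metis imageE range_subsetD)
        then show ?thesis using \<omega> by (force simp: bad_def not_less)
      qed
      have "(\<lambda>k. emp_mean n (sample Z n \<omega>) (s k)) \<longlonglongrightarrow> emp_mean n (sample Z n \<omega>) g"
        unfolding emp_mean_def using \<omega> n
        by (intro tendsto_divide tendsto_sum tendsto_const) (auto intro!: s(2) Z_space)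
      moreover have "(\<lambda>k. mean P (s k)) \<longlonglongrightarrow> mean P g"
      proof -
        \<comment> \<open>\<open>enn2real\<close> sends an infinite supremum to 0, so
          \<open>w\<close> dominates only almost everywhere, namely where the integrable supremum is
          finite.\<close>
        define w where "w z = enn2real (SUP h\<in>G0. ennreal \<bar>h z\<bar>)" for z
        have Sm: "(\<lambda>z. SUP h\<in>G0. ennreal \<bar>h z\<bar>) \<in> borel_measurable P"
          using G0 G by (intro borel_measurable_SUP) auto
        have "b_class M Z n G0 < ereal c"
        proof (rule le_less_trans[OF _ c(2)])
          show "b_class M Z n G0 \<le> b_class M Z n G"
            unfolding b_class_def using G0 I_props
            by (intro psi1_norm_mono Max_mono_fun SUP_subset_mono) auto
        qed
        then have fin: "(\<integral>\<^sup>+z. (SUP h\<in>G0. ennreal \<bar>h z\<bar>) \<partial>P) < \<infinity>"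
          using G0 G c by (intro envelope_integrable) auto
        then have AE: "AE z in P. (SUP h\<in>G0. ennreal \<bar>h z\<bar>) \<noteq> \<infinity>"
          using Sm by (intro nn_integral_PInf_AE) auto
        have iw: "integrable P w"
        proof (rule integrableI_bounded)
          show "w \<in> borel_measurable P" unfolding w_def[abs_def] using Sm by measurable
          have "(\<integral>\<^sup>+z. ennreal (norm (w z)) \<partial>P) \<le> (\<integral>\<^sup>+z. (SUP h\<in>G0. ennreal \<bar>h z\<bar>) \<partial>P)"
            by (intro nn_integral_mono) (auto simp: w_def ennreal_enn2real_if)
          then show "(\<integral>\<^sup>+z. ennreal (norm (w z)) \<partial>P) < \<infinity>" using fin by (rule le_less_trans)
        qed
        show ?thesis
          unfolding mean_def
        proof (rule integral_dominated_convergence[OF _ _ iw])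
          show "g \<in> borel_measurable P" using g G by auto
          show "s k \<in> borel_measurable P" for k using s(1) G0 G by auto
          show "AE z in P. (\<lambda>k. s k z) \<longlonglongrightarrow> g z" using s(2) by (intro AE_I2)
          show "AE z in P. norm (s k z) \<le> w z" for k
            using AE
          proof eventually_elim
            fix z assume f: "(SUP h\<in>G0. ennreal \<bar>h z\<bar>) \<noteq> \<infinity>"
            have "ennreal \<bar>s k z\<bar> \<le> (SUP h\<in>G0. ennreal \<bar>h z\<bar>)" using s(1) by (intro SUP_upper) auto
            moreover have "(SUP h\<in>G0. ennreal \<bar>h z\<bar>) < \<top>"
              using f by (metis infinity_ennreal_def top.not_eq_extremum)
            ultimately have "enn2real (ennreal \<bar>s k z\<bar>) \<le> w z"
              unfolding w_def by (rule enn2real_mono)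
            then show "norm (s k z) \<le> w z" by simp
          qed
        qed
      qed
      ultimately have "(\<lambda>k. \<bar>mean P (s k) - emp_mean n (sample Z n \<omega>) (s k)\<bar>)
        \<longlonglongrightarrow> \<bar>mean P g - emp_mean n (sample Z n \<omega>) g\<bar>"
        by (intro tendsto_rabs tendsto_diff)
      then show ?thesis using le by (intro LIMSEQ_le_const2) auto
    qed
    then show ?thesis using bm Np by (intro bexI[of _ "\<Union>k. bad k"]) auto
  qed
qed

end

section \<open>Localized star-shaped hulls\<close>

text \<open>Centred independent coordinates are orthogonal, so only the diagonal of the double sum
  survives.\<close>

lemma (in prob_space) second_moment_sum_PiM:
  fixes u :: "'a \<Rightarrow> real" and I :: "'i set"
  assumes I: "finite I" and u: "integrable M u" "integrable M (\<lambda>z. (u z)\<^sup>2)" "expectation u = 0"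
  defines "Q \<equiv> PiM I (\<lambda>_. M)"
  shows "integrable Q (\<lambda>x. (\<Sum>i\<in>I. u (x i))\<^sup>2)"
    and "(\<integral>x. (\<Sum>i\<in>I. u (x i))\<^sup>2 \<partial>Q) = real (card I) * expectation (\<lambda>z. (u z)\<^sup>2)"
proof -
  interpret Q: product_prob_space "\<lambda>_. M" I by standard
  have one: "expectation (\<lambda>_. 1) = (1 :: real)" by (simp add: prob_space)
  have um: "u \<in> borel_measurable M" "(\<lambda>z. (u z)\<^sup>2) \<in> borel_measurable M" using u by auto
  have sq: "(\<Sum>i\<in>I. u (x i))\<^sup>2 = (\<Sum>i\<in>I. \<Sum>j\<in>I. u (x i) * u (x j))" for x
    by (simp add: power2_eq_square sum_product)
  have diag: "integrable Q (\<lambda>x. u (x i) * u (x i)) \<and> (\<integral>x. u (x i) * u (x i) \<partial>Q) = expectation (\<lambda>z. (u z)\<^sup>2)"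
    if "i \<in> I" for i
    using u(2) integrable_PiM_component[OF that um(2)] integral_PiM_component[OF that um(2)]
    by (simp add: Q_def power2_eq_square)
  have off: "integrable Q (\<lambda>x. u (x i) * u (x j)) \<and> (\<integral>x. u (x i) * u (x j) \<partial>Q) = 0"
    if ij: "i \<in> I" "j \<in> I" "i \<noteq> j" for i j
  proof -
    \<comment> \<open>Factors 1 away from \<open>i\<close> and \<open>j\<close> write
      \<open>u (x i) * u (x j)\<close> as a product over all of \<open>I\<close>, the form in which
      independence is available.\<close>
    define f where "f k z = (if k = i \<or> k = j then u z else 1)" for k :: 'i and z
    have fi: "integrable M (f k)" for k using u(1) by (cases "k = i \<or> k = j") (auto simp: f_def[abs_def])
    have split: "(\<Prod>k\<in>I. a k) = a i * (a j * (\<Prod>k\<in>I - {i} - {j}. a k))" for a :: "'i \<Rightarrow> real"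
      using ij I by (simp add: prod.remove[of I i] prod.remove[of "I - {i}" j])
    have eq: "(\<Prod>k\<in>I. f k (x k)) = u (x i) * u (x j)" for x
    proof -
      have "(\<Prod>k\<in>I - {i} - {j}. f k (x k)) = 1" by (intro prod.neutral) (auto simp: f_def)
      then show ?thesis unfolding split[of "\<lambda>k. f k (x k)"] by (simp add: f_def)
    qed
    have "f i = u" by (auto simp: f_def)
    then have "(\<Prod>k\<in>I. expectation (f k)) = 0"
      using ij I u(3) by (intro prod_zero bexI[of _ i]) auto
    then show ?thesis
      using Q.product_integrable_prod[OF I, of f] Q.product_integral_prod[OF I, of f] fi
      unfolding eq Q_def by simp
  qed
  have int: "integrable Q (\<lambda>x. u (x i) * u (x j))" if "i \<in> I" "j \<in> I" for i j
    using that diag off by (cases "i = j") auto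
  show "integrable Q (\<lambda>x. (\<Sum>i\<in>I. u (x i))\<^sup>2)"
    unfolding sq using int by (intro Bochner_Integration.integrable_sum)
  have "(\<integral>x. (\<Sum>i\<in>I. u (x i))\<^sup>2 \<partial>Q) = (\<Sum>i\<in>I. \<Sum>j\<in>I. \<integral>x. u (x i) * u (x j) \<partial>Q)"
    unfolding sq using int by (simp add: Bochner_Integration.integral_sum Bochner_Integration.integrable_sum)
  also have "\<dots> = (\<Sum>i\<in>I. \<Sum>j\<in>I. if j = i then expectation (\<lambda>z. (u z)\<^sup>2) else 0)"
    using diag off by (intro sum.cong refl) auto
  also have "\<dots> = real (card I) * expectation (\<lambda>z. (u z)\<^sup>2)" using I by simp
  finally show "(\<integral>x. (\<Sum>i\<in>I. u (x i))\<^sup>2 \<partial>Q) = real (card I) * expectation (\<lambda>z. (u z)\<^sup>2)" .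
qed

text \<open>Suprema over uncountable classes are integrated as lower integrals, to which
  \<open>nn_integral_cmult\<close> does not apply.\<close>

lemma nn_integral_cmult_le:
  assumes c: "0 < c"
  shows "(\<integral>\<^sup>+x. ennreal c * f x \<partial>M) \<le> ennreal c * (\<integral>\<^sup>+x. f x \<partial>M)"
  unfolding nn_integral_def[of M "\<lambda>x. ennreal c * f x"]
proof (rule SUP_least)
  fix g assume "g \<in> {g. simple_function M g \<and> g \<le> (\<lambda>x. ennreal c * f x)}"
  then have g: "simple_function M g" "\<And>x. g x \<le> ennreal c * f x" by (auto simp: le_fun_def)
  have gm [measurable]: "g \<in> borel_measurable M" using g(1) by (rule borel_measurable_simple_function)
  have cc: "ennreal (1 / c) * ennreal c = 1" "ennreal c * ennreal (1 / c) = 1"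
    using c by (simp_all add: ennreal_mult[symmetric])
  have "integral\<^sup>S M g = (\<integral>\<^sup>+x. g x \<partial>M)" using g(1) by (rule nn_integral_eq_simple_integral[symmetric])
  also have "\<dots> = (\<integral>\<^sup>+x. ennreal c * (ennreal (1 / c) * g x) \<partial>M)"
    by (simp add: mult.assoc[symmetric] cc)
  also have "\<dots> = ennreal c * (\<integral>\<^sup>+x. ennreal (1 / c) * g x \<partial>M)" by (intro nn_integral_cmult) simp
  also have "\<dots> \<le> ennreal c * (\<integral>\<^sup>+x. f x \<partial>M)"
  proof (intro mult_left_mono nn_integral_mono)
    fix x
    have "ennreal (1 / c) * g x \<le> ennreal (1 / c) * (ennreal c * f x)" using g(2) by (intro mult_left_mono) auto
    then show "ennreal (1 / c) * g x \<le> f x" by (simp add: mult.assoc[symmetric] cc)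
  qed simp
  finally show "integral\<^sup>S M g \<le> ennreal c * (\<integral>\<^sup>+x. f x \<partial>M)" .
qed

section \<open>Scaling in star-shaped hulls\<close>

lemma mean_scale: "mean P (\<lambda>z. a * g z) = a * mean P g"
  by (simp add: mean_def)

lemma emp_mean_scale: "emp_mean n d (\<lambda>z. a * g z) = a * emp_mean n d g"
  by (simp add: emp_mean_def sum_distrib_left)

lemma star_levelE:
  assumes "h \<in> star_level P L l"
  obtains \<theta> g where "h = (\<lambda>z. \<theta> * g z)" "0 \<le> \<theta>" "\<theta> \<le> 1" "g \<in> L" "mean P h \<le> l"
  using assms by (auto simp: star_level_def star_hull_def)

lemma star_levelI:
  "0 \<le> \<theta> \<Longrightarrow> \<theta> \<le> 1 \<Longrightarrow> g \<in> L \<Longrightarrow> \<theta> * mean P g \<le> l \<Longrightarrow> (\<lambda>z. \<theta> * g z) \<in> star_level P L l"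
  by (auto simp: star_level_def star_hull_def mean_scale)

text \<open>Shrinking a member at level \<open>\<mu>\<close> by \<open>l / \<mu>\<close> stays in
  the hull and lands at level \<open>l\<close>. The supremum of deviations divided by the level is
  thus nonincreasing, and the fixed-point condition at \<open>lam r\<close> passes to all larger
  levels.\<close>

lemma sup_dev_star_level_scale:
  assumes "0 < l" "l \<le> \<mu>"
  shows "sup_dev P n d (star_level P L \<mu>) \<le> ennreal (\<mu> / l) * sup_dev P n d (star_level P L l)"
  unfolding sup_dev_def[of P n d "star_level P L \<mu>"]
proof (rule SUP_least)
  fix h assume "h \<in> star_level P L \<mu>"
  then obtain \<theta> g where h: "h = (\<lambda>z. \<theta> * g z)" "0 \<le> \<theta>" "\<theta> \<le> 1" "g \<in> L" "mean P h \<le> \<mu>"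
    by (rule star_levelE)
  define h' where "h' = (\<lambda>z. (l / \<mu> * \<theta>) * g z)"
  have "h' \<in> star_level P L l"
    unfolding h'_def
  proof (rule star_levelI)
    show "l / \<mu> * \<theta> \<le> 1" using h assms by (intro mult_le_one) auto
    have "l / \<mu> * mean P h \<le> l / \<mu> * \<mu>" using h assms by (intro mult_left_mono) auto
    then show "l / \<mu> * \<theta> * mean P g \<le> l" using assms by (simp add: h mean_scale)
  qed (use h assms in auto)
  have "\<mu> / l * (l / \<mu> * \<theta>) = \<theta>" using assms by simp
  then have "h = (\<lambda>z. \<mu> / l * h' z)" unfolding h(1) h'_def mult.assoc[symmetric] by simp
  then have "mean P h = \<mu> / l * mean P h'" "emp_mean n d h = \<mu> / l * emp_mean n d h'"
    by (simp_all only: mean_scale emp_mean_scale)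
  then have "\<bar>mean P h - emp_mean n d h\<bar> = \<mu> / l * \<bar>mean P h' - emp_mean n d h'\<bar>"
    using assms by (simp only: right_diff_distrib[symmetric] abs_mult) simp
  also have "ennreal \<dots> = ennreal (\<mu> / l) * ennreal \<bar>mean P h' - emp_mean n d h'\<bar>"
    using assms by (intro ennreal_mult) auto
  also have "\<dots> \<le> ennreal (\<mu> / l) * sup_dev P n d (star_level P L l)"
    unfolding sup_dev_def using \<open>h' \<in> _\<close> by (intro mult_left_mono SUP_upper) auto
  finally show "ennreal \<bar>mean P h - emp_mean n d h\<bar> \<le> ennreal (\<mu> / l) * sup_dev P n d (star_level P L l)" .
qed

context iid_sample
begin

lemma b_class_mono:
  assumes "\<And>g. g \<in> G \<Longrightarrow> \<exists>h\<in>L. \<forall>z. \<bar>g z\<bar> \<le> \<bar>h z\<bar>"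
  shows "b_class M Z n G \<le> b_class M Z n L"
  unfolding b_class_def using I_props assms
  by (intro psi1_norm_mono Max_mono_fun SUP_mono) (auto intro: ennreal_leI)

lemma b_class_star_level: "b_class M Z n (star_level P L l) \<le> b_class M Z n L"
proof (rule b_class_mono)
  fix h assume "h \<in> star_level P L l"
  then obtain \<theta> g where h: "h = (\<lambda>z. \<theta> * g z)" "0 \<le> \<theta>" "\<theta> \<le> 1" "g \<in> L" by (rule star_levelE)
  then show "\<exists>g\<in>L. \<forall>z. \<bar>h z\<bar> \<le> \<bar>g z\<bar>"
    by (intro bexI[of _ g]) (auto simp: abs_mult intro!: mult_left_le_one_le)
qed

lemma b_fun_eq: "b_fun M Z n g = b_class M Z n {g}"
  by (simp add: b_fun_def b_class_def)

text \<open>At level \<open>\<mu>\<close> the uniform deviation is at most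
  \<open>T / n = \<epsilon> * \<mu>\<close>; the factor 4 in the fixed-point condition is the one
  that the tail bound demands of the mean. A function with mean above \<open>\<mu>\<close> is shrunk
  to level \<open>\<mu>\<close>, and undoing this makes its error proportional to its mean.\<close>

lemma star_level_deviation:
  assumes L: "L \<subseteq> borel_measurable P" "L \<noteq> {}"
    and sep: "pointwise_separable P (star_level P L \<mu>)"
    and nonneg: "\<And>g. g \<in> L \<Longrightarrow> 0 \<le> mean P g"
    and b: "b_class M Z n L \<le> ereal \<phi>"
    and v: "\<And>g. g \<in> L \<Longrightarrow> mean P (\<lambda>z. (g z)\<^sup>2) \<le> B * mean P g + B\<^sup>2 / real n"
    and B: "0 \<le> B" and \<epsilon>: "0 < \<epsilon>" "\<epsilon> \<le> 1" and l: "0 < l" "l \<le> \<mu>"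
    and D: "(\<integral>\<^sup>+\<omega>. sup_dev P n (sample Z n \<omega>) (star_level P L l) \<partial>M) \<le> ennreal (\<epsilon> / 4 * l)"
    and y: "1 \<le> y" and \<mu>: "2000 * ((\<phi> + B / \<epsilon>) * y / (real n * \<epsilon>)) \<le> \<mu>"
  shows "\<exists>N\<in>sets M. measure M N \<le> 2 * exp (- y) \<and>
    (\<forall>\<omega>\<in>space M - N. \<forall>g\<in>L. \<bar>mean P g - emp_mean n (sample Z n \<omega>) g\<bar> \<le> \<epsilon> * max (mean P g) \<mu>)"
proof -
  have n0: "0 < real n" using n by simp
  have \<mu>0: "0 < \<mu>" using l by simp
  have \<phi>0: "0 \<le> \<phi>"
    using order_trans[OF psi1_norm_nonneg b[unfolded b_class_def]] by simp
  define T where "T = real n * \<epsilon> * \<mu>"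
  have T0: "0 < T" using n0 \<epsilon> \<mu>0 by (simp add: T_def)
  have key: "2000 * ((\<phi> + B / \<epsilon>) * y) \<le> T"
    using \<mu> n0 \<epsilon> by (simp add: T_def field_simps)
  have "0 \<le> B / \<epsilon> * y" "0 \<le> \<phi> * y" using B \<epsilon> y \<phi>0 by auto
  then have key1: "2000 * (\<phi> * y) \<le> T" and key2: "2000 * (B / \<epsilon> * y) \<le> T"
    by (smt (verit, best) key distrib_right)+
  have By: "B * y \<le> \<epsilon> * T / 2000" using key2 \<epsilon> by (simp add: field_simps)
  have BBy: "B \<le> B * y" using mult_left_mono[OF y B] by simp
  \<comment> \<open>The largest envelope level that the tail bound tolerates at threshold
    \<open>T\<close>. The factor 2000 in the assumption on \<open>\<mu>\<close> places
    \<open>\<phi>\<close> strictly below it, as an admissible psi_1 level requires.\<close>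
  define c where "c = T / (1000 * y)"
  have c0: "0 < c" using T0 y by (simp add: c_def)
  have "\<phi> < c"
  proof -
    have "1000 * (\<phi> * y) < T" using key1 T0 by linarith
    then show ?thesis using y by (simp add: c_def field_simps)
  qed
  then have bc: "b_class M Z n (star_level P L \<mu>) < ereal c"
    using b_class_star_level[of L \<mu>] b by (metis ereal_less_ereal_Ex less_ereal.simps(1) order_le_less_trans)
  define w where "w = B * \<mu> + B\<^sup>2 / real n"
  have Gm: "star_level P L \<mu> \<subseteq> borel_measurable P"
  proof
    fix h assume "h \<in> star_level P L \<mu>"
    then obtain \<theta> g where h: "h = (\<lambda>z. \<theta> * g z)" "g \<in> L" by (rule star_levelE)
    have [measurable]: "g \<in> borel_measurable P" using h L by auto
    show "h \<in> borel_measurable P" unfolding h by measurable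
  qed
  have w: "mean P (\<lambda>z. (h z)\<^sup>2) \<le> w" if "h \<in> star_level P L \<mu>" for h
  proof -
    from that obtain \<theta> g where h: "h = (\<lambda>z. \<theta> * g z)" "0 \<le> \<theta>" "\<theta> \<le> 1" "g \<in> L" "mean P h \<le> \<mu>"
      by (rule star_levelE)
    have "mean P (\<lambda>z. (h z)\<^sup>2) = \<theta>\<^sup>2 * mean P (\<lambda>z. (g z)\<^sup>2)"
      unfolding h(1) power_mult_distrib by (rule mean_scale)
    also have "\<dots> \<le> \<theta>\<^sup>2 * (B * mean P g + B\<^sup>2 / real n)" using v[OF h(4)] by (intro mult_left_mono) auto
    also have "\<dots> \<le> \<theta> * (B * mean P g) + 1 * (B\<^sup>2 / real n)"
      unfolding distrib_left
    proof (intro add_mono mult_right_mono)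
      show "\<theta>\<^sup>2 \<le> \<theta>" "\<theta>\<^sup>2 \<le> 1" using h by (auto simp: power2_eq_square intro: mult_left_le_one_le mult_le_one)
    qed (use B nonneg h in auto)
    also have "\<theta> * (B * mean P g) = B * mean P h" by (simp add: h(1) mean_scale)
    also have "B * mean P h \<le> B * \<mu>" using h B by (intro mult_left_mono)
    finally show ?thesis by (simp add: w_def)
  qed
  have "\<exists>N\<in>sets M. measure M N \<le> 2 * exp (- y) \<and>
    (\<forall>\<omega>\<in>space M - N. \<forall>g\<in>star_level P L \<mu>. \<bar>mean P g - emp_mean n (sample Z n \<omega>) g\<bar> \<le> T / real n)"
  proof (rule separable_class_deviation[OF c0 bc Gm sep w _ y])
    have "(\<integral>\<^sup>+\<omega>. sup_dev P n (sample Z n \<omega>) (star_level P L \<mu>) \<partial>M)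
      \<le> (\<integral>\<^sup>+\<omega>. ennreal (\<mu> / l) * sup_dev P n (sample Z n \<omega>) (star_level P L l) \<partial>M)"
      by (intro nn_integral_mono sup_dev_star_level_scale l)
    also have "\<dots> \<le> ennreal (\<mu> / l) * (\<integral>\<^sup>+\<omega>. sup_dev P n (sample Z n \<omega>) (star_level P L l) \<partial>M)"
      using l \<mu>0 by (intro nn_integral_cmult_le) simp
    also have "\<dots> \<le> ennreal (\<mu> / l) * ennreal (\<epsilon> / 4 * l)" by (intro mult_left_mono D) simp
    also have "\<dots> = ennreal (\<mu> / l * (\<epsilon> / 4 * l))" using l \<mu>0 \<epsilon> by (intro ennreal_mult[symmetric]) auto
    also have "\<mu> / l * (\<epsilon> / 4 * l) = T / (4 * real n)" using l n0 by (simp add: T_def)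
    finally show "(\<integral>\<^sup>+\<omega>. sup_dev P n (sample Z n \<omega>) (star_level P L \<mu>) \<partial>M) \<le> ennreal (T / (4 * real n))" .
    show "1000 * c * y \<le> T" using y by (simp add: c_def)
    have Bn: "B * \<mu> * real n = B * T / \<epsilon>" using \<epsilon> by (simp add: T_def)
    \<comment> \<open>By \<open>B * y \<le> \<epsilon> * T / 2000\<close> the part of
      \<open>w\<close> linear in \<open>B\<close> contributes at most half of
      \<open>T\<^sup>2\<close>, and the quadratic part far less than the other half.\<close>
    have "1000 * real n * w * y = 1000 * (B * y) * (T / \<epsilon>) + 1000 * B * (B * y)"
    proof -
      have "real n * w = B * T / \<epsilon> + B\<^sup>2" using Bn n0 by (simp add: w_def distrib_left mult_ac)
      then have "1000 * real n * w * y = 1000 * (B * T / \<epsilon> + B\<^sup>2) * y" by (simp only: mult.assoc)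
      then show ?thesis by (simp add: algebra_simps power2_eq_square)
    qed
    also have "\<dots> \<le> 1000 * (\<epsilon> * T / 2000) * (T / \<epsilon>) + 1000 * (B * y) * (\<epsilon> * T / 2000)"
      using By BBy B y T0 \<epsilon> by (intro add_mono mult_mono) auto
    also have "\<dots> \<le> 1000 * (\<epsilon> * T / 2000) * (T / \<epsilon>) + 1000 * (\<epsilon> * T / 2000) * (\<epsilon> * T / 2000)"
      using By T0 \<epsilon> by (intro add_mono mult_mono order_refl mult_left_mono mult_right_mono) auto
    also have "\<dots> = T\<^sup>2 * (1 / 2 + \<epsilon>\<^sup>2 / 4000)" using \<epsilon> by (simp add: field_simps power2_eq_square)
    also have "\<dots> \<le> T\<^sup>2 * 1"
      using \<epsilon> power_le_one[of \<epsilon> 2] by (intro mult_left_mono) auto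
    finally show "1000 * real n * w * y \<le> T\<^sup>2" by simp
  qed
  then obtain N where N: "N \<in> sets M" "measure M N \<le> 2 * exp (- y)"
    "\<And>\<omega> g. \<omega> \<in> space M - N \<Longrightarrow> g \<in> star_level P L \<mu> \<Longrightarrow> \<bar>mean P g - emp_mean n (sample Z n \<omega>) g\<bar> \<le> T / real n"
    by blast
  have Tn: "T / real n = \<epsilon> * \<mu>" using n0 by (simp add: T_def)
  show ?thesis
  proof (intro bexI[OF _ N(1)] conjI N(2) ballI)
    fix \<omega> g assume \<omega>: "\<omega> \<in> space M - N" and g: "g \<in> L"
    \<comment> \<open>The factor that brings \<open>g\<close> down to level \<open>\<mu>\<close>; it
      is 1 if the mean of \<open>g\<close> is already at most \<open>\<mu>\<close>.\<close>
    define \<theta> where "\<theta> = \<mu> / max (mean P g) \<mu>"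
    have m0: "0 < max (mean P g) \<mu>" using \<mu>0 by simp
    have \<theta>: "0 < \<theta>" "\<theta> \<le> 1" using \<mu>0 m0 by (auto simp: \<theta>_def divide_le_eq)
    have "\<theta> * mean P g \<le> \<theta> * max (mean P g) \<mu>" using \<theta> by (intro mult_left_mono) auto
    also have "\<dots> = \<mu>" using m0 by (simp add: \<theta>_def)
    finally have "(\<lambda>z. \<theta> * g z) \<in> star_level P L \<mu>" using \<theta> g by (intro star_levelI) auto
    from N(3)[OF \<omega> this] have "\<theta> * \<bar>mean P g - emp_mean n (sample Z n \<omega>) g\<bar> \<le> \<epsilon> * \<mu>"
      using \<theta> by (simp add: mean_scale emp_mean_scale right_diff_distrib[symmetric] abs_mult Tn)
    then show "\<bar>mean P g - emp_mean n (sample Z n \<omega>) g\<bar> \<le> \<epsilon> * max (mean P g) \<mu>"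
      using m0 \<mu>0 by (simp add: \<theta>_def field_simps)
  qed
qed

text \<open>For one function the mean absolute deviation is bounded by the standard deviation, so
  the tail bound applies without a fixed point. Including \<open>real n * \<eta> * m\<close> in the
  threshold lets the second-moment condition absorb the variance.\<close>

lemma single_deviation:
  assumes g: "g \<in> borel_measurable P" and nonneg: "AE z in P. 0 \<le> g z"
    and b: "b_fun M Z n g \<le> ereal b"
    and v: "mean P (\<lambda>z. (g z)\<^sup>2) \<le> B * mean P g + B\<^sup>2 / real n"
    and B: "0 \<le> B" and \<eta>: "0 < \<eta>" "\<eta> \<le> 1" and y: "1 \<le> y"
  shows "\<exists>N\<in>sets M. measure M N \<le> 2 * exp (- y) \<and>
    (\<forall>\<omega>\<in>space M - N. \<bar>mean P g - emp_mean n (sample Z n \<omega>) g\<bar>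
      \<le> \<eta> * mean P g + 2000 * ((b + B / \<eta>) * y / (real n * \<eta>)))"
proof -
  have n0: "0 < real n" using n by simp
  have b0: "0 \<le> b"
    using order_trans[OF psi1_norm_nonneg b[unfolded b_fun_def]] by simp
  have "b_class M Z n {g} \<le> ereal b" using b by (simp add: b_fun_eq)
  then have "b_class M Z n {g} < ereal (b + 1)"
    by (rule le_less_trans) simp
  then have int: "integrable P g" "integrable P (\<lambda>z. (g z)\<^sup>2)"
    using integrable_member[of "b + 1" "{g}" g] b0 g by auto
  define m where "m = mean P g"
  have m0: "0 \<le> m" unfolding m_def mean_def using nonneg by (intro integral_nonneg_AE)
  define T where "T = real n * \<eta> * m + 2000 * ((b + B / \<eta>) * y / \<eta>)"
  have t2: "0 \<le> (b + B / \<eta>) * y / \<eta>" using b0 B \<eta> y by simp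
  have t1: "0 \<le> real n * \<eta> * m" using n0 \<eta> m0 by simp
  have Tn: "T / real n = \<eta> * m + 2000 * ((b + B / \<eta>) * y / (real n * \<eta>))"
  proof -
    have "(real n * \<eta> * m + 2000 * (K / \<eta>)) / real n = \<eta> * m + 2000 * (K / (real n * \<eta>))" for K
      using n0 by (simp add: add_divide_distrib mult.commute)
    then show ?thesis by (simp only: T_def)
  qed
  show ?thesis
  \<comment> \<open>The tail bound needs a positive envelope level, hence \<open>T > 0\<close>. If
    \<open>T = 0\<close> the mean vanishes, so the nonnegative \<open>g\<close> is almost surely 0
    and there is no deviation.\<close>
  proof (cases "T = 0")
    case True
    then have "real n * \<eta> * m = 0" using t1 t2 unfolding T_def by linarith
    then have "m = 0" using n0 \<eta> by simp
    then have "AE z in P. g z = 0"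
      using int nonneg unfolding m_def mean_def by (simp add: integral_nonneg_eq_0_iff_AE)
    then have "AE \<omega> in M. \<forall>i\<in>{1..n}. g (Z i \<omega>) = 0"
      by (intro AE_finite_allI AE_Z) auto
    then obtain N where N: "N \<in> null_sets M" "{\<omega> \<in> space M. \<not> (\<forall>i\<in>{1..n}. g (Z i \<omega>) = 0)} \<subseteq> N"
      by (auto simp: eventually_ae_filter)
    have "emp_mean n (sample Z n \<omega>) g = 0" if "\<omega> \<in> space M - N" for \<omega>
      using that N(2) by (auto simp: emp_mean_def intro!: sum.neutral)
    then show ?thesis
      using N(1) \<open>m = 0\<close> True Tn by (intro bexI[of _ N]) (auto simp: m_def measure_eq_0_null_sets null_setsD2)
  next
    case False
    then have T0: "0 < T" using t1 t2 unfolding T_def by linarith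
    have bB: "2000 * ((b + B / \<eta>) * y) \<le> \<eta> * T"
      using t1 \<eta> mult_left_mono[of "2000 * ((b + B / \<eta>) * y / \<eta>)" T \<eta>] unfolding T_def by simp
    have "0 \<le> B / \<eta> * y" "0 \<le> b * y" using B \<eta> y b0 by auto
    then have by': "2000 * (b * y) \<le> \<eta> * T" and "2000 * (B / \<eta> * y) \<le> \<eta> * T"
      by (smt (verit, best) bB distrib_right)+
    then have By: "B * y \<le> \<eta>\<^sup>2 * T / 2000" using \<eta> by (simp add: field_simps power2_eq_square)
    have \<eta>T: "\<eta> * T \<le> T" using \<eta> T0 by simp
    have "real n * \<eta> * m \<le> T" using t2 unfolding T_def by linarith
    then have nm: "real n * m \<le> T / \<eta>" using \<eta> by (simp add: pos_le_divide_eq mult_ac)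
    have BBy: "B \<le> B * y" using mult_left_mono[OF y B] by simp
    define c where "c = T / (1000 * y)"
    have c0: "0 < c" using T0 y by (simp add: c_def)
    have "b < c"
    proof -
      have "1000 * (b * y) < T" using by' \<eta>T T0 by linarith
      then show ?thesis using y by (simp add: c_def field_simps)
    qed
    then have bc: "b_class M Z n {g} < ereal c"
      using b unfolding b_fun_eq by (metis less_ereal.simps(1) order_le_less_trans)
    define w where "w = B * m + B\<^sup>2 / real n"
    have w0: "0 \<le> w" using B m0 by (simp add: w_def)
    have T2: "1000 * real n * w * y \<le> T\<^sup>2"
    proof -
      have "1000 * real n * w * y = 1000 * (B * y) * (real n * m) + 1000 * B * (B * y)"
        using n0 by (simp add: w_def field_simps power2_eq_square)
      also have "\<dots> \<le> 1000 * (\<eta>\<^sup>2 * T / 2000) * (T / \<eta>) + 1000 * (B * y) * (\<eta>\<^sup>2 * T / 2000)"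
        using By BBy B y T0 \<eta> nm m0 by (intro add_mono mult_mono) auto
      also have "\<dots> \<le> 1000 * (\<eta>\<^sup>2 * T / 2000) * (T / \<eta>) + 1000 * (\<eta>\<^sup>2 * T / 2000) * (\<eta>\<^sup>2 * T / 2000)"
        using By T0 \<eta> by (intro add_mono mult_left_mono mult_right_mono order_refl) auto
      also have "\<dots> = T\<^sup>2 * (\<eta> / 2 + \<eta> ^ 4 / 4000)" using \<eta> by (simp add: field_simps power2_eq_square power4_eq_xxxx)
      also have "\<dots> \<le> T\<^sup>2 * 1"
        using \<eta> power_le_one[of \<eta> 4] by (intro mult_left_mono) auto
      finally show ?thesis by simp
    qed
    have "\<exists>N\<in>sets M. measure M N \<le> 2 * exp (- y) \<and>
      (\<forall>\<omega>\<in>space M - N. \<forall>h\<in>{g}. \<bar>mean P h - emp_mean n (sample Z n \<omega>) h\<bar> \<le> T / real n)"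
    proof (rule separable_class_deviation[OF c0 bc _ _ _ _ y _ T2])
      show "{g} \<subseteq> borel_measurable P" using g by simp
      show "pointwise_separable P {g}"
        unfolding pointwise_separable_def by (intro exI[of _ "{g}"]) (auto intro!: exI[of _ "\<lambda>_. g"])
      show "mean P (\<lambda>z. (h z)\<^sup>2) \<le> w" if "h \<in> {g}" for h using that v by (simp add: w_def m_def)
      show "1000 * c * y \<le> T" using y by (simp add: c_def)
      \<comment> \<open>The bound to be proved for the mean absolute deviation. It follows from
        \<open>\<bar>X\<bar> \<le> a / 2 + X\<^sup>2 / (2 * a)\<close>, because the second moment of
        \<open>X\<close> is at most \<open>a\<^sup>2\<close>.\<close>
      define a where "a = T / (4 * real n)"
      have a0: "0 < a" using T0 n0 by (simp add: a_def)
      define X where "X x = mean P g - emp_mean n x g" for x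
      have Xeq: "X x = - (\<Sum>i\<in>{1..n}. g (x i) - m) / real n" for x
        using n0 by (simp add: X_def m_def emp_mean_def sum_subtractf diff_divide_distrib minus_divide_left[symmetric])
      have ui: "integrable P (\<lambda>z. g z - m)" using int by simp
      have ui2: "integrable P (\<lambda>z. (g z - m)\<^sup>2)"
        unfolding power2_diff using int by (intro Bochner_Integration.integrable_add Bochner_Integration.integrable_diff) auto
      have u0: "P.expectation (\<lambda>z. g z - m) = 0" using int by (simp add: m_def mean_def P.prob_space)
      have u2: "P.expectation (\<lambda>z. (g z - m)\<^sup>2) \<le> w"
      proof -
        have "P.expectation (\<lambda>z. (g z - m)\<^sup>2) = mean P (\<lambda>z. (g z)\<^sup>2) - m\<^sup>2"
          using P.variance_eq[OF int] by (simp add: m_def mean_def)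
        then show ?thesis using v by (simp add: w_def m_def) (smt (verit) zero_le_power2)
      qed
      note sm = P.second_moment_sum_PiM[OF _ ui ui2 u0, of "{1..n}"]
      have X2: "integrable Q (\<lambda>x. (X x)\<^sup>2)" "(\<integral>x. (X x)\<^sup>2 \<partial>Q) \<le> w / real n"
      proof -
        have eq: "(X x)\<^sup>2 = (\<Sum>i\<in>{1..n}. g (x i) - m)\<^sup>2 / (real n)\<^sup>2" for x
          by (simp add: Xeq power_divide)
        show "integrable Q (\<lambda>x. (X x)\<^sup>2)" unfolding eq using sm by simp
        have "(\<integral>x. (X x)\<^sup>2 \<partial>Q) = real n * P.expectation (\<lambda>z. (g z - m)\<^sup>2) / (real n)\<^sup>2"
          unfolding eq using sm by simp
        also have "\<dots> \<le> real n * w / (real n)\<^sup>2" using u2 by (intro divide_right_mono mult_left_mono) auto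
        finally show "(\<integral>x. (X x)\<^sup>2 \<partial>Q) \<le> w / real n" using n0 by (simp add: power2_eq_square)
      qed
      have wa: "w / real n \<le> a\<^sup>2"
      proof -
        have "16 * real n * w * 1 \<le> 1000 * real n * w * y" using w0 n0 y by (intro mult_mono) auto
        then have "16 * real n * w \<le> T\<^sup>2" using T2 by linarith
        then show ?thesis using n0 by (simp add: a_def power_divide field_simps power2_eq_square)
      qed
      have "(\<integral>\<^sup>+\<omega>. sup_dev P n (sample Z n \<omega>) {g} \<partial>M) = (\<integral>\<^sup>+\<omega>. ennreal \<bar>X (sample Z n \<omega>)\<bar> \<partial>M)"
        by (simp add: sup_dev_def X_def)
      also have "\<dots> \<le> (\<integral>\<^sup>+\<omega>. ennreal (a / 2 + (X (sample Z n \<omega>))\<^sup>2 / (2 * a)) \<partial>M)"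
      proof (intro nn_integral_mono ennreal_leI)
        fix \<omega>
        let ?X = "X (sample Z n \<omega>)"
        have "0 \<le> (a - \<bar>?X\<bar>)\<^sup>2" by simp
        then have "2 * a * \<bar>?X\<bar> \<le> a\<^sup>2 + ?X\<^sup>2" by (simp add: power2_diff)
        then show "\<bar>?X\<bar> \<le> a / 2 + ?X\<^sup>2 / (2 * a)" using a0 by (simp add: field_simps power2_eq_square)
      qed
      also have "\<dots> = (\<integral>\<^sup>+x. ennreal (a / 2 + (X x)\<^sup>2 / (2 * a)) \<partial>Q)"
      proof (rule nn_integral_sample[symmetric])
        have [measurable]: "(\<lambda>x. (X x)\<^sup>2) \<in> borel_measurable Q" using X2 by auto
        show "(\<lambda>x. ennreal (a / 2 + (X x)\<^sup>2 / (2 * a))) \<in> borel_measurable Q" by measurable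
      qed
      also have "\<dots> = ennreal (\<integral>x. a / 2 + (X x)\<^sup>2 / (2 * a) \<partial>Q)"
      proof (rule nn_integral_eq_integral)
        interpret QQ: prob_space Q by (rule prob_space_PiM) (rule P.prob_space_axioms)
        show "integrable Q (\<lambda>x. a / 2 + (X x)\<^sup>2 / (2 * a))"
          by (intro Bochner_Integration.integrable_add QQ.integrable_const integrable_divide X2)
        show "AE x in Q. 0 \<le> a / 2 + (X x)\<^sup>2 / (2 * a)" using a0 by simp
      qed
      also have "\<dots> \<le> ennreal (T / (4 * real n))"
      proof (rule ennreal_leI)
        interpret QQ: prob_space Q by (rule prob_space_PiM) (rule P.prob_space_axioms)
        have "(\<integral>x. a / 2 + (X x)\<^sup>2 / (2 * a) \<partial>Q) = a / 2 + (\<integral>x. (X x)\<^sup>2 \<partial>Q) / (2 * a)"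
          using Bochner_Integration.integral_add[OF QQ.integrable_const[of "a / 2"] integrable_divide[OF X2(1), of "2 * a"]]
          by (simp only: lebesgue_integral_const QQ.prob_space scaleR_one integral_divide_zero)
        also have "\<dots> \<le> a / 2 + a\<^sup>2 / (2 * a)"
          using X2(2) wa a0 by (intro add_left_mono divide_right_mono) auto
        also have "\<dots> = a" using a0 by (simp add: power2_eq_square)
        finally show "(\<integral>x. a / 2 + (X x)\<^sup>2 / (2 * a) \<partial>Q) \<le> T / (4 * real n)" by (simp add: a_def)
      qed
      finally show "(\<integral>\<^sup>+\<omega>. sup_dev P n (sample Z n \<omega>) {g} \<partial>M) \<le> ennreal (T / (4 * real n))" .
    qed
    then show ?thesis unfolding Tn m_def[symmetric] by (simp add: m_def)
  qed
qed

text \<open>The estimator is random, so one null set must serve the whole class: take it for the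
  countable dense subclass, and pointwise limits keep the sign.\<close>

lemma separable_nonneg:
  assumes G: "pointwise_separable P G" and nonneg: "\<And>g. g \<in> G \<Longrightarrow> AE z in P. 0 \<le> g z"
  shows "AE \<omega> in M. \<forall>g\<in>G. \<forall>i\<in>{1..n}. 0 \<le> g (Z i \<omega>)"
proof -
  obtain G0 where G0: "G0 \<subseteq> G" "countable G0"
    and lim: "\<And>g. g \<in> G \<Longrightarrow> \<exists>s :: nat \<Rightarrow> 'z \<Rightarrow> real. range s \<subseteq> G0 \<and> (\<forall>z\<in>space P. (\<lambda>k. s k z) \<longlonglongrightarrow> g z)"
    using G unfolding pointwise_separable_def by auto
  have "AE \<omega> in M. \<forall>g\<in>G0. \<forall>i\<in>{1..n}. 0 \<le> g (Z i \<omega>)"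
    using G0 nonneg by (intro AE_ball_countable' AE_finite_allI AE_Z) auto
  then show ?thesis
    using AE_space
  proof eventually_elim
    fix \<omega> assume \<omega>: "\<forall>g\<in>G0. \<forall>i\<in>{1..n}. 0 \<le> g (Z i \<omega>)" "\<omega> \<in> space M"
    show "\<forall>g\<in>G. \<forall>i\<in>{1..n}. 0 \<le> g (Z i \<omega>)"
    proof (intro ballI)
      fix g i assume "g \<in> G" and i: "i \<in> {1..n}"
      then obtain s where s: "range s \<subseteq> G0" "\<And>z. z \<in> space P \<Longrightarrow> (\<lambda>k. s k z) \<longlonglongrightarrow> g z"
        using lim by blast
      have "0 \<le> s k (Z i \<omega>)" for k using range_subsetD[OF s(1), of k] \<omega> i by blast
      then show "0 \<le> g (Z i \<omega>)"
        by (intro LIMSEQ_le_const[OF s(2)[OF Z_space[OF i \<omega>(2)]]]) auto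
    qed
  qed
qed

end

section \<open>Regularized empirical risk minimization\<close>

text \<open>Nonnegativity of \<open>J\<close> bounds its image below, without which the real-valued
  infimum says nothing about \<open>J f\<close>.\<close>

lemma Arg_Min_le:
  assumes "h \<in> Arg_Min n F J" "f \<in> F" "\<And>g. g \<in> F \<Longrightarrow> 0 \<le> J g"
  shows "J h \<le> J f + (if min_attained F J then 0 else 1 / real n)"
proof (cases "min_attained F J")
  case False
  have "(INF g\<in>F. J g) \<le> J f"
    using assms by (intro cINF_lower bdd_belowI2[where m = 0])
  then show ?thesis using assms(1) False by (auto simp: Arg_Min_def)
qed (use assms in \<open>auto simp: Arg_Min_def\<close>)

text \<open>Above level \<open>q\<close> the error is relative and
  \<open>(1 + 2 * \<epsilon>) * (1 - \<epsilon>) \<ge> 1\<close> inverts it, which uses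
  \<open>\<epsilon> \<le> 1 / 2\<close>; below \<open>q\<close> the error is the additive
  \<open>\<epsilon> * q\<close>.\<close>

lemma isomorphic_bound:
  fixes R Rn :: real
  assumes "\<bar>R - Rn\<bar> \<le> \<epsilon> * max R q" "0 \<le> q" "0 \<le> Rn" "0 < \<epsilon>" "\<epsilon> \<le> 1 / 2"
  shows "R \<le> (1 + 2 * \<epsilon>) * Rn + \<epsilon> * q"
proof (cases "q < R")
  case True
  then have "(1 - \<epsilon>) * R \<le> Rn" using assms by (simp add: algebra_simps)
  then have "(1 + 2 * \<epsilon>) * ((1 - \<epsilon>) * R) \<le> (1 + 2 * \<epsilon>) * Rn" using assms by (intro mult_left_mono) auto
  moreover have "1 * R \<le> ((1 + 2 * \<epsilon>) * (1 - \<epsilon>)) * R"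
  proof (rule mult_right_mono)
    have "0 \<le> \<epsilon> * (1 - 2 * \<epsilon>)" using assms by simp
    then show "1 \<le> (1 + 2 * \<epsilon>) * (1 - \<epsilon>)" by (simp add: algebra_simps)
  qed (use True assms in simp)
  moreover have "0 \<le> \<epsilon> * q" using assms by simp
  ultimately show ?thesis by (simp add: mult.assoc)
next
  case False
  then have "R \<le> Rn + \<epsilon> * q" using assms(1) by (simp add: max_def split: if_splits)
  moreover have "0 \<le> \<epsilon> * Rn" using assms by simp
  ultimately show ?thesis by (simp add: distrib_right)
qed

section \<open>The setting of the theorem and its deviation events\<close>

locale regularized_erm = iid_sample M P Z n
  for M :: "'w measure" and P :: "'z measure" and Z n +
  fixes loss :: "('z \<Rightarrow> real) \<Rightarrow> 'z \<Rightarrow> real" and F :: "('z \<Rightarrow> real) set"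
    and crit :: "('z \<Rightarrow> real) \<Rightarrow> real" and \<phi> B lam :: "real \<Rightarrow> real" and \<epsilon> :: real
    and \<rho> :: "real \<Rightarrow> real \<Rightarrow> real"
  assumes loss_measurable: "\<And>f. f \<in> F \<Longrightarrow> loss f \<in> borel_measurable P"
    and crit_nonneg: "\<And>f. f \<in> F \<Longrightarrow> 0 \<le> crit f"
    and separable: "\<And>r l. 0 \<le> r \<Longrightarrow> 0 < l \<Longrightarrow> pointwise_separable P (star_level P (loss ` crit_ball F crit r) l)"
    and loss_nonneg: "\<And>f. f \<in> F \<Longrightarrow> AE z in P. 0 \<le> loss f z"
    and B_nonneg: "\<And>r. 0 \<le> r \<Longrightarrow> 0 \<le> B r"
    and b_le: "\<And>r f. 0 \<le> r \<Longrightarrow> f \<in> crit_ball F crit r \<Longrightarrow> b_class M Z n (loss ` crit_ball F crit r) \<le> ereal (\<phi> r)"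
    and second_moment: "\<And>r f. 0 \<le> r \<Longrightarrow> f \<in> crit_ball F crit r \<Longrightarrow>
      mean P (\<lambda>z. (loss f z)\<^sup>2) \<le> B r * mean P (loss f) + (B r)\<^sup>2 / real n"
    and \<epsilon>: "0 < \<epsilon>" "\<epsilon> < 1 / 2"
    and lam_pos: "\<And>r. 0 \<le> r \<Longrightarrow> 0 < lam r"
    and lam_fixpoint: "\<And>r. 0 \<le> r \<Longrightarrow> (\<integral>\<^sup>+\<omega>. sup_dev P n (sample Z n \<omega>)
        (star_level P (loss ` crit_ball F crit r) (lam r)) \<partial>M) \<le> ennreal (\<epsilon> / 4 * lam r)"
    and \<rho>_mono: "\<And>r s x. 0 < x \<Longrightarrow> 0 \<le> r \<Longrightarrow> r \<le> s \<Longrightarrow> \<rho> r x \<le> \<rho> s x"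
    and \<rho>_ge: "\<And>r x. 0 \<le> r \<Longrightarrow> 0 < x \<Longrightarrow>
      max (lam r) (2000 * ((\<phi> r + B r / \<epsilon>) * (x + 1) / (real n * \<epsilon>))) \<le> \<rho> r x"
begin

abbreviation "R f \<equiv> mean P (loss f)"
abbreviation "Rn \<omega> f \<equiv> emp_mean n (sample Z n \<omega>) (loss f)"
abbreviation "bn f \<equiv> real_of_ereal (b_fun M Z n (loss f))"

lemma n_pos: "0 < real n"
  using n by simp

lemma R_nonneg: "f \<in> F \<Longrightarrow> 0 \<le> R f"
  unfolding mean_def by (intro integral_nonneg_AE loss_nonneg)

lemma \<rho>_pos: "0 \<le> r \<Longrightarrow> 0 < x \<Longrightarrow> 0 < \<rho> r x"
  using \<rho>_ge[of r x] lam_pos[of r] by linarith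

lemma lam_le_\<rho>: "0 \<le> r \<Longrightarrow> 0 < x \<Longrightarrow> lam r \<le> \<rho> r x"
  using \<rho>_ge[of r x] by linarith

lemma in_crit_ball: "f \<in> F \<Longrightarrow> f \<in> crit_ball F crit (crit f)"
  by (simp add: crit_ball_def)

lemma bn_nonneg: "0 \<le> bn f"
  unfolding b_fun_def by (intro real_of_ereal_pos psi1_norm_nonneg)

text \<open>\<open>real_of_ereal\<close> would turn an infinite norm into 0; the envelope bound
  \<open>\<phi> (crit f)\<close> rules this out.\<close>

lemma b_fun_le_bn:
  assumes "f \<in> F"
  shows "b_fun M Z n (loss f) \<le> ereal (bn f)"
proof -
  have "b_fun M Z n (loss f) \<le> b_class M Z n (loss ` crit_ball F crit (crit f))"
    unfolding b_fun_eq using in_crit_ball[OF assms] by (intro b_class_mono) auto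
  also have "\<dots> \<le> ereal (\<phi> (crit f))"
    by (rule b_le[OF crit_nonneg[OF assms] in_crit_ball[OF assms]])
  finally have "b_fun M Z n (loss f) \<le> ereal (\<phi> (crit f))" .
  moreover have "0 \<le> b_fun M Z n (loss f)" unfolding b_fun_def by (rule psi1_norm_nonneg)
  ultimately show ?thesis by (cases "b_fun M Z n (loss f)") auto
qed

text \<open>The tail bound wants a parameter of at least 1 and receives \<open>t + 1\<close>, whence
  the factor \<open>x + 1\<close> in the lower bound on \<open>\<rho>\<close>. Localization is at
  the smallest level that this lower bound allows, and is relaxed to \<open>\<rho> r t\<close> at
  the end.\<close>

lemma crit_ball_deviation:
  assumes r: "0 \<le> r" and t: "0 < t"
  shows "\<exists>N\<in>sets M. measure M N \<le> 2 * exp (- (t + 1)) \<and>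
    (\<forall>\<omega>\<in>space M - N. \<forall>f\<in>crit_ball F crit r. \<bar>R f - Rn \<omega> f\<bar> \<le> \<epsilon> * max (R f) (\<rho> r t))"
proof (cases "crit_ball F crit r = {}")
  case True
  then show ?thesis by (intro bexI[of _ "{}"]) auto
next
  case False
  then obtain f1 where f1: "f1 \<in> crit_ball F crit r" by auto
  define \<mu> where "\<mu> = max (lam r) (2000 * ((\<phi> r + B r / \<epsilon>) * (t + 1) / (real n * \<epsilon>)))"
  have \<mu>: "lam r \<le> \<mu>" "\<mu> \<le> \<rho> r t" "0 < \<mu>"
    using \<rho>_ge[OF r t] lam_pos[OF r] by (auto simp: \<mu>_def)
  let ?L = "loss ` crit_ball F crit r"
  have ballF: "f \<in> F" if "f \<in> crit_ball F crit r" for f using that by (simp add: crit_ball_def)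
  have "\<exists>N\<in>sets M. measure M N \<le> 2 * exp (- (t + 1)) \<and>
    (\<forall>\<omega>\<in>space M - N. \<forall>g\<in>?L. \<bar>mean P g - emp_mean n (sample Z n \<omega>) g\<bar> \<le> \<epsilon> * max (mean P g) \<mu>)"
  proof (rule star_level_deviation[where l = "lam r" and B = "B r" and \<phi> = "\<phi> r"])
    show "?L \<subseteq> borel_measurable P" using loss_measurable ballF by auto
    show "?L \<noteq> {}" using False by simp
    show "pointwise_separable P (star_level P ?L \<mu>)" using r \<mu> by (intro separable)
    show "0 \<le> mean P g" if "g \<in> ?L" for g using that R_nonneg ballF by auto
    show "b_class M Z n ?L \<le> ereal (\<phi> r)" by (rule b_le[OF r f1])
    show "mean P (\<lambda>z. (g z)\<^sup>2) \<le> B r * mean P g + (B r)\<^sup>2 / real n" if "g \<in> ?L" for g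
      using that second_moment[OF r] by auto
    show "2000 * ((\<phi> r + B r / \<epsilon>) * (t + 1) / (real n * \<epsilon>)) \<le> \<mu>" by (simp add: \<mu>_def)
  qed (use B_nonneg[OF r] \<epsilon> lam_pos[OF r] \<mu> lam_fixpoint[OF r] t in auto)
  then obtain N where N: "N \<in> sets M" "measure M N \<le> 2 * exp (- (t + 1))"
    "\<And>\<omega> f. \<omega> \<in> space M - N \<Longrightarrow> f \<in> crit_ball F crit r \<Longrightarrow> \<bar>R f - Rn \<omega> f\<bar> \<le> \<epsilon> * max (R f) \<mu>"
    by blast
  show ?thesis
  proof (intro bexI[OF _ N(1)] conjI N(2) ballI)
    fix \<omega> f assume "\<omega> \<in> space M - N" "f \<in> crit_ball F crit r"
    then have "\<bar>R f - Rn \<omega> f\<bar> \<le> \<epsilon> * max (R f) \<mu>" by (rule N(3))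
    also have "\<dots> \<le> \<epsilon> * max (R f) (\<rho> r t)" using \<epsilon> \<mu> by (intro mult_left_mono max.mono) auto
    finally show "\<bar>R f - Rn \<omega> f\<bar> \<le> \<epsilon> * max (R f) (\<rho> r t)" .
  qed
qed

text \<open>Each \<open>f\<close> is handled in the ball whose radius is \<open>crit f\<close>
  rounded up, which is at most \<open>crit f + 1\<close>: hence the shift by 1 in the penalty. The
  number of balls is of order \<open>A\<close>, and \<open>ln A\<close> in \<open>t\<close> cancels
  it. The further radius \<open>k\<close> is for approximate minimizers that leave the range
  \<open>crit f \<le> A\<close>.\<close>

lemma peeling:
  assumes A: "1 \<le> A" and x: "0 < x" and t: "t = x + ln A"
  shows "\<exists>N\<in>sets M. measure M N \<le> 8 * exp (- (x + 1)) \<and> (\<forall>\<omega>\<in>space M - N.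
    (\<forall>f\<in>F. crit f \<le> A \<longrightarrow> \<bar>R f - Rn \<omega> f\<bar> \<le> \<epsilon> * max (R f) (\<rho> (crit f + 1) t)) \<and>
    (\<forall>f\<in>F. crit f \<le> real k \<longrightarrow> \<bar>R f - Rn \<omega> f\<bar> \<le> \<epsilon> * max (R f) (\<rho> (real k) t)))"
proof -
  have t0: "0 < t" using A x by (simp add: t add_pos_nonneg)
  \<comment> \<open>The integers from 0 to \<open>A\<close> rounded up, and \<open>k\<close>: at
    most \<open>A + 3 \<le> 4 * A\<close> radii because \<open>1 \<le> A\<close>. Each costs
    \<open>2 * exp (- (t + 1))\<close>, so the total is \<open>8 * exp (- (x + 1))\<close>.\<close>
  define K where "K = insert k {0..nat \<lceil>A\<rceil>}"
  have K: "finite K" "real (card K) \<le> 4 * A"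
  proof -
    have "card K \<le> nat \<lceil>A\<rceil> + 2" unfolding K_def by (rule order_trans[OF card_insert_le_m1]) auto
    then have "real (card K) \<le> real (nat \<lceil>A\<rceil>) + 2" by linarith
    also have "\<dots> \<le> (A + 1) + 2" using A by linarith
    finally show "real (card K) \<le> 4 * A" using A by linarith
  qed (simp add: K_def)
  have "\<forall>j. \<exists>N. N \<in> sets M \<and> measure M N \<le> 2 * exp (- (t + 1)) \<and> (\<forall>\<omega>\<in>space M - N.
      \<forall>f\<in>crit_ball F crit (real j). \<bar>R f - Rn \<omega> f\<bar> \<le> \<epsilon> * max (R f) (\<rho> (real j) t))"
    using crit_ball_deviation[OF _ t0] by (metis of_nat_0_le_iff)
  then obtain N where N: "\<And>j. N j \<in> sets M" "\<And>j. measure M (N j) \<le> 2 * exp (- (t + 1))"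
    "\<And>j \<omega> f. \<omega> \<in> space M - N j \<Longrightarrow> f \<in> crit_ball F crit (real j) \<Longrightarrow>
      \<bar>R f - Rn \<omega> f\<bar> \<le> \<epsilon> * max (R f) (\<rho> (real j) t)"
    by metis
  have "measure M (\<Union>j\<in>K. N j) \<le> (\<Sum>j\<in>K. measure M (N j))"
    using K N(1) by (intro M.finite_measure_subadditive_finite) auto
  also have "\<dots> \<le> real (card K) * (2 * exp (- (t + 1)))"
    using N(2) by (intro sum_bounded_above)
  also have "\<dots> \<le> 4 * A * (2 * exp (- (t + 1)))" using K by (intro mult_right_mono) auto
  also have "\<dots> = 8 * exp (- (x + 1))"
    using A by (simp add: t exp_add exp_diff exp_minus field_simps)
  finally have meas: "measure M (\<Union>j\<in>K. N j) \<le> 8 * exp (- (x + 1))" .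
  show ?thesis
  proof (intro bexI[of _ "\<Union>j\<in>K. N j"] conjI meas ballI impI)
    show "(\<Union>j\<in>K. N j) \<in> sets M" using K N(1) by auto
    fix \<omega> f assume \<omega>: "\<omega> \<in> space M - (\<Union>j\<in>K. N j)" and f: "f \<in> F"
    { assume c: "crit f \<le> A"
      define j where "j = nat \<lceil>crit f\<rceil>"
      have j: "crit f \<le> real j" "real j \<le> crit f + 1" using crit_nonneg[OF f] unfolding j_def by linarith+
      have "j \<le> nat \<lceil>A\<rceil>" using c unfolding j_def by (intro nat_mono ceiling_mono)
      then have "j \<in> K" by (simp add: K_def)
      then have "\<bar>R f - Rn \<omega> f\<bar> \<le> \<epsilon> * max (R f) (\<rho> (real j) t)"
        using \<omega> f j by (intro N(3)) (auto simp: crit_ball_def)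
      also have "\<dots> \<le> \<epsilon> * max (R f) (\<rho> (crit f + 1) t)"
        using \<epsilon> j \<rho>_mono[OF t0, of "real j" "crit f + 1"] by (intro mult_left_mono max.mono) auto
      finally show "\<bar>R f - Rn \<omega> f\<bar> \<le> \<epsilon> * max (R f) (\<rho> (crit f + 1) t)" . }
    { assume c: "crit f \<le> real k"
      then show "\<bar>R f - Rn \<omega> f\<bar> \<le> \<epsilon> * max (R f) (\<rho> (real k) t)"
        using \<omega> f by (intro N(3)) (auto simp: crit_ball_def K_def) }
  qed
qed

lemma risk_deviation:
  assumes f: "f \<in> F" and \<eta>: "0 < \<eta>" "\<eta> \<le> 1" and x: "0 < x"
  shows "\<exists>N\<in>sets M. measure M N \<le> 2 * exp (- (x + 1)) \<and> (\<forall>\<omega>\<in>space M - N.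
    \<bar>R f - Rn \<omega> f\<bar> \<le> \<eta> * R f + 2000 * ((bn f + B (crit f) / \<eta>) * (x + 1) / (real n * \<eta>)))"
  using single_deviation[OF loss_measurable[OF f] loss_nonneg[OF f] b_fun_le_bn[OF f]
      second_moment[OF crit_nonneg[OF f] in_crit_ball[OF f]] B_nonneg[OF crit_nonneg[OF f]] \<eta>, of "x + 1"] x
  by simp

text \<open>Separability is available for localized hulls only, so each loss is scaled by
  \<open>1 / (1 + R f)\<close> to enter level 1; its sign is unaffected. Countably many integer
  balls cover \<open>F\<close>.\<close>

lemma empirical_risk_nonneg: "AE \<omega> in M. \<forall>f\<in>F. 0 \<le> Rn \<omega> f"
proof -
  have "AE \<omega> in M. \<forall>k::nat. \<forall>g\<in>star_level P (loss ` crit_ball F crit (real k)) 1. \<forall>i\<in>{1..n}. 0 \<le> g (Z i \<omega>)"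
  proof (subst AE_all_countable, intro allI separable_nonneg separable)
    fix k :: nat and g assume "g \<in> star_level P (loss ` crit_ball F crit (real k)) 1"
    then obtain \<theta> h where h: "g = (\<lambda>z. \<theta> * h z)" "0 \<le> \<theta>" "h \<in> loss ` crit_ball F crit (real k)"
      by (rule star_levelE)
    then have "AE z in P. 0 \<le> h z" using loss_nonneg by (auto simp: crit_ball_def)
    then show "AE z in P. 0 \<le> g z" using h by (auto elim!: eventually_mono)
  qed auto
  then show ?thesis
  proof eventually_elim
    fix \<omega> assume *: "\<forall>k::nat. \<forall>g\<in>star_level P (loss ` crit_ball F crit (real k)) 1. \<forall>i\<in>{1..n}. 0 \<le> g (Z i \<omega>)"
    show "\<forall>f\<in>F. 0 \<le> Rn \<omega> f"
    proof
      fix f assume f: "f \<in> F"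
      define k where "k = nat \<lceil>crit f\<rceil>"
      have "crit f \<le> real k" unfolding k_def by linarith
      then have "loss f \<in> loss ` crit_ball F crit (real k)" using f by (auto simp: crit_ball_def)
      moreover define \<theta> where "\<theta> = 1 / (1 + R f)"
      moreover have \<theta>: "0 < \<theta>" "\<theta> \<le> 1" "\<theta> * R f \<le> 1"
        using R_nonneg[OF f] by (auto simp: \<theta>_def)
      ultimately have mem: "(\<lambda>z. \<theta> * loss f z) \<in> star_level P (loss ` crit_ball F crit (real k)) 1"
        by (intro star_levelI) auto
      have "0 \<le> \<theta> * loss f (Z i \<omega>)" if "i \<in> {1..n}" for i
        using *[rule_format, OF mem that] .
      then have "0 \<le> loss f (Z i \<omega>)" if "i \<in> {1..n}" for i
        using that \<theta> by (metis zero_le_mult_iff not_less)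
      then show "0 \<le> Rn \<omega> f" by (auto simp: emp_mean_def intro!: divide_nonneg_nonneg sum_nonneg)
    qed
  qed
qed

section \<open>From minimality to the oracle inequality\<close>

definition objective :: "real \<Rightarrow> (nat \<Rightarrow> 'z) \<Rightarrow> ('z \<Rightarrow> real) \<Rightarrow> real" where
  "objective t d f = emp_mean n d (loss f) + 2 / (1 + 2 * \<epsilon>) * \<rho> (crit f + 1) t"

text \<open>Multiplying the minimality by \<open>1 + 2 * \<epsilon>\<close> gives the empirical risk
  the coefficient it has in \<open>isomorphic_bound\<close> and the penalty the coefficient 2, of
  which one copy must remain on the left of the oracle inequality.\<close>

lemma objective_minimiser:
  assumes t: "0 < t" and nn: "\<forall>f\<in>F. 0 \<le> Rn \<omega> f" and f: "f \<in> F"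
    and h: "h \<in> Arg_Min n F (objective t (sample Z n \<omega>))"
  shows "h \<in> F"
    and "(1 + 2 * \<epsilon>) * Rn \<omega> h + 2 * \<rho> (crit h + 1) t \<le> (1 + 2 * \<epsilon>) * Rn \<omega> f + 2 * \<rho> (crit f + 1) t
      + (1 + 2 * \<epsilon>) * (if min_attained F (objective t (sample Z n \<omega>)) then 0 else 1 / real n)"
proof -
  show "h \<in> F" using h by (auto simp: Arg_Min_def split: if_splits)
  let ?d = "if min_attained F (objective t (sample Z n \<omega>)) then 0 else 1 / real n"
  have "0 \<le> objective t (sample Z n \<omega>) g" if "g \<in> F" for g
    using nn that \<rho>_pos[OF _ t, of "crit g + 1"] crit_nonneg[OF that] \<epsilon> by (auto simp: objective_def)
  from Arg_Min_le[OF h f this]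
  have "(1 + 2 * \<epsilon>) * objective t (sample Z n \<omega>) h \<le> (1 + 2 * \<epsilon>) * (objective t (sample Z n \<omega>) f + ?d)"
    using \<epsilon> by (intro mult_left_mono) auto
  moreover have "(1 + 2 * \<epsilon>) * objective t (sample Z n \<omega>) g = (1 + 2 * \<epsilon>) * Rn \<omega> g + 2 * \<rho> (crit g + 1) t" for g
    using \<epsilon> by (simp add: objective_def distrib_left[of "1 + 2 * \<epsilon>"])
  ultimately show "(1 + 2 * \<epsilon>) * Rn \<omega> h + 2 * \<rho> (crit h + 1) t \<le> (1 + 2 * \<epsilon>) * Rn \<omega> f + 2 * \<rho> (crit f + 1) t
      + (1 + 2 * \<epsilon>) * ?d"
    by (simp add: distrib_left[of "1 + 2 * \<epsilon>"])
qed

text \<open>\<open>loc\<close> isolates what the two cases of the theorem must supply: either the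
  estimator lies where peeling is uniform, or it is only approximate and lies in one fixed ball
  where \<open>\<rho>\<close> is of order \<open>1 / n\<close>.\<close>

lemma oracle_inequality:
  assumes A: "1 \<le> A" and x: "0 < x" and t: "t = x + ln A"
    and fhat: "\<And>\<omega>. \<omega> \<in> space M \<Longrightarrow> fhat (sample Z n \<omega>) \<in> Arg_Min n F (objective t (sample Z n \<omega>))"
    and N0: "N0 \<in> sets M" "measure M N0 \<le> 2 * exp (- (x + 1))"
    and loc: "\<And>\<omega>. \<omega> \<in> space M - N0 \<Longrightarrow> \<forall>f\<in>F. 0 \<le> Rn \<omega> f \<Longrightarrow>
      crit (fhat (sample Z n \<omega>)) \<le> A \<or>
      (\<not> min_attained F (objective t (sample Z n \<omega>)) \<and> crit (fhat (sample Z n \<omega>)) \<le> real k \<and> \<rho> (real k) t \<le> 6 / real n)"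
  shows "\<exists>E\<in>sets M. measure M E > 1 - 12 * exp (- x) \<and> (\<forall>\<omega>\<in>E.
    R (fhat (sample Z n \<omega>)) + \<rho> (crit (fhat (sample Z n \<omega>)) + 1) t
      \<le> (INF f\<in>F. (1 + 3 * \<epsilon>) * R f + 2 * \<rho> (crit f + 1) t
          + 16000 * ((bn f + B (crit f) / \<epsilon>) * (x + 1) / (real n * \<epsilon>)))
        + (if min_attained F (objective t (sample Z n \<omega>)) then 0 else 16000 / real n))"
proof -
  have t0: "0 < t" using A x by (simp add: t add_pos_nonneg)
  define \<Phi> where "\<Phi> f = (1 + 3 * \<epsilon>) * R f + 2 * \<rho> (crit f + 1) t
          + 16000 * ((bn f + B (crit f) / \<epsilon>) * (x + 1) / (real n * \<epsilon>))" for f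
  have rem0: "0 \<le> (bn f + B (crit f) / \<epsilon>) * (x + 1) / (real n * \<epsilon>)" if "f \<in> F" for f
    using bn_nonneg[of f] B_nonneg[OF crit_nonneg[OF that]] \<epsilon> x by simp
  obtain \<omega>0 where "\<omega>0 \<in> space M" using M.not_empty by auto
  then have Fne: "F \<noteq> {}" using fhat[of \<omega>0] by (auto simp: Arg_Min_def split: if_splits)
  have \<Phi>0: "0 \<le> \<Phi> f" if "f \<in> F" for f
    using R_nonneg[OF that] \<rho>_pos[OF _ t0, of "crit f + 1"] crit_nonneg[OF that] rem0[OF that] \<epsilon>
    unfolding \<Phi>_def by (intro add_nonneg_nonneg) auto
  \<comment> \<open>The infimum may not be attained. Of the two copies of
    \<open>\<rho> (crit h + 1) t\<close> given by minimality, one stays in the conclusion, half of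
    the other pays for the error of \<open>h\<close>, and its second half, at least
    \<open>\<rho> 1 t / 2\<close>, pays for this slack.\<close>
  define s where "s = \<rho> 1 t / 2"
  have s0: "0 < s" using \<rho>_pos[OF _ t0, of 1] by (simp add: s_def)
  have "\<exists>f\<in>F. \<Phi> f < (INF f\<in>F. \<Phi> f) + s"
  proof (rule ccontr)
    assume "\<not> ?thesis"
    then have "(INF f\<in>F. \<Phi> f) + s \<le> (INF f\<in>F. \<Phi> f)" using Fne by (intro cINF_greatest) (auto simp: not_less)
    then show False using s0 by simp
  qed
  \<comment> \<open>This \<open>f\<close> is fixed before the sample is drawn, so a single-function
    bound suffices for it; only the estimator \<open>h\<close> needs uniformity.\<close>
  then obtain f where f: "f \<in> F" "\<Phi> f < (INF f\<in>F. \<Phi> f) + s" by auto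
  obtain N1 where N1: "N1 \<in> sets M" "measure M N1 \<le> 8 * exp (- (x + 1))"
    "\<And>\<omega> h. \<omega> \<in> space M - N1 \<Longrightarrow> h \<in> F \<Longrightarrow> crit h \<le> A \<Longrightarrow> \<bar>R h - Rn \<omega> h\<bar> \<le> \<epsilon> * max (R h) (\<rho> (crit h + 1) t)"
    "\<And>\<omega> h. \<omega> \<in> space M - N1 \<Longrightarrow> h \<in> F \<Longrightarrow> crit h \<le> real k \<Longrightarrow> \<bar>R h - Rn \<omega> h\<bar> \<le> \<epsilon> * max (R h) (\<rho> (real k) t)"
    using peeling[OF A x t, of k] by blast
  obtain N2 where N2: "N2 \<in> null_sets M" "{\<omega> \<in> space M. \<not> (\<forall>f\<in>F. 0 \<le> Rn \<omega> f)} \<subseteq> N2"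
    using empirical_risk_nonneg by (auto simp: eventually_ae_filter)
  obtain N3 where N3: "N3 \<in> sets M" "measure M N3 \<le> 2 * exp (- (x + 1))"
    "\<And>\<omega>. \<omega> \<in> space M - N3 \<Longrightarrow>
      \<bar>R f - Rn \<omega> f\<bar> \<le> \<epsilon> / 2 * R f + 2000 * ((bn f + B (crit f) / (\<epsilon> / 2)) * (x + 1) / (real n * (\<epsilon> / 2)))"
    using risk_deviation[OF f(1), of "\<epsilon> / 2" x] \<epsilon> x by auto
  \<comment> \<open>The budget is 2 + 8 + 0 + 2 times \<open>exp (- (x + 1))\<close>.\<close>
  define N where "N = N0 \<union> N1 \<union> N2 \<union> N3"
  have N2s: "N2 \<in> sets M" "measure M N2 = 0" using N2(1) by (auto simp: measure_eq_0_null_sets)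
  have Ns: "N \<in> sets M" unfolding N_def using N0 N1 N2s N3 by auto
  have "measure M N \<le> measure M N0 + measure M N1 + measure M N2 + measure M N3"
    unfolding N_def using N0 N1 N2s N3
    by (intro order_trans[OF measure_Un_le] add_right_mono order_refl) auto
  also have "\<dots> \<le> 12 * exp (- (x + 1))" using N0 N1 N2s N3 by linarith
  also have "\<dots> < 12 * exp (- x)" by simp
  finally have meas: "1 - 12 * exp (- x) < measure M (space M - N)"
    using M.prob_compl[OF Ns] by simp
  show ?thesis
  proof (intro bexI[of _ "space M - N"] conjI meas ballI)
    show "space M - N \<in> sets M" using Ns by auto
    fix \<omega> assume \<omega>: "\<omega> \<in> space M - N"
    then have \<omega>': "\<omega> \<in> space M" "\<omega> \<in> space M - N0" "\<omega> \<in> space M - N1" "\<omega> \<in> space M - N3"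
      and nn: "\<forall>f\<in>F. 0 \<le> Rn \<omega> f" using N2(2) by (auto simp: N_def)
    define h where "h = fhat (sample Z n \<omega>)"
    define \<delta> where "\<delta> = (if min_attained F (objective t (sample Z n \<omega>)) then 0 else 1 / real n)"
    have \<delta>0: "0 \<le> \<delta>" by (simp add: \<delta>_def)
    have hF: "h \<in> F" and min: "(1 + 2 * \<epsilon>) * Rn \<omega> h + 2 * \<rho> (crit h + 1) t
        \<le> (1 + 2 * \<epsilon>) * Rn \<omega> f + 2 * \<rho> (crit f + 1) t + (1 + 2 * \<epsilon>) * \<delta>"
      using objective_minimiser[OF t0 nn f(1) fhat[OF \<omega>'(1)]] by (auto simp: h_def \<delta>_def)
    have Rn0: "0 \<le> Rn \<omega> h" using nn hF by auto
    have \<rho>h: "\<rho> 1 t \<le> \<rho> (crit h + 1) t" using \<rho>_mono[OF t0, of 1 "crit h + 1"] crit_nonneg[OF hF] by simp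
    have \<rho>1: "0 < \<rho> 1 t" using \<rho>_pos[OF _ t0, of 1] by simp
    have "R h \<le> (1 + 2 * \<epsilon>) * Rn \<omega> h + 1 / 2 * \<rho> (crit h + 1) t + 3 * \<delta>"
      using loc[OF \<omega>'(2) nn]
    proof
      assume "crit (fhat (sample Z n \<omega>)) \<le> A"
      then have "\<bar>R h - Rn \<omega> h\<bar> \<le> \<epsilon> * max (R h) (\<rho> (crit h + 1) t)"
        using N1(3)[OF \<omega>'(3) hF] by (simp add: h_def)
      then have "R h \<le> (1 + 2 * \<epsilon>) * Rn \<omega> h + \<epsilon> * \<rho> (crit h + 1) t"
        using Rn0 \<rho>h \<rho>1 \<epsilon> by (intro isomorphic_bound) auto
      moreover have "\<epsilon> * \<rho> (crit h + 1) t \<le> 1 / 2 * \<rho> (crit h + 1) t"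
        using \<epsilon> \<rho>h \<rho>1 by (intro mult_right_mono) auto
      ultimately show ?thesis using \<delta>0 by linarith
    next
      assume *: "\<not> min_attained F (objective t (sample Z n \<omega>)) \<and> crit (fhat (sample Z n \<omega>)) \<le> real k \<and> \<rho> (real k) t \<le> 6 / real n"
      then have "\<bar>R h - Rn \<omega> h\<bar> \<le> \<epsilon> * max (R h) (\<rho> (real k) t)"
        using N1(4)[OF \<omega>'(3) hF] by (simp add: h_def)
      moreover have k0: "0 < \<rho> (real k) t" using \<rho>_pos[OF _ t0, of "real k"] by simp
      ultimately have "R h \<le> (1 + 2 * \<epsilon>) * Rn \<omega> h + \<epsilon> * \<rho> (real k) t"
        using Rn0 \<epsilon> by (intro isomorphic_bound) auto
      \<comment> \<open>As \<open>\<epsilon> < 1 / 2\<close>, the additive error in the extra ball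
        is at most \<open>3 / n\<close>, which here equals \<open>3 * \<delta>\<close>.\<close>
      moreover have "\<epsilon> * \<rho> (real k) t \<le> 1 / 2 * (6 / real n)"
        using * \<epsilon> k0 by (intro mult_mono) auto
      ultimately show ?thesis using * \<rho>h \<rho>1 by (simp add: \<delta>_def)
    qed
    moreover have "(1 + 2 * \<epsilon>) * \<delta> \<le> 2 * \<delta>" using \<epsilon> \<delta>0 by (intro mult_right_mono) auto
    \<comment> \<open>The deviation of \<open>f\<close> is taken at \<open>\<epsilon> / 2\<close>
      because \<open>(1 + 2 * \<epsilon>) * (1 + \<epsilon> / 2) \<le> 1 + 3 * \<epsilon>\<close>
      holds for \<open>\<epsilon> \<le> 1 / 2\<close>. Halving multiplies the remainder by at most
      4, and the factor \<open>1 + 2 * \<epsilon>\<close> by at most 2, so 2000 becomes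
      16000.\<close>
    moreover have "(1 + 2 * \<epsilon>) * Rn \<omega> f + 2 * \<rho> (crit f + 1) t \<le> \<Phi> f"
    proof -
      define q where "q = (bn f + B (crit f) / \<epsilon>) * (x + 1) / (real n * \<epsilon>)"
      have B0: "0 \<le> B (crit f)" using B_nonneg[OF crit_nonneg[OF f(1)]] .
      define W where "W = (bn f + B (crit f) / (\<epsilon> / 2)) * (x + 1) / (real n * (\<epsilon> / 2))"
      have "W \<le> (2 * (bn f + B (crit f) / \<epsilon>)) * (x + 1) / (real n * (\<epsilon> / 2))"
        unfolding W_def using bn_nonneg[of f] B0 \<epsilon> x
        by (intro divide_right_mono mult_right_mono) (auto simp: field_simps)
      also have "\<dots> = 4 * q" using \<epsilon> n_pos by (simp add: q_def field_simps)
      finally have "Rn \<omega> f \<le> (1 + \<epsilon> / 2) * R f + 8000 * q"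
        using N3(3)[OF \<omega>'(4), folded W_def] unfolding distrib_right by linarith
      then have "(1 + 2 * \<epsilon>) * Rn \<omega> f \<le> (1 + 2 * \<epsilon>) * ((1 + \<epsilon> / 2) * R f + 8000 * q)"
        using \<epsilon> by (intro mult_left_mono) auto
      also have "\<dots> = ((1 + 2 * \<epsilon>) * (1 + \<epsilon> / 2)) * R f + (1 + 2 * \<epsilon>) * 8000 * q"
        by (subst distrib_left) (simp only: mult.assoc)
      also have "\<dots> \<le> (1 + 3 * \<epsilon>) * R f + 16000 * q"
      proof (intro add_mono mult_right_mono)
        have "0 \<le> \<epsilon> * (1 / 2 - \<epsilon>)" using \<epsilon> by simp
        then show "(1 + 2 * \<epsilon>) * (1 + \<epsilon> / 2) \<le> 1 + 3 * \<epsilon>" by (simp add: algebra_simps)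
        show "(1 + 2 * \<epsilon>) * 8000 \<le> 16000" using \<epsilon> by simp
      qed (use R_nonneg[OF f(1)] rem0[OF f(1)] in \<open>auto simp: q_def\<close>)
      finally show ?thesis by (simp add: \<Phi>_def q_def)
    qed
    ultimately have "R h + \<rho> (crit h + 1) t \<le> (INF f\<in>F. \<Phi> f) + 5 * \<delta>"
      using min f(2) \<rho>h unfolding s_def by linarith
    also have "5 * \<delta> \<le> (if min_attained F (objective t (sample Z n \<omega>)) then 0 else 16000 / real n)"
      using n_pos by (auto simp: \<delta>_def divide_right_mono)
    finally show "R (fhat (sample Z n \<omega>)) + \<rho> (crit (fhat (sample Z n \<omega>)) + 1) t
      \<le> (INF f\<in>F. (1 + 3 * \<epsilon>) * R f + 2 * \<rho> (crit f + 1) t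
          + 16000 * ((bn f + B (crit f) / \<epsilon>) * (x + 1) / (real n * \<epsilon>)))
        + (if min_attained F (objective t (sample Z n \<omega>)) then 0 else 16000 / real n)"
      by (simp add: h_def \<Phi>_def[abs_def])
  qed
qed

text \<open>Minimality against \<open>f0\<close> bounds \<open>\<rho> (crit h + 1) t\<close> by the
  penalty of \<open>f0\<close> plus half of an empirical term \<open>w\<close>. If the penalty
  dominates, doubling and monotonicity bound \<open>crit h\<close>. If \<open>w\<close> dominates,
  \<open>lam (crit h + 1)\<close> is small and the generalized inverse bounds \<open>crit h\<close>,
  unless the slack \<open>\<delta>\<close> of an approximate minimizer is what made \<open>w\<close>
  large.\<close>

lemma localization:
  assumes lim: "filterlim lam at_top at_top" and x: "0 < x"
    and doubling: "\<And>r x. 0 \<le> r \<Longrightarrow> 0 < x \<Longrightarrow> 2 * \<rho> r x \<le> \<rho> (K1 * (r + 1)) x"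
    and f0: "f0 \<in> F"
    and A: "K1 * (crit f0 + 2) \<le> A"
      "gen_inverse lam ((1 + 2 * \<epsilon>) * (3 * R f0 + 2 * 2000 * (bn f0 + B (crit f0)) * ((x + 1) / real n))) \<le> A"
    and K1: "0 < K1" and t: "t = x + ln A"
  shows "1 \<le> A" and "\<exists>N0\<in>sets M. \<exists>k. measure M N0 \<le> 2 * exp (- (x + 1)) \<and>
    (\<forall>\<omega>\<in>space M - N0. (\<forall>f\<in>F. 0 \<le> Rn \<omega> f) \<longrightarrow> (\<forall>h\<in>Arg_Min n F (objective t (sample Z n \<omega>)).
      crit h \<le> A \<or> (\<not> min_attained F (objective t (sample Z n \<omega>)) \<and> crit h \<le> real k \<and> \<rho> (real k) t \<le> 6 / real n)))"
proof -
  have K1_ge: "1 \<le> K1"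
  proof (rule ccontr)
    assume "\<not> 1 \<le> K1"
    \<comment> \<open>The fixed point of \<open>r \<mapsto> K1 * (r + 1)\<close> for
      \<open>K1 < 1\<close>; there doubling would read
      \<open>2 * \<rho> r x \<le> \<rho> r x\<close> with \<open>\<rho>\<close> positive.\<close>
    define r where "r = K1 / (1 - K1)"
    have r: "0 \<le> r" "K1 * (r + 1) = r" using K1 \<open>\<not> 1 \<le> K1\<close> by (auto simp: r_def field_simps)
    show False using doubling[OF r(1) x] \<rho>_pos[OF r(1) x] by (simp add: r(2))
  qed
  have c0: "0 \<le> crit f0" by (rule crit_nonneg[OF f0])
  have "1 * 1 \<le> K1 * (crit f0 + 2)" using K1_ge c0 by (intro mult_mono) auto
  then show A1: "1 \<le> A" using A by simp
  then have t0: "0 < t" using x by (simp add: t add_pos_nonneg)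
  define q where "q = 2000 * ((bn f0 + B (crit f0)) * (x + 1) / real n)"
  define y where "y = (1 + 2 * \<epsilon>) * (3 * R f0 + 2 * q)"
  have q0: "0 \<le> q" using bn_nonneg[of f0] B_nonneg[OF c0] x by (simp add: q_def)
  have y0: "0 \<le> y" using q0 R_nonneg[OF f0] \<epsilon> by (simp add: y_def)
  have "2 * 2000 * (bn f0 + B (crit f0)) * ((x + 1) / real n) = 2 * q" by (simp add: q_def)
  then have gi: "gen_inverse lam y \<le> A" using A(2) by (simp only: y_def)
  \<comment> \<open>Divergence of \<open>lam\<close> bounds both the set inside the generalized
    inverse, whose supremum would otherwise be meaningless, and the radii collected in
    \<open>S\<close>.\<close>
  obtain b where b: "\<And>r. b \<le> r \<Longrightarrow> max y (6 / real n) + 1 \<le> lam r"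
    using lim unfolding filterlim_at_top eventually_at_top_linorder by blast
  have bdd: "r \<le> b" if "lam r \<le> max y (6 / real n)" for r
    using b[of r] that by (cases "b \<le> r") auto
  define S where "S = {k :: nat. \<rho> (real k) t \<le> 6 / real n}"
  \<comment> \<open>The largest integer radius with penalty at most \<open>6 / n\<close>; it does
    not depend on the sample. For empty \<open>S\<close> its value is unspecified, but the escape
    case below always exhibits an element of \<open>S\<close>.\<close>
  define k where "k = Max S"
  have Sfin: "finite S"
  proof (rule finite_subset)
    show "S \<subseteq> {..nat \<lceil>b\<rceil>}"
    proof
      fix j assume "j \<in> S"
      then have "lam (real j) \<le> 6 / real n" using lam_le_\<rho>[OF _ t0, of "real j"] by (simp add: S_def)
      then have "real j \<le> b" by (intro bdd) simp
      then show "j \<in> {..nat \<lceil>b\<rceil>}" by (simp add: le_nat_iff) linarith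
    qed
  qed simp
  obtain N0 where N0: "N0 \<in> sets M" "measure M N0 \<le> 2 * exp (- (x + 1))"
    "\<And>\<omega>. \<omega> \<in> space M - N0 \<Longrightarrow> \<bar>R f0 - Rn \<omega> f0\<bar> \<le> 1 * R f0 + 2000 * ((bn f0 + B (crit f0) / 1) * (x + 1) / (real n * 1))"
    using risk_deviation[OF f0 _ _ x, of 1] by auto
  show "\<exists>N0\<in>sets M. \<exists>k. measure M N0 \<le> 2 * exp (- (x + 1)) \<and>
    (\<forall>\<omega>\<in>space M - N0. (\<forall>f\<in>F. 0 \<le> Rn \<omega> f) \<longrightarrow> (\<forall>h\<in>Arg_Min n F (objective t (sample Z n \<omega>)).
      crit h \<le> A \<or> (\<not> min_attained F (objective t (sample Z n \<omega>)) \<and> crit h \<le> real k \<and> \<rho> (real k) t \<le> 6 / real n)))"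
  proof (intro bexI[OF _ N0(1)] exI[of _ k] conjI N0(2) ballI impI)
    fix \<omega> h assume \<omega>: "\<omega> \<in> space M - N0" and nn: "\<forall>f\<in>F. 0 \<le> Rn \<omega> f"
      and h: "h \<in> Arg_Min n F (objective t (sample Z n \<omega>))"
    let ?att = "min_attained F (objective t (sample Z n \<omega>))"
    define \<delta> where "\<delta> = (if ?att then 0 else 1 / real n)"
    have \<delta>0: "0 \<le> \<delta>" by (simp add: \<delta>_def)
    have hF: "h \<in> F" and min: "(1 + 2 * \<epsilon>) * Rn \<omega> h + 2 * \<rho> (crit h + 1) t
        \<le> (1 + 2 * \<epsilon>) * Rn \<omega> f0 + 2 * \<rho> (crit f0 + 1) t + (1 + 2 * \<epsilon>) * \<delta>"
      using objective_minimiser[OF t0 nn f0 h] by (auto simp: \<delta>_def)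
    define w where "w = (1 + 2 * \<epsilon>) * (Rn \<omega> f0 + \<delta>)"
    have ch: "0 \<le> crit h" by (rule crit_nonneg[OF hF])
    have "0 \<le> (1 + 2 * \<epsilon>) * Rn \<omega> h" using nn hF \<epsilon> by simp
    then have \<rho>h: "2 * \<rho> (crit h + 1) t \<le> w + 2 * \<rho> (crit f0 + 1) t"
      using min by (simp add: w_def distrib_left)
    \<comment> \<open>The coefficients \<open>3 * R f0\<close> and \<open>2 * q\<close> in
      \<open>y\<close> exceed the \<open>2 * R f0\<close> and \<open>q\<close> of the deviation
      bound at \<open>\<eta> = 1\<close>. This keeps a third of \<open>y\<close> in reserve against
      the slack \<open>2 * \<delta>\<close>.\<close>
    have w_le: "w \<le> 2 / 3 * y + 2 * \<delta>"
    proof -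
      have "Rn \<omega> f0 \<le> 2 * R f0 + q" using N0(3)[OF \<omega>] by (simp add: q_def)
      then have "Rn \<omega> f0 \<le> 2 / 3 * (3 * R f0 + 2 * q)" using q0 by simp
      then have "(1 + 2 * \<epsilon>) * Rn \<omega> f0 \<le> (1 + 2 * \<epsilon>) * (2 / 3 * (3 * R f0 + 2 * q))"
        using \<epsilon> by (intro mult_left_mono) auto
      also have "\<dots> = 2 / 3 * y" unfolding y_def by (rule mult.left_commute)
      finally have "(1 + 2 * \<epsilon>) * Rn \<omega> f0 \<le> 2 / 3 * y" .
      moreover have "(1 + 2 * \<epsilon>) * \<delta> \<le> 2 * \<delta>" using \<epsilon> \<delta>0 by (intro mult_right_mono) auto
      ultimately show ?thesis unfolding w_def distrib_left by linarith
    qed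
    consider "w < 2 * \<rho> (crit f0 + 1) t" | "\<rho> (crit h + 1) t \<le> w" using \<rho>h by linarith
    then show "crit h \<le> A \<or> (\<not> ?att \<and> crit h \<le> real k \<and> \<rho> (real k) t \<le> 6 / real n)"
    proof cases
      case 1
      then have "\<rho> (crit h + 1) t < 2 * \<rho> (crit f0 + 1) t" using \<rho>h by linarith
      also have "\<dots> \<le> \<rho> (K1 * (crit f0 + 2)) t"
        using doubling[OF _ t0, of "crit f0 + 1"] c0 by (simp add: add.assoc)
      finally have "\<rho> (crit h + 1) t < \<rho> (K1 * (crit f0 + 2)) t" .
      then have "crit h + 1 < K1 * (crit f0 + 2)"
        using \<rho>_mono[OF t0, of "K1 * (crit f0 + 2)" "crit h + 1"] K1 c0 by (cases "K1 * (crit f0 + 2) \<le> crit h + 1") auto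
      then show ?thesis using A by simp
    next
      case 2
      show ?thesis
      proof (cases "lam (crit h + 1) \<le> y")
        case True
        have "crit h + 1 \<le> gen_inverse lam y"
          unfolding gen_inverse_def
        proof (rule cSup_upper)
          show "bdd_above (insert 0 {r. 0 < r \<and> lam r \<le> y})"
            using bdd by (intro bdd_aboveI[of _ "max 0 b"]) (auto simp: le_max_iff_disj)
        qed (use True ch in auto)
        then show ?thesis using gi by simp
      next
        case False
        then have "y < \<rho> (crit h + 1) t" using lam_le_\<rho>[OF _ t0, of "crit h + 1"] ch by simp
        \<comment> \<open>From \<open>y < w \<le> 2 / 3 * y + 2 * \<delta>\<close>. In particular
          \<open>\<delta>\<close> is not 0, so the minimum is not attained, and then
          \<open>w \<le> 6 / n\<close>: the origin of the constant 6.\<close>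
        then have y6: "y < 6 * \<delta>" using 2 w_le by simp
        then have natt: "\<not> ?att" and \<delta>: "\<delta> = 1 / real n" using y0 by (auto simp: \<delta>_def split: if_splits)
        have r6: "\<rho> (crit h + 1) t \<le> 6 / real n" using 2 w_le y6 \<delta> by simp
        define j where "j = nat \<lceil>crit h\<rceil>"
        have j: "crit h \<le> real j" "real j \<le> crit h + 1" using ch unfolding j_def by linarith+
        then have "\<rho> (real j) t \<le> \<rho> (crit h + 1) t" by (intro \<rho>_mono t0) auto
        then have "j \<in> S" using r6 by (simp add: S_def)
        then have "k \<in> S" "j \<le> k" unfolding k_def using Sfin by (auto intro: Max_in)
        then show ?thesis using natt j by (auto simp: S_def)
      qed
    qed
  qed
qed

end

text \<open>In case (i), \<open>max 1 C\<close> keeps \<open>ln (\<alpha> x)\<close> nonnegative and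
  so the second argument of \<open>\<rho>\<close> positive; in case (ii), doubling already forces
  \<open>1 \<le> \<alpha> x\<close>. An approximate minimizer may lose \<open>1 / n\<close> in the
  objective, and the last term charges for this exactly when the minimum is not attained. The
  estimator is an arbitrary map of the sample, so the inequality is asserted on a measurable event
  \<open>A\<close> of large probability. The witnesses 2000 for \<open>c0\<close> and
  \<open>K'\<close> come from the deviation bounds, and 16000 is
  \<open>2 * 4 * 2000\<close>.\<close>

theorem theoremB:
  shows "\<exists>c0>0::real. \<exists>c1>0::real. \<exists>K'>0::real.
    \<forall>(M :: 'w measure) (P :: 'z measure) (Z :: nat \<Rightarrow> 'w \<Rightarrow> 'z) (n :: nat)
      (loss :: ('z \<Rightarrow> real) \<Rightarrow> 'z \<Rightarrow> real) (F :: ('z \<Rightarrow> real) set)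
      (crit :: ('z \<Rightarrow> real) \<Rightarrow> real)
      (\<phi> :: real \<Rightarrow> real) (B :: real \<Rightarrow> real) (\<epsilon> :: real)
      (lam :: real \<Rightarrow> real) (\<rho> :: real \<Rightarrow> real \<Rightarrow> real) (\<alpha> :: real \<Rightarrow> real).
      1 \<le> n \<and> prob_space M \<and> prob_space P \<and>
      prob_space.indep_vars M (\<lambda>_. P) Z {1..n} \<and>
      (\<forall>i\<in>{1..n}. distr M P (Z i) = P) \<and>
      F \<subseteq> borel_measurable P \<and>
      (\<forall>f\<in>F. loss f \<in> borel_measurable P) \<and>
      (\<forall>f\<in>F. 0 \<le> crit f) \<and>
      (\<forall>r\<ge>0. \<forall>l>0. pointwise_separable P (star_level P (loss ` crit_ball F crit r) l)) \<and>
      (\<forall>f\<in>F. AE z in P. 0 \<le> loss f z) \<and>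
      mono_on {0..} \<phi> \<and> mono_on {0..} B \<and> (\<forall>r\<ge>0. 0 \<le> B r) \<and>
      (\<forall>r\<ge>0. \<forall>f\<in>crit_ball F crit r.
         b_class M Z n (loss ` crit_ball F crit r) \<le> ereal (\<phi> r) \<and>
         mean P (\<lambda>z. (loss f z)\<^sup>2) \<le> B r * mean P (loss f) + (B r)\<^sup>2 / real n) \<and>
      0 < \<epsilon> \<and> \<epsilon> < 1/2 \<and>
      (\<forall>r\<ge>0. 0 < lam r \<and>
         (\<integral>\<^sup>+\<omega>. sup_dev P n (sample Z n \<omega>)
              (star_level P (loss ` crit_ball F crit r) (lam r)) \<partial>M)
           \<le> ennreal (\<epsilon> / 4 * lam r)) \<and>
      (\<forall>x>0. mono_on {0..} (\<lambda>r. \<rho> r x)) \<and>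
      (\<forall>r\<ge>0. \<forall>x>0.
         max (lam r) (c0 * ((\<phi> r + B r / \<epsilon>) * (x + 1) / (real n * \<epsilon>))) \<le> \<rho> r x) \<and>
      ((\<exists>C>0. (\<forall>f\<in>F. crit f \<le> C) \<and> (\<forall>x>0. \<alpha> x = max 1 C))
       \<or>
       (filterlim lam at_top at_top \<and>
        (\<exists>K1>0. (\<forall>r\<ge>0. \<forall>x>0. 2 * \<rho> r x \<le> \<rho> (K1 * (r + 1)) x) \<and>
          (\<exists>f0 \<in> (\<Union>r\<in>{0..}. crit_ball F crit r).
             \<forall>x>0. max (K1 * (crit f0 + 2))
               (gen_inverse lam
                  ((1 + 2 * \<epsilon>) *
                   (3 * mean P (loss f0) +
                    2 * K' * (real_of_ereal (b_fun M Z n (loss f0)) + B (crit f0))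
                      * ((x + 1) / real n))))
               \<le> \<alpha> x))))
      \<longrightarrow>
      (\<forall>x>0. \<forall>fhat :: (nat \<Rightarrow> 'z) \<Rightarrow> 'z \<Rightarrow> real.
         let t = x + ln (\<alpha> x);
             J = (\<lambda>d f. emp_mean n d (loss f) + 2 / (1 + 2 * \<epsilon>) * \<rho> (crit f + 1) t)
         in (\<forall>\<omega>\<in>space M. fhat (sample Z n \<omega>) \<in> Arg_Min n F (J (sample Z n \<omega>))) \<longrightarrow>
            (\<exists>A\<in>sets M. measure M A > 1 - 12 * exp (- x) \<and>
               (\<forall>\<omega>\<in>A. let d = sample Z n \<omega> in
                  mean P (loss (fhat d)) + \<rho> (crit (fhat d) + 1) t
                    \<le> (INF f\<in>F. (1 + 3 * \<epsilon>) * mean P (loss f) + 2 * \<rho> (crit f + 1) t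
                          + c1 * ((real_of_ereal (b_fun M Z n (loss f)) + B (crit f) / \<epsilon>)
                                  * (x + 1) / (real n * \<epsilon>)))
                      + (if min_attained F (J d) then 0 else c1 / real n))))"
proof (rule exI[of _ 2000], rule conjI, simp, rule exI[of _ 16000], rule conjI, simp,
    rule exI[of _ 2000], rule conjI, simp, intro allI impI)
  fix M :: "'w measure" and P :: "'z measure" and Z n loss F crit and \<phi> B :: "real \<Rightarrow> real" and \<epsilon> lam \<rho> \<alpha> x
    and fhat :: "(nat \<Rightarrow> 'z) \<Rightarrow> 'z \<Rightarrow> real"
  assume H: "1 \<le> n \<and> prob_space M \<and> prob_space P \<and>
      prob_space.indep_vars M (\<lambda>_. P) Z {1..n} \<and>
      (\<forall>i\<in>{1..n}. distr M P (Z i) = P) \<and>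
      F \<subseteq> borel_measurable P \<and>
      (\<forall>f\<in>F. loss f \<in> borel_measurable P) \<and>
      (\<forall>f\<in>F. 0 \<le> crit f) \<and>
      (\<forall>r\<ge>0. \<forall>l>0. pointwise_separable P (star_level P (loss ` crit_ball F crit r) l)) \<and>
      (\<forall>f\<in>F. AE z in P. 0 \<le> loss f z) \<and>
      mono_on {0..} \<phi> \<and> mono_on {0..} B \<and> (\<forall>r\<ge>0. 0 \<le> B r) \<and>
      (\<forall>r\<ge>0. \<forall>f\<in>crit_ball F crit r.
         b_class M Z n (loss ` crit_ball F crit r) \<le> ereal (\<phi> r) \<and>
         mean P (\<lambda>z. (loss f z)\<^sup>2) \<le> B r * mean P (loss f) + (B r)\<^sup>2 / real n) \<and>
      0 < \<epsilon> \<and> \<epsilon> < 1/2 \<and>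
      (\<forall>r\<ge>0. 0 < lam r \<and>
         (\<integral>\<^sup>+\<omega>. sup_dev P n (sample Z n \<omega>)
              (star_level P (loss ` crit_ball F crit r) (lam r)) \<partial>M)
           \<le> ennreal (\<epsilon> / 4 * lam r)) \<and>
      (\<forall>x>0. mono_on {0..} (\<lambda>r. \<rho> r x)) \<and>
      (\<forall>r\<ge>0. \<forall>x>0.
         max (lam r) (2000 * ((\<phi> r + B r / \<epsilon>) * (x + 1) / (real n * \<epsilon>))) \<le> \<rho> r x) \<and>
      ((\<exists>C>0. (\<forall>f\<in>F. crit f \<le> C) \<and> (\<forall>x>0. \<alpha> x = max 1 C))
       \<or>
       (filterlim lam at_top at_top \<and>
        (\<exists>K1>0. (\<forall>r\<ge>0. \<forall>x>0. 2 * \<rho> r x \<le> \<rho> (K1 * (r + 1)) x) \<and>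
          (\<exists>f0 \<in> (\<Union>r\<in>{0..}. crit_ball F crit r).
             \<forall>x>0. max (K1 * (crit f0 + 2))
               (gen_inverse lam
                  ((1 + 2 * \<epsilon>) *
                   (3 * mean P (loss f0) +
                    2 * 2000 * (real_of_ereal (b_fun M Z n (loss f0)) + B (crit f0))
                      * ((x + 1) / real n))))
               \<le> \<alpha> x))))" and x: "(0::real) < x"
  then interpret M: prob_space M + P: prob_space P by auto
  interpret regularized_erm M P Z n loss F crit \<phi> B lam \<epsilon> \<rho>
    using H
    by unfold_locales (auto simp: mono_on_def)
  let ?t = "x + ln (\<alpha> x)"
  let ?claim = "\<exists>E\<in>sets M. measure M E > 1 - 12 * exp (- x) \<and> (\<forall>\<omega>\<in>E.
    R (fhat (sample Z n \<omega>)) + \<rho> (crit (fhat (sample Z n \<omega>)) + 1) ?t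
      \<le> (INF f\<in>F. (1 + 3 * \<epsilon>) * R f + 2 * \<rho> (crit f + 1) ?t
          + 16000 * ((bn f + B (crit f) / \<epsilon>) * (x + 1) / (real n * \<epsilon>)))
        + (if min_attained F (objective ?t (sample Z n \<omega>)) then 0 else 16000 / real n))"
  have claim: ?claim
    if fhat: "\<And>\<omega>. \<omega> \<in> space M \<Longrightarrow> fhat (sample Z n \<omega>) \<in> Arg_Min n F (objective ?t (sample Z n \<omega>))"
  proof -
    from H consider (bounded) C where "C > 0" "\<forall>f\<in>F. crit f \<le> C" "\<alpha> x = max 1 C"
      | (growing) K1 f0 where "filterlim lam at_top at_top" "K1 > 0"
          "\<And>r x. 0 \<le> r \<Longrightarrow> 0 < x \<Longrightarrow> 2 * \<rho> r x \<le> \<rho> (K1 * (r + 1)) x" "f0 \<in> F"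
          "K1 * (crit f0 + 2) \<le> \<alpha> x"
          "gen_inverse lam ((1 + 2 * \<epsilon>) * (3 * R f0 + 2 * 2000 * (bn f0 + B (crit f0)) * ((x + 1) / real n))) \<le> \<alpha> x"
      using x by (elim conjE disjE exE bexE) (auto simp: crit_ball_def)
    then show ?thesis
    proof cases
      case bounded
      show ?thesis
      \<comment> \<open>Every member of \<open>F\<close> has \<open>crit\<close> at most
        \<open>\<alpha> x\<close>, so the first alternative of \<open>loc\<close> holds surely, with
        an empty exceptional set and an arbitrary \<open>k\<close>.\<close>
      proof (rule oracle_inequality[OF _ x refl fhat, where ?N0.0 = "{}" and k = 0])
        show "crit (fhat (sample Z n \<omega>)) \<le> \<alpha> x \<or> (\<not> min_attained F (objective ?t (sample Z n \<omega>)) \<and>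
          crit (fhat (sample Z n \<omega>)) \<le> real 0 \<and> \<rho> (real 0) ?t \<le> 6 / real n)" if "\<omega> \<in> space M - {}" for \<omega>
          using bounded fhat[of \<omega>] that by (auto simp: Arg_Min_def split: if_splits)
      qed (use bounded in auto)
    next
      case growing
      note l = localization[OF growing(1) x growing(3-6) growing(2) refl]
      obtain N0 k where N0: "N0 \<in> sets M" "measure M N0 \<le> 2 * exp (- (x + 1))"
        "\<And>\<omega> h. \<omega> \<in> space M - N0 \<Longrightarrow> \<forall>f\<in>F. 0 \<le> Rn \<omega> f \<Longrightarrow> h \<in> Arg_Min n F (objective ?t (sample Z n \<omega>)) \<Longrightarrow>
          crit h \<le> \<alpha> x \<or> (\<not> min_attained F (objective ?t (sample Z n \<omega>)) \<and> crit h \<le> real k \<and> \<rho> (real k) ?t \<le> 6 / real n)"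
        using l(2) by blast
      show ?thesis
        using fhat N0(3) by (intro oracle_inequality[OF l(1) x refl fhat N0(1,2), where k = k]) auto
    qed
  qed
  show "let t = x + ln (\<alpha> x);
             J = (\<lambda>d f. emp_mean n d (loss f) + 2 / (1 + 2 * \<epsilon>) * \<rho> (crit f + 1) t)
         in (\<forall>\<omega>\<in>space M. fhat (sample Z n \<omega>) \<in> Arg_Min n F (J (sample Z n \<omega>))) \<longrightarrow>
            (\<exists>A\<in>sets M. measure M A > 1 - 12 * exp (- x) \<and>
               (\<forall>\<omega>\<in>A. let d = sample Z n \<omega> in
                  mean P (loss (fhat d)) + \<rho> (crit (fhat d) + 1) t
                    \<le> (INF f\<in>F. (1 + 3 * \<epsilon>) * mean P (loss f) + 2 * \<rho> (crit f + 1) t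
                          + 16000 * ((real_of_ereal (b_fun M Z n (loss f)) + B (crit f) / \<epsilon>)
                                  * (x + 1) / (real n * \<epsilon>)))
                      + (if min_attained F (J d) then 0 else 16000 / real n)))"
    using claim unfolding Let_def objective_def by simp
qed

end
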